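(* Let $X$ be a perfect, compact plane set such that $\mathbb{C}\setminus X$ is connected and let $r>0$. Suppose that $\mathcal{F}$ is a useful set of paths in $X$ with the following properties: $\overline{\mathcal{F}(X)}=X$, the set of lengths of paths in $\mathcal{F}$ is bounded above, every pair of distinct points of $X$ which are in the same component of $X$ can be joined by a path in $\mathcal{F}$, and $\mathcal{F}$ includes all injective rectifiable paths in $X$ of length $\le r$. Set $D=\mathcal{D}^1_{\mathcal{F}}(X)$. Then $D=D_R=D_P$ and $\mathcal{D}^1_{\mathcal{F}}(X)$ is the completion of $D^1(X)$.
   Context: Perfect means non-empty without isolated points. A function $f:X\to\mathbb{C}$ is complex-differentiable at $a\in X$ if $f'(a)=\lim_{z\to a,\,z\in X\setminus\{a\}}\frac{f(z)-f(a)}{z-a}$ exists. $D^1(X)$ is the space of continuously complex-differentiable functions on $X$, with norm $\|f\|=\|f\|_\infty+\|f'\|_\infty$ (supremum norms on $X$). A path in $X$ is a continuous map $\gamma:[a,b]\to X$ with $a<b$ real; its endpoints are $\gamma^-=\gamma(a)$ and $\gamma^+=\gamma(b)$. A Jordan arc is an injective path. A set $\mathcal{F}$ of paths in $X$ is useful if every path in $\mathcal{F}$ is a rectifiable Jordan arc and, whenever $\gamma\in\mathcal{F}$ is defined on $[a,b]$ and $[c,d]\subseteq[a,b]$ with $c<d$, the restriction of $\gamma$ to $[c,d]$ is in $\mathcal{F}$. Write $\mathcal{F}(X)=\bigcup_{\gamma\in\mathcal{F}}\mathrm{Image}(\gamma)$. For $f\in C(X)$ (continuous complex-valued functions on $X$),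 a function $g\in C(X)$ is an $\mathcal{F}$-derivative of $f$ if $\int_\gamma g(z)\,dz=f(\gamma^+)-f(\gamma^-)$ for every $\gamma\in\mathcal{F}$. $\mathcal{D}^1_{\mathcal{F}}(X)$ is the set of $f\in C(X)$ which have an $\mathcal{F}$-derivative in $C(X)$. When $\overline{\mathcal{F}(X)}=X$ the $\mathcal{F}$-derivative $g$ of $f$ is unique, $\mathcal{D}^1_{\mathcal{F}}(X)$ is a Banach algebra with norm $\|f\|=\|f\|_\infty+\|g\|_\infty$, and $D^1(X)$ is contained isometrically in it; "$\mathcal{D}^1_{\mathcal{F}}(X)$ is the completion of $D^1(X)$" means that $D^1(X)$ is dense in $\mathcal{D}^1_{\mathcal{F}}(X)$. $D_R$ is the closure in $D$ of the set of (restrictions to $X$ of) rational functions with poles off $X$, and $D_P$ is the closure in $D$ of the set of (restrictions to $X$ of) polynomial functions in $z$. *)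

theory Defs
  imports "HOL-Analysis.Analysis" "HOL-Computational_Algebra.Polynomial"
begin

definition perfect :: "complex set \<Rightarrow> bool" where
  "perfect X \<longleftrightarrow> X \<noteq> {} \<and> \<not> (\<exists>x. x isolated_in X)"

text \<open>
  Functions on \<open>X\<close> are rendered as functions of type \<^typ>\<open>complex \<Rightarrow> complex\<close> that are
  \<^const>\<open>extensional\<close> on \<open>X\<close>, so that equality in HOL is equality of functions on \<open>X\<close>.
\<close>

definition C_space :: "complex set \<Rightarrow> (complex \<Rightarrow> complex) set" where
  "C_space X = {f \<in> extensional X. continuous_on X f}"

definition sup_norm :: "complex set \<Rightarrow> (complex \<Rightarrow> complex) \<Rightarrow> real" where
  "sup_norm X f = (SUP z\<in>X. norm (f z))"

text \<open>The filter \<open>at a within X\<close> already excludes the point \<open>a\<close> itself.\<close>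

definition cderiv :: "complex set \<Rightarrow> (complex \<Rightarrow> complex) \<Rightarrow> complex \<Rightarrow> complex" where
  "cderiv X f a = Lim (at a within X) (\<lambda>z. (f z - f a) / (z - a))"

definition D1_space :: "complex set \<Rightarrow> (complex \<Rightarrow> complex) set" where
  "D1_space X = {f \<in> extensional X.
     (\<forall>a\<in>X. f field_differentiable (at a within X)) \<and> continuous_on X (cderiv X f)}"

definition D1_norm :: "complex set \<Rightarrow> (complex \<Rightarrow> complex) \<Rightarrow> real" where
  "D1_norm X f = sup_norm X f + sup_norm X (cderiv X f)"

text \<open>
  The library's \<^const>\<open>path\<close> is fixed to the parameter interval \<open>{0..1}\<close>; here the interval
  varies and is part of the path, and the map is extensional on it.
\<close>

datatype plane_path = Plane_Path (lo: real) (hi: real) (fn: "real \<Rightarrow> complex")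

definition path_in :: "complex set \<Rightarrow> plane_path \<Rightarrow> bool" where
  "path_in X \<gamma> \<longleftrightarrow> lo \<gamma> < hi \<gamma> \<and> fn \<gamma> \<in> extensional {lo \<gamma>..hi \<gamma>} \<and>
     continuous_on {lo \<gamma>..hi \<gamma>} (fn \<gamma>) \<and> fn \<gamma> ` {lo \<gamma>..hi \<gamma>} \<subseteq> X"

definition start_pt :: "plane_path \<Rightarrow> complex" where
  "start_pt \<gamma> = fn \<gamma> (lo \<gamma>)"

definition end_pt :: "plane_path \<Rightarrow> complex" where
  "end_pt \<gamma> = fn \<gamma> (hi \<gamma>)"

definition image_of :: "plane_path \<Rightarrow> complex set" where
  "image_of \<gamma> = fn \<gamma> ` {lo \<gamma>..hi \<gamma>}"

definition subarc :: "real \<Rightarrow> real \<Rightarrow> plane_path \<Rightarrow> plane_path" where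
  "subarc c d \<gamma> = Plane_Path c d (restrict (fn \<gamma>) {c..d})"

definition jordan_arc_in :: "complex set \<Rightarrow> plane_path \<Rightarrow> bool" where
  "jordan_arc_in X \<gamma> \<longleftrightarrow> path_in X \<gamma> \<and> inj_on (fn \<gamma>) {lo \<gamma>..hi \<gamma>}"

definition variation_sum :: "plane_path \<Rightarrow> real set set \<Rightarrow> real" where
  "variation_sum \<gamma> d = (\<Sum>k\<in>d. norm (fn \<gamma> (Sup k) - fn \<gamma> (Inf k)))"

definition rectifiable :: "plane_path \<Rightarrow> bool" where
  "rectifiable \<gamma> \<longleftrightarrow> bdd_above (variation_sum \<gamma> ` {d. d division_of {lo \<gamma>..hi \<gamma>}})"

text \<open>Meaningful for rectifiable paths only.\<close>

definition path_len :: "plane_path \<Rightarrow> real" where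
  "path_len \<gamma> = (SUP d \<in> {d. d division_of {lo \<gamma>..hi \<gamma>}}. variation_sum \<gamma> d)"

text \<open>
  The integral of \<open>g(z) dz\<close> along a path, as a Riemann--Stieltjes integral (limit of tagged
  sums as the mesh tends to 0); the library's contour integral needs piecewise \<open>C\<^sup>1\<close> paths.
\<close>

definition has_path_integral ::
    "(complex \<Rightarrow> complex) \<Rightarrow> complex \<Rightarrow> plane_path \<Rightarrow> bool" where
  "has_path_integral g I \<gamma> \<longleftrightarrow>
     (\<forall>e>0. \<exists>\<delta>>0. \<forall>p. p tagged_division_of {lo \<gamma>..hi \<gamma>} \<and> (\<lambda>t. ball t \<delta>) fine p \<longrightarrow>
        norm ((\<Sum>(t, k)\<in>p. g (fn \<gamma> t) * (fn \<gamma> (Sup k) - fn \<gamma> (Inf k))) - I) < e)"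

definition useful :: "complex set \<Rightarrow> plane_path set \<Rightarrow> bool" where
  "useful X F \<longleftrightarrow> (\<forall>\<gamma>\<in>F. jordan_arc_in X \<gamma> \<and> rectifiable \<gamma> \<and>
     (\<forall>c d. lo \<gamma> \<le> c \<and> c < d \<and> d \<le> hi \<gamma> \<longrightarrow> subarc c d \<gamma> \<in> F))"

definition F_derivative ::
    "plane_path set \<Rightarrow> complex set \<Rightarrow> (complex \<Rightarrow> complex) \<Rightarrow> (complex \<Rightarrow> complex) \<Rightarrow> bool" where
  "F_derivative F X f g \<longleftrightarrow> g \<in> C_space X \<and>
     (\<forall>\<gamma>\<in>F. has_path_integral g (f (end_pt \<gamma>) - f (start_pt \<gamma>)) \<gamma>)"

definition DF_space :: "plane_path set \<Rightarrow> complex set \<Rightarrow> (complex \<Rightarrow> complex) set" where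
  "DF_space F X = {f \<in> C_space X. \<exists>g. F_derivative F X f g}"

text \<open>
  The \<open>F\<close>-derivative is unique, and \<open>DF_norm\<close> is meaningful, for members of \<^const>\<open>DF_space\<close>
  when the images of the paths in \<open>F\<close> have dense union in \<open>X\<close>.
\<close>

definition F_deriv ::
    "plane_path set \<Rightarrow> complex set \<Rightarrow> (complex \<Rightarrow> complex) \<Rightarrow> complex \<Rightarrow> complex" where
  "F_deriv F X f = (THE g. F_derivative F X f g)"

definition DF_norm :: "plane_path set \<Rightarrow> complex set \<Rightarrow> (complex \<Rightarrow> complex) \<Rightarrow> real" where
  "DF_norm F X f = sup_norm X f + sup_norm X (F_deriv F X f)"

definition DF_closure ::
    "plane_path set \<Rightarrow> complex set \<Rightarrow> (complex \<Rightarrow> complex) set \<Rightarrow> (complex \<Rightarrow> complex) set" where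
  "DF_closure F X S = {f \<in> DF_space F X.
     \<forall>e>0. \<exists>h \<in> S \<inter> DF_space F X. DF_norm F X (\<lambda>z\<in>X. f z - h z) < e}"

definition rational_funs :: "complex set \<Rightarrow> (complex \<Rightarrow> complex) set" where
  "rational_funs X = {(\<lambda>z\<in>X. poly p z / poly q z) | p q. \<forall>z\<in>X. poly q z \<noteq> 0}"

definition polynomial_funs :: "complex set \<Rightarrow> (complex \<Rightarrow> complex) set" where
  "polynomial_funs X = {(\<lambda>z\<in>X. poly p z) | p. True}"

definition D_R :: "plane_path set \<Rightarrow> complex set \<Rightarrow> (complex \<Rightarrow> complex) set" where
  "D_R F X = DF_closure F X (rational_funs X)"

definition D_P :: "plane_path set \<Rightarrow> complex set \<Rightarrow> (complex \<Rightarrow> complex) set" where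
  "D_P F X = DF_closure F X (polynomial_funs X)"

definition DF_completes_D1 :: "plane_path set \<Rightarrow> complex set \<Rightarrow> bool" where
  "DF_completes_D1 F X \<longleftrightarrow> D1_space X \<subseteq> DF_space F X \<and>
     (\<forall>f\<in>D1_space X. DF_norm F X f = D1_norm X f) \<and>
     DF_closure F X (D1_space X) = DF_space F X"

end

theory Submission
  imports Defs "HOL-Complex_Analysis.Complex_Analysis"
begin

text \<open>
  Let \<open>f\<close> have the \<open>F\<close>-derivative \<open>g\<close>. Short segments in \<open>X\<close> belong to \<open>F\<close>, so \<open>g = f'\<close> is
  holomorphic in the interior of \<open>X\<close>, and by Mergelyan's theorem some polynomial \<open>p\<close> is uniformly
  close to \<open>g\<close> on \<open>X\<close>. If \<open>P' = p\<close>, then \<open>u = f - P\<close> varies little on each component of \<open>X\<close>,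
  because the lengths of the paths in \<open>F\<close> are bounded. Components of \<open>X\<close> have arbitrarily small
  clopen neighbourhoods, so \<open>u\<close> is close to a locally constant function with finitely many values, and
  it remains to approximate the indicator function of a clopen set by polynomials with small
  derivatives.

  Mergelyan's theorem is obtained by Vitushkin localisation at the scale of a unit lattice. A
  continuous \<open>f\<close> is a sum of localised functions \<open>f\<^sub>c\<close>, and \<open>f\<^sub>c = 0\<close> if \<open>f\<close> is holomorphic near the
  lattice point \<open>c\<close>. Otherwise there is a connected subset of \<open>- X\<close> of diameter at least 1 near \<open>c\<close>,
  joining \<open>p\<close> to \<open>b\<close> say, and \<open>z - (p + b) / 2 - sqrt ((z - p) (z - b))\<close> is holomorphic off this set;
  it and its square match the first two Laurent coefficients of \<open>f\<^sub>c\<close> at infinity. The errors are then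
  \<open>O(\<omega> \<bar>z - c\<bar> powr (-3))\<close>, where \<open>\<omega>\<close> is the oscillation of \<open>f\<close> at unit scale, so their sum over
  the lattice is \<open>O(\<omega>)\<close>; rescaling makes \<open>\<omega>\<close> small.
\<close>

section \<open>Uniform limits of polynomials\<close>

text \<open>Two obstacles shape the proof. \<open>X\<close> may have infinitely many components, and
  integrals along paths in \<open>F\<close> cannot compare values on different components; hence the
  detour through clopen sets. And a continuous function need not have a \<open>dbar\<close>, so
  localisation lets the derivative fall on the cut-off instead. Matching two Laurent coefficients is
  dictated by the dimension: over a planar lattice the inverse squares of the distances have a
  divergent sum, the inverse cubes a convergent one. Connectedness of \<open>- X\<close> enters in
  two ways: poles can be pushed to infinity as in Runge's theorem, and from each point of
  \<open>- X\<close> a connected open subset reaches distance 1. The latter says that the complement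
  has large analytic capacity wherever a correction is needed; the square root makes this explicit
  and replaces a conformal map. Approximants are handled as members of the uniform closure of the
  polynomials, an algebra stable under exponentials and small logarithms, so that they can be given
  by closed formulas.\<close>

definition poly_limit :: "complex set \<Rightarrow> (complex \<Rightarrow> complex) \<Rightarrow> bool" where
  "poly_limit X f \<longleftrightarrow> (\<forall>e>0. \<exists>p. \<forall>z\<in>X. norm (f z - poly p z) < e)"

lemma poly_limit_poly [simp]: "poly_limit X (poly p)"
  unfolding poly_limit_def by (metis diff_self norm_zero)

lemma poly_limit_cong: "(\<And>z. z \<in> X \<Longrightarrow> f z = g z) \<Longrightarrow> poly_limit X f \<longleftrightarrow> poly_limit X g"
  unfolding poly_limit_def by simp

lemma poly_limit_const [simp]: "poly_limit X (\<lambda>z. c)"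
  using poly_limit_poly[of X "[:c:]"] by (rule iffD1[OF poly_limit_cong, rotated]) simp

lemma poly_limit_ident [simp]: "poly_limit X (\<lambda>z. z)"
  using poly_limit_poly[of X "[:0,1:]"] by (rule iffD1[OF poly_limit_cong, rotated]) simp

lemma poly_limit_closed:
  assumes "\<And>e. e > 0 \<Longrightarrow> \<exists>g. poly_limit X g \<and> (\<forall>z\<in>X. norm (f z - g z) < e)"
  shows "poly_limit X f"
  unfolding poly_limit_def
proof (intro allI impI)
  fix e :: real assume "e > 0"
  then obtain g where g: "poly_limit X g" "\<forall>z\<in>X. norm (f z - g z) < e/2"
    using assms[of "e/2"] by auto
  then obtain p where p: "\<forall>z\<in>X. norm (g z - poly p z) < e/2"
    unfolding poly_limit_def using \<open>e > 0\<close> half_gt_zero by blast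
  have "norm (f z - poly p z) < e" if "z \<in> X" for z
    using norm_triangle_lt[of "f z - g z" "g z - poly p z" e] g(2) p that by force
  then show "\<exists>p. \<forall>z\<in>X. norm (f z - poly p z) < e" by blast
qed

lemma poly_limit_add:
  assumes "poly_limit X f" "poly_limit X g"
  shows "poly_limit X (\<lambda>z. f z + g z)"
  unfolding poly_limit_def
proof (intro allI impI)
  fix e :: real assume "e > 0"
  then obtain p q where "\<forall>z\<in>X. norm (f z - poly p z) < e/2" "\<forall>z\<in>X. norm (g z - poly q z) < e/2"
    using assms unfolding poly_limit_def by (meson half_gt_zero)
  then have "\<forall>z\<in>X. norm (f z + g z - poly (p + q) z) < e"
    by (smt (verit) add_diff_add field_sum_of_halves norm_triangle_ineq poly_add)
  then show "\<exists>p. \<forall>z\<in>X. norm (f z + g z - poly p z) < e" by blast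
qed

lemma poly_limit_bounded:
  assumes "compact X" "poly_limit X f"
  obtains B where "B > 0" "\<And>z. z \<in> X \<Longrightarrow> norm (f z) \<le> B"
proof -
  obtain p where p: "\<forall>z\<in>X. norm (f z - poly p z) < 1"
    using assms unfolding poly_limit_def by (meson zero_less_one)
  have "compact (poly p ` X)"
    by (intro compact_continuous_image assms continuous_intros)
  then obtain B where "B > 0" "\<And>z. z \<in> X \<Longrightarrow> norm (poly p z) \<le> B"
    using compact_imp_bounded bounded_pos by (metis image_eqI)
  then have "norm (f z) \<le> B + 1" if "z \<in> X" for z
    using p that norm_triangle_sub[of "f z" "poly p z"] by force
  with \<open>B > 0\<close> show ?thesis by (intro that[of "B+1"]) auto
qed

lemma poly_limit_mult:
  assumes "compact X" "poly_limit X f" "poly_limit X g"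
  shows "poly_limit X (\<lambda>z. f z * g z)"
  unfolding poly_limit_def
proof (intro allI impI)
  fix e :: real assume e: "e > 0"
  obtain B where B: "B > 0" "\<And>z. z \<in> X \<Longrightarrow> norm (f z) \<le> B"
    using poly_limit_bounded[OF assms(1,2)] by blast
  obtain C where C: "C > 0" "\<And>z. z \<in> X \<Longrightarrow> norm (g z) \<le> C"
    using poly_limit_bounded[OF assms(1,3)] by blast
  define d where "d = min 1 (e / (B + C + 2))"
  have d: "d > 0" "d \<le> 1" using e B C by (auto simp: d_def)
  have "d \<le> e / (B + C + 2)" by (simp add: d_def)
  then have d3: "d * (B + C + 2) \<le> e"
    using B(1) C(1) by (simp add: pos_le_divide_eq)
  obtain p where p: "\<forall>z\<in>X. norm (f z - poly p z) < d"
    using assms d unfolding poly_limit_def by blast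
  obtain q where q: "\<forall>z\<in>X. norm (g z - poly q z) < d"
    using assms d unfolding poly_limit_def by blast
  have "norm (f z * g z - poly (p * q) z) < e" if "z \<in> X" for z
  proof -
    have "f z * g z - poly (p * q) z = f z * (g z - poly q z) + (f z - poly p z) * (g z - (g z - poly q z))"
      by (simp add: algebra_simps)
    also have "norm \<dots> \<le> norm (f z) * norm (g z - poly q z) + norm (f z - poly p z) * norm (g z - (g z - poly q z))"
      by (rule order_trans[OF norm_triangle_ineq]) (simp add: norm_mult)
    also have "\<dots> \<le> B * d + d * (C + d)"
    proof (intro add_mono mult_mono)
      show "norm (g z - (g z - poly q z)) \<le> C + d"
        using C(2)[OF that] q that norm_triangle_ineq4[of "g z" "g z - poly q z"]
        by (smt (verit, ccfv_SIG))
    qed (use B p q d that in \<open>auto simp: less_imp_le\<close>)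
    also have "\<dots> \<le> d * (B + C + 1)"
      using d by (simp add: algebra_simps mult_left_le)
    also have "\<dots> < e" using d d3 by (simp add: algebra_simps)
    finally show ?thesis .
  qed
  then show "\<exists>p. \<forall>z\<in>X. norm (f z * g z - poly p z) < e" by blast
qed

lemma poly_limit_cmult: "compact X \<Longrightarrow> poly_limit X f \<Longrightarrow> poly_limit X (\<lambda>z. c * f z)"
  by (rule poly_limit_mult) auto

lemma poly_limit_diff:
  "compact X \<Longrightarrow> poly_limit X f \<Longrightarrow> poly_limit X g \<Longrightarrow> poly_limit X (\<lambda>z. f z - g z)"
  using poly_limit_add[of X f "\<lambda>z. -1 * g z"] poly_limit_cmult[of X g "-1"] by simp

lemma poly_limit_power: "compact X \<Longrightarrow> poly_limit X f \<Longrightarrow> poly_limit X (\<lambda>z. f z ^ n)"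
  by (induction n) (auto intro: poly_limit_mult)

lemma poly_limit_sum:
  "(\<And>i. i \<in> I \<Longrightarrow> poly_limit X (f i)) \<Longrightarrow> poly_limit X (\<lambda>z. \<Sum>i\<in>I. f i z)"
  by (induction I rule: infinite_finite_induct) (auto intro: poly_limit_add)

text \<open>The Taylor series of \<open>F\<close> at 0 converges uniformly on the disc of radius
  \<rho>, and its partial sums evaluated at \<open>u\<close> are polynomials in \<open>u\<close>.
  Exponentials, reciprocals and logarithms are all obtained from this.\<close>

lemma poly_limit_holomorphic_compose:
  assumes X: "compact X" and u: "poly_limit X u" and F: "F holomorphic_on ball 0 R"
    and \<rho>: "\<And>z. z \<in> X \<Longrightarrow> norm (u z) \<le> \<rho>" "\<rho> < R"
  shows "poly_limit X (\<lambda>z. F (u z))"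
proof (cases "X = {}")
  case True then show ?thesis by (simp add: poly_limit_def)
next
  case False
  then have \<rho>0: "\<rho> \<ge> 0" using \<rho>(1) norm_ge_zero order_trans by blast
  define a where "a n = (deriv ^^ n) F 0 / fact n" for n
  have sums: "(\<lambda>n. a n * w ^ n) sums F w" if "norm w < R" for w
    using holomorphic_power_series[OF F, of w] that by (simp add: a_def)
  \<comment> \<open>Uniform convergence on the closed disc needs a radius of convergence strictly
    above \<rho>; convergence at the intermediate point \<open>s\<close> provides it.\<close>
  define s where "s = (\<rho> + R) / 2"
  have s: "\<rho> < s" "s < R" using \<rho>(2) by (auto simp: s_def)
  have "summable (\<lambda>n. a n * of_real s ^ n)"
    using sums[of "of_real s"] s \<rho>0 by (auto simp: sums_iff)
  then have "ereal (norm (of_real s :: complex)) \<le> conv_radius a"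
    by (rule conv_radius_geI)
  then have "ereal \<rho> < conv_radius a"
    using s \<rho>0 by (metis abs_of_nonneg ereal_less(2) ereal_less_eq(3) less_le_trans less_ereal.simps(1) norm_of_real order_less_imp_le order_trans)
  then have "uniform_limit (cball 0 \<rho>) (\<lambda>n w. \<Sum>i<n. a i * (w - 0) ^ i) (\<lambda>w. suminf (\<lambda>i. a i * (w - 0) ^ i)) sequentially"
    by (rule powser_uniform_limit)
  moreover have "suminf (\<lambda>i. a i * (w - 0) ^ i) = F w" if "w \<in> cball 0 \<rho>" for w
    using sums[of w] that \<rho>(2) by (auto simp: sums_iff)
  ultimately have lim: "uniform_limit (cball 0 \<rho>) (\<lambda>n w. \<Sum>i<n. a i * w ^ i) F sequentially"
    by (subst (asm) uniform_limit_cong'[where g = "\<lambda>n w. \<Sum>i<n. a i * w ^ i" and i = F]) auto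
  show ?thesis
  proof (rule poly_limit_closed)
    fix e :: real assume "e > 0"
    then obtain n where n: "\<forall>w\<in>cball 0 \<rho>. dist (\<Sum>i<n. a i * w ^ i) (F w) < e"
      using lim unfolding uniform_limit_iff eventually_sequentially by blast
    have "poly_limit X (\<lambda>z. \<Sum>i<n. a i * u z ^ i)"
      by (intro poly_limit_sum poly_limit_cmult poly_limit_power X u)
    moreover have "norm (F (u z) - (\<Sum>i<n. a i * u z ^ i)) < e" if "z \<in> X" for z
      using n \<rho>(1)[OF that] by (simp add: dist_norm norm_minus_commute)
    ultimately show "\<exists>g. poly_limit X g \<and> (\<forall>z\<in>X. norm (F (u z) - g z) < e)" by blast
  qed
qed

lemma poly_limit_exp:
  assumes "compact X" "poly_limit X u"
  shows "poly_limit X (\<lambda>z. exp (u z))"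
proof -
  obtain B where B: "\<And>z. z \<in> X \<Longrightarrow> norm (u z) \<le> B"
    using poly_limit_bounded[OF assms] by metis
  show ?thesis
    by (rule poly_limit_holomorphic_compose[OF assms, where R = "B + 1" and \<rho> = B])
       (auto intro!: holomorphic_intros B)
qed

section \<open>Runge's theorem by pole pushing\<close>

lemma poly_limit_Cauchy_kernel_near:
  assumes X: "compact X" and v: "poly_limit X (\<lambda>z. 1 / (z - v))"
    and near: "\<And>z. z \<in> X \<Longrightarrow> norm (w - v) \<le> norm (z - v) / 2" and "v \<notin> X"
  shows "poly_limit X (\<lambda>z. 1 / (z - w))" "poly_limit X (\<lambda>z. Ln ((z - w) / (z - v)))"
proof -
  \<comment> \<open>This \<open>u\<close> has norm at most 1/2 on \<open>X\<close>, and (z - w) / (z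
    - v) = 1 - u z. Moving the pole from \<open>v\<close> to \<open>w\<close> is thus multiplication
    by a geometric series in \<open>u\<close>, and the logarithm of the quotient is a power series
    in \<open>u\<close> too.\<close>
  define u where "u z = (w - v) * (1 / (z - v))" for z
  have u: "poly_limit X u" unfolding u_def by (intro poly_limit_cmult X v)
  have zv: "z \<noteq> v" if "z \<in> X" for z using that assms(4) by blast
  have u_le: "norm (u z) \<le> 1/2" if "z \<in> X" for z
    using near[OF that] zv[OF that] by (simp add: u_def norm_mult norm_divide field_simps)
  have eq: "(z - w) / (z - v) = 1 - u z" if "z \<in> X" for z
    using zv[OF that] by (simp add: u_def field_simps)
  have pos: "Re (1 - x) > 0" if "norm x < 1" for x :: complex
    using that complex_Re_le_cmod[of x] by simp
  have "poly_limit X (\<lambda>z. (\<lambda>x. 1 / (1 - x)) (u z))"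
    by (rule poly_limit_holomorphic_compose[OF X u, where R = 1 and \<rho> = "1/2"])
       (use u_le in \<open>auto intro!: holomorphic_intros\<close>)
  then have "poly_limit X (\<lambda>z. 1 / (z - v) * (1 / (1 - u z)))"
    by (intro poly_limit_mult X v)
  moreover have "1 / (z - v) * (1 / (1 - u z)) = 1 / (z - w)" if "z \<in> X" for z
    using eq[OF that] zv[OF that] by (metis (no_types, lifting) nonzero_eq_divide_eq right_minus_eq times_divide_eq_right mult.commute divide_divide_eq_left mult.left_neutral)
  ultimately show "poly_limit X (\<lambda>z. 1 / (z - w))"
    using poly_limit_cong by (metis (no_types, lifting))
  have "poly_limit X (\<lambda>z. (\<lambda>x. Ln (1 - x)) (u z))"
  proof (rule poly_limit_holomorphic_compose[OF X u, where R = 1 and \<rho> = "1/2"])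
    show "(\<lambda>x. Ln (1 - x)) holomorphic_on ball 0 1"
      using pos by (intro holomorphic_intros) (force simp: complex_nonpos_Reals_iff)
  qed (use u_le in auto)
  then show "poly_limit X (\<lambda>z. Ln ((z - w) / (z - v)))"
    by (rule iffD1[OF poly_limit_cong, rotated]) (simp add: eq)
qed

text \<open>Why d/5: two points of the small ball are less than 2d/5 apart, while \<open>X\<close>
  stays more than 4d/5 away from them. This supplies the hypothesis \<open>near\<close> of
  \<open>poly_limit_Cauchy_kernel_near\<close>.\<close>

lemma ball_avoiding_dist:
  fixes a :: "'a::real_normed_vector"
  assumes "ball a d \<inter> X = {}" "x \<in> ball a (d/5)" "y \<in> ball a (d/5)" "z \<in> X"
  shows "norm (y - x) \<le> norm (z - x) / 2"
proof -
  have "dist a z \<ge> d" using assms(1,4) by (meson disjoint_iff mem_ball not_le)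
  then show ?thesis
    using assms(2,3) dist_triangle[of a z x] dist_triangle[of y x a]
    by (auto simp: dist_norm norm_minus_commute)
qed

text \<open>Approximability of the kernel is a locally constant property of the pole on the
  connected set \<open>- X\<close>, and it holds for a pole far away.\<close>

lemma poly_limit_Cauchy_kernel:
  assumes X: "compact X" "connected (- X)" and v: "v \<notin> X"
  shows "poly_limit X (\<lambda>z. 1 / (z - v))"
proof -
  obtain B where B: "B > 0" "\<And>z. z \<in> X \<Longrightarrow> norm z \<le> B"
    using compact_imp_bounded[OF X(1)] bounded_pos by metis
  \<comment> \<open>At twice the radius of a disc containing \<open>X\<close>, the kernel is a power
    series in z / w with |z / w| at most 1/2 on \<open>X\<close>.\<close>
  define w where "w = complex_of_real (2 * B)"
  have nw: "norm w = 2 * B" using B by (simp add: w_def)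
  have w: "w \<notin> X" using B(2)[of w] B(1) nw by auto
  have w0: "w \<noteq> 0" using nw B by auto
  define F where "F x = - (1 / w) * (1 / (1 - x))" for x
  define u where "u z = (1 / w) * z" for z
  have "poly_limit X (\<lambda>z. F (u z))"
  proof (rule poly_limit_holomorphic_compose[OF X(1), where R = 1 and \<rho> = "1/2" and F = F and u = u])
    show "norm (u z) \<le> 1/2" if "z \<in> X" for z
      using B that nw by (simp add: u_def norm_mult norm_divide field_simps)
    show "poly_limit X u" unfolding u_def by (intro poly_limit_cmult X poly_limit_ident)
    show "F holomorphic_on ball 0 1" unfolding F_def by (intro holomorphic_intros) auto
  qed auto
  moreover have "F (u z) = 1 / (z - w)" if "z \<in> X" for z
  proof -
    have "w - z \<noteq> 0" "z - w \<noteq> 0" using w that by auto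
    then show ?thesis using w0 by (simp add: F_def u_def divide_simps)
  qed
  ultimately have base: "poly_limit X (\<lambda>z. 1 / (z - w))"
    using poly_limit_cong by (metis (no_types, lifting))
  show ?thesis
  proof (rule connected_induction_simple[OF X(2), where a = w and b = v and P = "\<lambda>v. poly_limit X (\<lambda>z. 1 / (z - v))"])
    fix a assume "a \<in> - X"
    then obtain d where d: "d > 0" "ball a d \<subseteq> - X"
      using open_contains_ball[of "-X"] compact_imp_closed[OF X(1)] by auto
    show "\<exists>T. openin (top_of_set (- X)) T \<and> a \<in> T \<and>
       (\<forall>x\<in>T. \<forall>y\<in>T. poly_limit X (\<lambda>z. 1 / (z - x)) \<longrightarrow> poly_limit X (\<lambda>z. 1 / (z - y)))"
    proof (intro exI[of _ "ball a (d/5)"] conjI ballI impI)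
      have sub: "ball a (d/5) \<subseteq> - X" using d subset_ball[of "d/5" d a] by auto
      then show "openin (top_of_set (- X)) (ball a (d/5))" by (simp add: open_subset)
      show "a \<in> ball a (d/5)" using d by simp
      fix x y assume xy: "x \<in> ball a (d/5)" "y \<in> ball a (d/5)" "poly_limit X (\<lambda>z. 1 / (z - x))"
      show "poly_limit X (\<lambda>z. 1 / (z - y))"
        by (rule poly_limit_Cauchy_kernel_near(1)[OF X(1) xy(3) ball_avoiding_dist[of a d X]])
           (use d sub xy in auto)
    qed
  qed (use v w base in auto)
qed


section \<open>Local approximants with two prescribed Laurent coefficients\<close>

lemma exists_connected_escape:
  fixes p :: complex
  assumes X: "compact X" "connected (- X)" and p: "p \<notin> X"
  obtains U b where "open U" "connected U" "U \<subseteq> ball p 2" "U \<inter> X = {}" "p \<in> U" "b \<in> U" "dist p b \<ge> 1"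
proof -
  define W where "W = - X \<inter> ball p 2"
  define U where "U = connected_component_set W p"
  have W: "open W" "p \<in> W" using p compact_imp_closed[OF X(1)] by (auto simp: W_def)
  have U: "open U" "connected U" "p \<in> U" "U \<subseteq> W"
    unfolding U_def using W open_connected_component[OF W(1)] connected_component_subset[of W p]
    by (simp_all add: connected_component_refl)
  \<comment> \<open>Otherwise the closure of this component would not meet the sphere of radius 2,
    so \<open>U\<close> would be clopen in the connected set \<open>- X\<close> and hence all of it;
    but the complement of a compact set is unbounded.\<close>
  have "\<not> U \<subseteq> ball p 1"
  proof
    assume sub: "U \<subseteq> ball p 1"
    have "closure U \<subseteq> cball p 1"
      using sub by (meson ball_subset_cball closed_cball closure_minimal subset_trans)
    then have "closure U \<subseteq> ball p 2" by (auto simp: subset_iff)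
    moreover have "closedin (top_of_set W) U" unfolding U_def by (rule closedin_connected_component)
    moreover from this obtain T where T: "closed T" "U = W \<inter> T" unfolding closedin_closed by blast
    moreover from T have "closure U \<subseteq> T" by (simp add: closure_minimal)
    ultimately have "U = - X \<inter> closure U"
      using U(4) closure_subset[of U] unfolding W_def by blast
    then have "closedin (top_of_set (- X)) U" by (metis closed_closure closedin_closed_Int)
    moreover have "openin (top_of_set (- X)) U" using U by (auto simp: W_def intro!: open_subset)
    ultimately have "U = - X" using X(2) U(3) unfolding connected_clopen by blast
    then have "bounded (- X)" using sub bounded_ball bounded_subset by blast
    then have "bounded (X \<union> - X)" using compact_imp_bounded[OF X(1)] bounded_Un[of X "- X"] by blast
    then show False by (simp only: Compl_partition not_bounded_UNIV)
  qed
  then obtain b where "b \<in> U" "dist p b \<ge> 1" by (auto simp: subset_iff not_less)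
  with U show ?thesis by (intro that[of U b]) (auto simp: W_def)
qed

lemma Re_pos_near_1: "norm (x - 1) < 1 \<Longrightarrow> Re x > 0" for x :: complex
  using complex_Re_le_cmod[of "1 - x"] by (simp add: norm_minus_commute)

lemma Ln_mult_Re_pos:
  assumes "Re x > 0" "Re y > 0" shows "Ln (x * y) = Ln x + Ln y"
proof -
  have "x \<noteq> 0" "y \<noteq> 0" using assms by auto
  moreover have "\<bar>Im (Ln x)\<bar> < pi / 2" "\<bar>Im (Ln y)\<bar> < pi / 2"
    using assms Re_Ln_pos_lt[of x] Re_Ln_pos_lt[of y] calculation by blast+
  ultimately show ?thesis by (intro Ln_times_simple) (auto simp: abs_less_iff)
qed

text \<open>The branch arises by dragging \<open>b\<close> away from \<open>p\<close> inside
  \<open>U\<close>: a short move from \<open>x\<close> to \<open>y\<close> adds the small logarithm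
  of (z - y) / (z - x). The last clause pins the branch down far away, so that the square root
  derived from it has nonnegative real part there.\<close>

lemma exists_poly_limit_log:
  assumes X: "compact X" "connected (- X)"
    and U: "open U" "connected U" "U \<subseteq> ball p 2" "U \<inter> X = {}" "p \<in> U" "b \<in> U"
  obtains L where "poly_limit X L" "\<And>z. z \<in> X \<Longrightarrow> exp (L z) = (z - b) / (z - p)"
    "\<And>z. z \<in> X \<Longrightarrow> norm (z - p) \<ge> 10 \<Longrightarrow> L z = Ln ((z - b) / (z - p))"
proof -
  define P where "P b \<longleftrightarrow> (\<exists>L. poly_limit X L \<and> (\<forall>z\<in>X. exp (L z) = (z - b) / (z - p) \<and>
      (norm (z - p) \<ge> 10 \<longrightarrow> L z = Ln ((z - b) / (z - p)))))" for b
  have "P b"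
  proof (rule connected_induction_simple[OF U(2), where a = p and b = b and P = P])
    have "p \<notin> X" using U by blast
    then show "P p" unfolding P_def by (intro exI[of _ "\<lambda>z. 0"]) auto
    fix a assume a: "a \<in> U"
    then obtain d where d: "d > 0" "ball a d \<subseteq> U" using U(1) open_contains_ball by blast
    show "\<exists>T. openin (top_of_set U) T \<and> a \<in> T \<and> (\<forall>x\<in>T. \<forall>y\<in>T. P x \<longrightarrow> P y)"
    proof (intro exI[of _ "ball a (d/5)"] conjI ballI impI)
      have sub: "ball a (d/5) \<subseteq> U" using d subset_ball[of "d/5" d a] by auto
      then show "openin (top_of_set U) (ball a (d/5))" by (simp add: open_subset)
      show "a \<in> ball a (d/5)" using d by simp
      fix x y assume xy: "x \<in> ball a (d/5)" "y \<in> ball a (d/5)" and Px: "P x"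
      have xyX: "x \<notin> X" "y \<notin> X" using xy sub U(4) by auto
      have xyp: "dist p x < 2" "dist p y < 2"
        using subsetD[OF U(3) subsetD[OF sub xy(1)]] subsetD[OF U(3) subsetD[OF sub xy(2)]] by simp_all
      obtain L where L: "poly_limit X L" "\<And>z. z \<in> X \<Longrightarrow> exp (L z) = (z - x) / (z - p)"
          "\<And>z. z \<in> X \<Longrightarrow> norm (z - p) \<ge> 10 \<Longrightarrow> L z = Ln ((z - x) / (z - p))"
        using Px unfolding P_def by blast
      define M where "M z = Ln ((z - y) / (z - x))" for z
      have "poly_limit X M" unfolding M_def
        by (rule poly_limit_Cauchy_kernel_near(2)[OF X(1) poly_limit_Cauchy_kernel[OF X] ball_avoiding_dist[of a d X]])
           (use d xy xyX U in auto)
      then have 1: "poly_limit X (\<lambda>z. L z + M z)" using L by (intro poly_limit_add)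
      have 2: "exp (L z + M z) = (z - y) / (z - p)" if "z \<in> X" for z
      proof -
        have "z \<noteq> x" "z \<noteq> y" using that xyX by auto
        then show ?thesis using L(2)[OF that] by (simp add: exp_add M_def)
      qed
      \<comment> \<open>Since \<open>x\<close> and \<open>y\<close> lie within 2 of
        \<open>p\<close>, distance 10 from \<open>p\<close> brings both quotients within 1 of the
        number 1, hence into the right half-plane, where principal logarithms add.\<close>
      have 3: "L z + M z = Ln ((z - y) / (z - p))" if "z \<in> X" "norm (z - p) \<ge> 10" for z
      proof -
        have ne: "z \<noteq> p" "z \<noteq> x" using that xyX by auto
        have zx: "norm (z - x) \<ge> 8"
          using that(2) xyp norm_triangle_ineq[of "z - x" "x - p"] by (simp add: dist_norm norm_minus_commute)
        have "norm (x - y) < 4" using xyp dist_triangle[of x y p] by (simp add: dist_norm norm_minus_commute)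
        then have "norm ((z - y) / (z - x) - 1) < 1" "norm ((z - x) / (z - p) - 1) < 1"
          using ne zx that(2) xyp by (simp_all add: divide_simps norm_divide dist_norm norm_minus_commute diff_divide_distrib[symmetric])
        then have "Ln ((z - x) / (z - p) * ((z - y) / (z - x))) = Ln ((z - x) / (z - p)) + M z"
          unfolding M_def by (intro Ln_mult_Re_pos Re_pos_near_1)
        then show ?thesis using L(3)[OF that] ne by simp
      qed
      show "P y" unfolding P_def using 1 2 3 by blast
    qed
  qed (use U in auto)
  then show ?thesis using that unfolding P_def by metis
qed

text \<open>
  With \<open>b\<close> as in \<open>exists_connected_escape\<close> and \<open>S\<close> the branch of \<open>sqrt ((z - p) (z - b))\<close> with
  \<open>S z ~ z\<close> at infinity, take \<open>h z = z - m - S z\<close>, where \<open>m\<close> is the midpoint of \<open>p\<close> and \<open>b\<close>.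
\<close>

lemma exists_local_generator:
  assumes X: "compact X" "connected (- X)" and p: "p \<notin> X"
  obtains m q h where "poly_limit X h" "norm (m - p) \<le> 1" "1/4 \<le> norm q" "norm q \<le> 1"
    "\<And>z. z \<in> X \<Longrightarrow> h z * (2 * (z - m) - h z) = q"
    "\<And>z. z \<in> X \<Longrightarrow> norm (h z) \<le> 22"
    "\<And>z. z \<in> X \<Longrightarrow> norm (z - m) \<ge> 12 \<Longrightarrow> norm (h z) \<le> 4 / norm (z - m)"
proof -
  obtain U b where U: "open U" "connected U" "U \<subseteq> ball p 2" "U \<inter> X = {}" "p \<in> U" "b \<in> U" "dist p b \<ge> 1"
    using exists_connected_escape[OF assms] by metis
  obtain L where L: "poly_limit X L" "\<And>z. z \<in> X \<Longrightarrow> exp (L z) = (z - b) / (z - p)"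
    "\<And>z. z \<in> X \<Longrightarrow> norm (z - p) \<ge> 10 \<Longrightarrow> L z = Ln ((z - b) / (z - p))"
    using exists_poly_limit_log[OF X U(1-6)] by metis
  define m where "m = (p + b) / 2"
  \<comment> \<open>Chosen so that (z - m)^2 - (z - p) (z - b) = q: the conjugate of
    \<open>h z\<close> is 2 (z - m) - h z, and their product is constant.\<close>
  define q where "q = (b - p)\<^sup>2 / 4"
  \<comment> \<open>A root of (z - b) / (z - p), which tends to 1 at infinity; the branch
    \<open>S\<close> is (z - p) \<sigma>.\<close>
  define \<sigma> where "\<sigma> z = exp ((1/2) * L z)" for z
  define h where "h z = z - m - (z - p) * \<sigma> z" for z
  have bp: "norm (b - p) < 2" "norm (b - p) \<ge> 1"
    using U by (auto simp: dist_norm norm_minus_commute)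
  have mp: "m - p = (b - p) / 2" "m - b = (p - b) / 2" by (simp_all add: m_def field_simps)
  have nmp: "norm (m - p) \<le> 1" "norm (m - b) \<le> 1"
    unfolding mp using bp by (simp_all add: norm_divide norm_minus_commute)
  have "(1::real)\<^sup>2 \<le> (norm (b - p))\<^sup>2" "(norm (b - p))\<^sup>2 \<le> 2\<^sup>2"
    by (rule power_mono; use bp in simp)+
  then have nq: "1/4 \<le> norm q" "norm q \<le> 1"
    by (simp_all add: q_def norm_divide norm_power)
  have h: "poly_limit X h" unfolding h_def \<sigma>_def
    by (intro poly_limit_diff poly_limit_mult poly_limit_exp poly_limit_cmult poly_limit_ident poly_limit_const X L)
  have zp: "z \<noteq> p" if "z \<in> X" for z using that p by auto
  have sq: "((z - p) * \<sigma> z)\<^sup>2 = (z - p) * (z - b)" if "z \<in> X" for z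
  proof -
    have "(\<sigma> z)\<^sup>2 = exp (L z)" by (simp add: \<sigma>_def exp_double[symmetric])
    then have "((z - p) * \<sigma> z)\<^sup>2 = (z - p)\<^sup>2 * ((z - b) / (z - p))"
      using L(2)[OF that] by (simp add: power_mult_distrib)
    then show ?thesis using zp[OF that] by (simp add: power2_eq_square)
  qed
  have hq: "h z * (2 * (z - m) - h z) = q" if "z \<in> X" for z
  proof -
    have "h z * (2 * (z - m) - h z) = (z - m)\<^sup>2 - ((z - p) * \<sigma> z)\<^sup>2"
      by (simp add: h_def algebra_simps power2_eq_square)
    also have "\<dots> = q" unfolding sq[OF that] m_def q_def by (simp add: field_simps power2_eq_square)
    finally show ?thesis .
  qed
  \<comment> \<open>As \<sigma> has nonnegative real part, z - m and (z - p) \<sigma> do not cancel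
    in the conjugate factor, and \<open>h\<close> is \<open>q\<close> divided by this large
    factor.\<close>
  have far: "norm (h z) \<le> 2 / norm (z - p)" if z: "z \<in> X" "norm (z - p) \<ge> 10" for z
  proof -
    have "\<bar>Im (L z)\<bar> \<le> pi"
      unfolding L(3)[OF z] using mpi_less_Im_Ln[of "(z - b) / (z - p)"] Im_Ln_le_pi[of "(z - b) / (z - p)"] z p U(4,6)
      by (fastforce simp: abs_le_iff)
    then have "cos (Im (L z) / 2) \<ge> 0" by (intro cos_ge_zero) auto
    then have \<sigma>: "Re (\<sigma> z) \<ge> 0" by (simp add: \<sigma>_def Re_exp)
    have "norm ((p - m) / (z - p)) \<le> 1/10"
      using nmp z by (simp add: norm_divide divide_simps norm_minus_commute)
    then have "Re ((p - m) / (z - p)) \<ge> - 1/10"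
      using abs_Re_le_cmod[of "(p - m) / (z - p)"] by linarith
    then have "Re (1 + (p - m) / (z - p) + \<sigma> z) \<ge> 1/2" using \<sigma> by simp
    then have ge: "norm (1 + (p - m) / (z - p) + \<sigma> z) \<ge> 1/2"
      using complex_Re_le_cmod order_trans by blast
    have "2 * (z - m) - h z = (z - p) * (1 + (p - m) / (z - p) + \<sigma> z)"
      using zp[OF z(1)] by (simp add: h_def field_simps)
    then have "norm (2 * (z - m) - h z) \<ge> norm (z - p) / 2"
      using mult_left_mono[OF ge, of "norm (z - p)"] by (simp add: norm_mult)
    then have "norm (h z) * (norm (z - p) / 2) \<le> norm (h z) * norm (2 * (z - m) - h z)"
      by (intro mult_left_mono) auto
    also have "\<dots> \<le> 1" using hq[OF z(1)] nq by (metis norm_mult)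
    finally have "norm (h z) * norm (z - p) \<le> 2" by simp
    moreover have "norm (z - p) > 0" using z by linarith
    ultimately show ?thesis by (simp add: pos_le_divide_eq)
  qed
  have bound: "norm (h z) \<le> 22" if z: "z \<in> X" for z
  proof (cases "norm (z - p) \<ge> 10")
    case True
    then have "2 / norm (z - p) \<le> 1" by (subst pos_divide_le_eq) auto
    with far[OF z True] show ?thesis by linarith
  next
    case False
    have zb: "norm (z - b) \<le> 12" "norm (z - m) \<le> 11"
      using False bp nmp norm_triangle_ineq[of "z - p" "p - b"] norm_triangle_ineq[of "z - p" "p - m"]
      by (auto simp: norm_minus_commute)
    have "(norm ((z - p) * \<sigma> z))\<^sup>2 = norm (z - p) * norm (z - b)"
      using sq[OF z] by (metis norm_mult norm_power)
    also have "\<dots> \<le> 10 * 12" using zb False by (intro mult_mono) auto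
    also have "\<dots> \<le> (11::real)\<^sup>2" by simp
    finally have "norm ((z - p) * \<sigma> z) \<le> 11" by (rule power2_le_imp_le) simp
    then show ?thesis using zb norm_triangle_ineq4[of "z - m" "(z - p) * \<sigma> z"] by (simp add: h_def)
  qed
  have far': "norm (h z) \<le> 4 / norm (z - m)" if z: "z \<in> X" "norm (z - m) \<ge> 12" for z
  proof -
    have *: "norm (z - p) \<ge> norm (z - m) - 1"
      using nmp norm_triangle_ineq[of "z - p" "p - m"] by (simp add: norm_minus_commute)
    then have "norm (z - p) \<ge> 10" "norm (z - p) \<ge> norm (z - m) / 2" using z by auto
    then have "norm (h z) \<le> 2 / norm (z - p)" "2 / norm (z - p) \<le> 2 / (norm (z - m) / 2)"
      using far[OF z(1)] z by (blast, intro frac_le) auto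
    then show ?thesis by simp
  qed
  show ?thesis by (rule that[OF h nmp(1) nq hq bound far'])
qed

text \<open>With t = z - m the identity for \<open>h\<close> reads h = q / (2t) + h^2 / (2t). As h =
  O(1/t), this makes \<open>h\<close> equal to q / (2t) and its square equal to q^2 / (4 t^2), both
  up to O(t^-3). Centring at \<open>m\<close> removes the t^-2 term of \<open>h\<close>, so \<alpha>
  and \<beta> can be matched separately. The lower bound on |q| keeps the coefficients of
  \<open>g\<close> comparable to \<omega>.\<close>

lemma exists_local_approximant:
  assumes X: "compact X" "connected (- X)" and p: "p \<notin> X"
  obtains m where "norm (m - p) \<le> 1"
    "\<And>\<alpha> \<beta> \<omega>. norm \<alpha> \<le> \<omega> \<Longrightarrow> norm \<beta> \<le> \<omega> \<Longrightarrow> \<exists>g. poly_limit X g \<and> (\<forall>z\<in>X. norm (g z) \<le> 40000 * \<omega> \<and>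
       (norm (z - m) \<ge> 12 \<longrightarrow> norm (g z - \<alpha> / (z - m) - \<beta> / (z - m)\<^sup>2) \<le> 40000 * \<omega> / norm (z - m) ^ 3))"
proof -
  obtain m q h where h: "poly_limit X h" and m: "norm (m - p) \<le> 1" and q: "1/4 \<le> norm q" "norm q \<le> 1"
    and hq: "\<And>z. z \<in> X \<Longrightarrow> h z * (2 * (z - m) - h z) = q"
    and bound: "\<And>z. z \<in> X \<Longrightarrow> norm (h z) \<le> 22"
    and far: "\<And>z. z \<in> X \<Longrightarrow> norm (z - m) \<ge> 12 \<Longrightarrow> norm (h z) \<le> 4 / norm (z - m)"
    using exists_local_generator[OF assms] by metis
  have q0: "q \<noteq> 0" using q by auto
  show ?thesis
  proof (rule that[OF m])
    fix \<alpha> \<beta> :: complex and \<omega> :: real assume ab: "norm \<alpha> \<le> \<omega>" "norm \<beta> \<le> \<omega>"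
    then have \<omega>: "\<omega> \<ge> 0" using norm_ge_zero order_trans by blast
    define g where "g z = 2 * \<alpha> / q * h z + 4 * \<beta> / q\<^sup>2 * h z ^ 2" for z
    have "poly_limit X g" unfolding g_def
      by (intro poly_limit_add poly_limit_cmult poly_limit_power X h)
    have aq: "norm (\<alpha> / q) \<le> 4 * \<omega>"
    proof -
      have "norm \<alpha> \<le> (4 * \<omega>) * (1/4)" using ab by simp
      also have "\<dots> \<le> (4 * \<omega>) * norm q" using \<omega> q by (intro mult_left_mono) auto
      finally show ?thesis using q0 by (simp add: norm_divide field_simps)
    qed
    have bq: "norm (\<beta> / q\<^sup>2) \<le> 16 * \<omega>"
    proof -
      have "(1/4)\<^sup>2 \<le> (norm q)\<^sup>2" using q by (intro power_mono) auto
      then have *: "1/16 \<le> (norm q)\<^sup>2" by (simp add: power2_eq_square)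
      have "norm \<beta> \<le> (16 * \<omega>) * (1/16)" using ab by simp
      also have "\<dots> \<le> (16 * \<omega>) * (norm q)\<^sup>2" using \<omega> * by (intro mult_left_mono) auto
      finally show ?thesis using q0 by (simp add: norm_divide norm_power field_simps)
    qed
    \<comment> \<open>40000 rounds up 2 * 88 + 4 * 7744 = 31152; the far estimate below gives 64 +
      4608.\<close>
    have "norm (g z) \<le> 40000 * \<omega>" if z: "z \<in> X" for z
    proof -
      have 1: "norm (\<alpha> / q) * norm (h z) \<le> 4 * \<omega> * 22"
        using aq bound[OF z] \<omega> by (intro mult_mono) auto
      have "norm (h z) ^ 2 \<le> 22 ^ 2" using bound[OF z] by (intro power_mono) auto
      then have 2: "norm (\<beta> / q\<^sup>2) * norm (h z) ^ 2 \<le> 16 * \<omega> * 484"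
        using bq \<omega> by (intro mult_mono) auto
      have "norm (g z) \<le> norm (2 * (\<alpha> / q * h z)) + norm (4 * (\<beta> / q\<^sup>2 * h z ^ 2))"
        unfolding g_def by (rule order_trans[OF _ norm_triangle_ineq]) (simp add: mult.assoc)
      also have "\<dots> = 2 * (norm (\<alpha> / q) * norm (h z)) + 4 * (norm (\<beta> / q\<^sup>2) * norm (h z) ^ 2)"
        by (simp add: norm_mult norm_power norm_divide)
      finally show ?thesis using 1 2 \<omega> by linarith
    qed
    moreover have "norm (g z - \<alpha> / (z - m) - \<beta> / (z - m)\<^sup>2) \<le> 40000 * \<omega> / norm (z - m) ^ 3"
      if z: "z \<in> X" "norm (z - m) \<ge> 12" for z
    proof -
      define t where "t = z - m"
      define s where "s = norm t"
      have t: "t \<noteq> 0" and s: "s \<ge> 12" using z by (auto simp: t_def s_def)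
      have e1: "h z = (q + (h z)\<^sup>2) / (2 * t)"
        using hq[OF z(1)] t by (simp add: t_def[symmetric] field_simps power2_eq_square)
      have e2: "(h z)\<^sup>2 = (q + (h z)\<^sup>2)\<^sup>2 / (4 * t\<^sup>2)"
        by (subst e1) (simp add: power_divide power_mult_distrib)
      have g1: "2 * \<alpha> / q * h z = \<alpha> / t + (\<alpha> / q) * (h z)\<^sup>2 / t"
        by (subst e1) (use q0 t in \<open>simp add: field_simps\<close>)
      have g2: "4 * \<beta> / q\<^sup>2 * (h z)\<^sup>2 = \<beta> / t\<^sup>2 + (\<beta> / q\<^sup>2) * (2 * q * (h z)\<^sup>2 + (h z) ^ 4) / t\<^sup>2"
        by (subst e2) (use q0 t in \<open>simp add: field_simps power2_eq_square power4_eq_xxxx\<close>)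
      have hs: "norm (h z) \<le> 4 / s" using far[OF z] by (simp add: s_def t_def)
      have h2: "norm (h z) ^ 2 \<le> 16 / s\<^sup>2"
        using power_mono[OF hs, of 2] by (simp add: power_divide)
      have h4: "norm (h z) ^ 4 \<le> 256 / s ^ 4"
        using power_mono[OF hs, of 4] by (simp add: power_divide)
      have "norm ((\<alpha> / q) * (h z)\<^sup>2 / t) = norm (\<alpha> / q) * norm (h z) ^ 2 / s"
        by (simp add: norm_mult norm_divide norm_power s_def)
      also have "\<dots> \<le> 4 * \<omega> * (16 / s\<^sup>2) / s"
        using aq h2 \<omega> s by (intro divide_right_mono mult_mono) auto
      also have "\<dots> = 64 * (\<omega> / s ^ 3)" by (simp add: power2_eq_square power3_eq_cube)
      finally have b1: "norm ((\<alpha> / q) * (h z)\<^sup>2 / t) \<le> 64 * (\<omega> / s ^ 3)" .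
      have "norm (2 * q * (h z)\<^sup>2 + (h z) ^ 4) \<le> 2 * norm q * norm (h z) ^ 2 + norm (h z) ^ 4"
        by (rule order_trans[OF norm_triangle_ineq]) (simp add: norm_mult norm_power)
      also have "\<dots> \<le> 2 * 1 * (16 / s\<^sup>2) + 256 / s ^ 4"
        using q h2 h4 by (intro add_mono mult_mono) auto
      also have "\<dots> \<le> 32 / s + 256 / s"
      proof -
        have "s \<le> s\<^sup>2" "s \<le> s ^ 4" using s by (auto intro!: self_le_power)
        then show ?thesis using s by (intro add_mono) (auto simp: frac_le)
      qed
      finally have "norm (2 * q * (h z)\<^sup>2 + (h z) ^ 4) \<le> 288 / s" by simp
      then have "norm (\<beta> / q\<^sup>2) * norm (2 * q * (h z)\<^sup>2 + (h z) ^ 4) / s\<^sup>2 \<le> 16 * \<omega> * (288 / s) / s\<^sup>2"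
        using bq \<omega> s by (intro divide_right_mono mult_mono) auto
      also have "\<dots> = 4608 * (\<omega> / s ^ 3)" by (simp add: power2_eq_square power3_eq_cube)
      finally have b2: "norm ((\<beta> / q\<^sup>2) * (2 * q * (h z)\<^sup>2 + (h z) ^ 4) / t\<^sup>2) \<le> 4608 * (\<omega> / s ^ 3)"
        by (simp add: norm_mult norm_divide norm_power s_def)
      have "g z - \<alpha> / t - \<beta> / t\<^sup>2 = (\<alpha> / q) * (h z)\<^sup>2 / t + (\<beta> / q\<^sup>2) * (2 * q * (h z)\<^sup>2 + (h z) ^ 4) / t\<^sup>2"
        unfolding g_def g1 g2 by simp
      then have "norm (g z - \<alpha> / t - \<beta> / t\<^sup>2) \<le> 64 * (\<omega> / s ^ 3) + 4608 * (\<omega> / s ^ 3)"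
        using b1 b2 norm_triangle_mono by metis
      also have "\<dots> \<le> 40000 * (\<omega> / s ^ 3)" using \<omega> s by (simp add: divide_right_mono)
      finally show ?thesis by (simp add: t_def s_def)
    qed
    ultimately show "\<exists>g. poly_limit X g \<and> (\<forall>z\<in>X. norm (g z) \<le> 40000 * \<omega> \<and>
       (norm (z - m) \<ge> 12 \<longrightarrow> norm (g z - \<alpha> / (z - m) - \<beta> / (z - m)\<^sup>2) \<le> 40000 * \<omega> / norm (z - m) ^ 3))"
      using \<open>poly_limit X g\<close> by blast
  qed
qed

section \<open>The Cauchy--Pompeiu formula\<close>

definition unit_area :: real where "unit_area = measure lborel (ball (0::complex) 1)"

lemma unit_area_pos: "unit_area > 0"
  by (simp add: unit_area_def content_ball_pos)

lemma emeasure_complex_ball: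
  assumes "r \<ge> 0" shows "emeasure lborel (ball (c::complex) r) = ennreal (r\<^sup>2 * unit_area)"
  using content_ball_conv_unit_ball[OF assms, of c] emeasure_lborel_ball_finite[of c r]
  by (subst emeasure_eq_ennreal_measure) (auto simp: unit_area_def)

text \<open>Takes the place of polar coordinates: \<open>f\<close> is dominated by the sum of the
  constants \<open>a k\<close> on the balls of radius \<open>\<rho> k\<close>, whose integral is
  \<open>unit_area\<close> times the given series. For dyadic radii, full balls instead of annuli
  cost a constant factor.\<close>

lemma integrable_annuli:
  fixes f :: "complex \<Rightarrow> real"
  assumes f: "f \<in> borel_measurable borel" "\<And>z. f z \<ge> 0"
    and le: "\<And>z. f z \<noteq> 0 \<Longrightarrow> \<exists>k::nat. z \<in> ball 0 (\<rho> k) \<and> f z \<le> a k"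
    and a: "\<And>k. a k \<ge> 0" "\<And>k. \<rho> k \<ge> 0" "summable (\<lambda>k. a k * (\<rho> k)\<^sup>2)"
  shows "integrable lborel f"
proof (rule integrableI_nonneg)
  have "(\<integral>\<^sup>+z. ennreal (f z) \<partial>lborel) \<le> (\<integral>\<^sup>+z. (\<Sum>k. ennreal (a k) * indicator (ball 0 (\<rho> k)) (z::complex)) \<partial>lborel)"
  proof (rule nn_integral_mono)
    fix z :: complex
    show "ennreal (f z) \<le> (\<Sum>k. ennreal (a k) * indicator (ball 0 (\<rho> k)) z)"
    proof (cases "f z = 0")
      case False
      then obtain k where k: "z \<in> ball 0 (\<rho> k)" "f z \<le> a k" using le by blast
      define g where "g k = ennreal (a k) * indicator (ball 0 (\<rho> k)) z" for k
      have "ennreal (f z) \<le> g k"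
        using k by (simp add: ennreal_leI g_def)
      also have "\<dots> \<le> (\<Sum>k. g k)"
        using sum_le_suminf[of g "{k}"] by simp
      finally show ?thesis by (simp add: g_def)
    qed simp
  qed
  also have "\<dots> = (\<Sum>k. \<integral>\<^sup>+z. ennreal (a k) * indicator (ball 0 (\<rho> k)) (z::complex) \<partial>lborel)"
    by (rule nn_integral_suminf) (auto intro!: borel_measurable_times_ennreal borel_measurable_indicator)
  also have "\<dots> = (\<Sum>k. ennreal (a k * (\<rho> k)\<^sup>2 * unit_area))"
    using a unit_area_pos
    by (simp add: nn_integral_cmult_indicator emeasure_complex_ball ennreal_mult' mult.assoc)
  also have "\<dots> = ennreal (\<Sum>k. a k * (\<rho> k)\<^sup>2 * unit_area)"
    using a unit_area_pos by (intro suminf_ennreal2 summable_mult2) auto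
  also have "\<dots> < \<infinity>" by simp
  finally show "(\<integral>\<^sup>+z. ennreal (f z) \<partial>lborel) < \<infinity>" .
qed (use f in auto)

text \<open>The singular part of the Cauchy kernel; off the unit ball 1 / |z| is at most 1. The
  value at 0 is 0, by division by zero.\<close>

definition local_kernel :: "complex \<Rightarrow> real" where
  "local_kernel z = indicator (ball 0 1) z / norm z"

lemma local_kernel_measurable [measurable]: "local_kernel \<in> borel_measurable borel"
  unfolding local_kernel_def
  by (intro borel_measurable_divide borel_measurable_indicator borel_measurable_norm) auto

lemma integrable_local_kernel: "integrable lborel local_kernel"
proof (rule integrable_annuli[where a = "\<lambda>k. 2 * 2 ^ k" and \<rho> = "\<lambda>k. (1/2) ^ k"])
  fix z :: complex assume "local_kernel z \<noteq> 0"
  then have z: "0 < norm z" "norm z < 1" by (auto simp: local_kernel_def split: split_indicator_asm)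
  \<comment> \<open>With k = m - 1, \<open>z\<close> lies in the annulus (1/2)^(k+1) \<le> |z| <
    (1/2)^k, where 1 / |z| is at most 2 * 2^k. The area factor 4^-k leaves a geometric
    series.\<close>
  define m where "m = (LEAST m. (1/2) ^ m \<le> norm z)"
  obtain n where "(1/2) ^ n < norm z" using real_arch_pow_inv[of "norm z" "1/2"] z by auto
  then have m: "(1/2) ^ m \<le> norm z" unfolding m_def
    using LeastI[of "\<lambda>m. (1/2) ^ m \<le> norm z" n] by simp
  then have "m \<noteq> 0" using z by (intro notI) simp
  then obtain k where k: "m = Suc k" by (cases m) auto
  then have lt: "norm z < (1/2) ^ k" using not_less_Least[of k "\<lambda>m. (1/2) ^ m \<le> norm z"] by (auto simp: m_def)
  have "1 / norm z \<le> 1 / (1/2) ^ Suc k" using m k z by (intro divide_left_mono) auto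
  then have "local_kernel z \<le> 2 * 2 ^ k" using z by (simp add: local_kernel_def power_one_over)
  with lt show "\<exists>k. z \<in> ball 0 ((1/2) ^ k) \<and> local_kernel z \<le> 2 * 2 ^ k" by auto
next
  have "(\<lambda>k. 2 * 2 ^ k * ((1 / 2) ^ k)\<^sup>2) = (\<lambda>k. 2 * (1/2::real) ^ k)"
    by (auto simp: power_one_over power2_eq_square field_simps)
  then show "summable (\<lambda>k. 2 * 2 ^ k * ((1 / 2) ^ k)\<^sup>2 :: real)"
    by (simp add: summable_mult summable_geometric)
qed (auto simp: local_kernel_def)

text \<open>The profile of the \<open>dbar\<close> of the regularised Cauchy kernel used below: at y
  = \<epsilon> \<eta> that \<open>dbar\<close> is bell \<eta> / \<epsilon>^2, an approximate
  identity up to the factor \<open>bell_mass\<close>.\<close>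

definition bell :: "complex \<Rightarrow> real" where "bell z = 1 / (1 + (norm z)\<^sup>2)\<^sup>2"

lemma bell_measurable [measurable]: "bell \<in> borel_measurable borel"
  unfolding bell_def by measurable

lemma bell_nonneg: "bell z \<ge> 0"
  by (simp add: bell_def)

lemma integrable_bell: "integrable lborel bell"
proof (rule integrable_annuli[where a = "\<lambda>k. 16 * (1/16) ^ k" and \<rho> = "\<lambda>k. 2 ^ k"])
  fix z :: complex
  define k where "k = (LEAST k. norm z < 2 ^ k)"
  obtain n where "norm z < 2 ^ n" using real_arch_pow[of 2 "norm z"] by auto
  then have lt: "norm z < 2 ^ k" unfolding k_def by (rule LeastI)
  have "bell z \<le> 16 * (1/16) ^ k"
  proof (cases k)
    case 0
    have "1 \<le> (1 + (norm z)\<^sup>2)\<^sup>2" by simp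
    then have "bell z \<le> 1" unfolding bell_def by (simp add: divide_le_eq)
    then show ?thesis using 0 by simp
  next
    case (Suc j)
    then have "2 ^ j \<le> norm z" using not_less_Least[of j "\<lambda>k. norm z < 2 ^ k"] by (auto simp: k_def)
    then have "(2 ^ j) ^ 2 \<le> (norm z)\<^sup>2" by (rule power_mono) simp
    then have "(2 ^ j) ^ 2 \<le> 1 + (norm z)\<^sup>2" by (rule order_trans) simp
    then have "((2 ^ j) ^ 2) ^ 2 \<le> (1 + (norm z)\<^sup>2)\<^sup>2" by (rule power_mono) simp
    then have "bell z \<le> 1 / ((2 ^ j) ^ 2) ^ 2" unfolding bell_def by (intro frac_le) auto
    also have "((2::real) ^ j) ^ 2 = 4 ^ j" by (simp add: power2_eq_square flip: power_mult_distrib)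
    also have "((4::real) ^ j) ^ 2 = 16 ^ j" by (simp add: power2_eq_square flip: power_mult_distrib)
    finally show ?thesis using Suc by (simp add: power_one_over)
  qed
  with lt show "\<exists>k. z \<in> ball 0 (2 ^ k) \<and> bell z \<le> 16 * (1/16) ^ k" by auto
next
  have "((2::real) ^ k)\<^sup>2 = 4 ^ k" for k by (simp add: power2_eq_square flip: power_mult_distrib)
  then have "(\<lambda>k. 16 * (1/16) ^ k * (2 ^ k)\<^sup>2) = (\<lambda>k. 16 * (1/4::real) ^ k)"
    by (auto simp: power_mult_distrib[symmetric])
  then show "summable (\<lambda>k. 16 * (1/16) ^ k * (2 ^ k)\<^sup>2 :: real)"
    by (simp add: summable_mult summable_geometric)
qed (auto simp: bell_def)

definition bell_mass :: real where "bell_mass = (\<integral>z. bell z \<partial>lborel)"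

lemma bell_mass_pos: "bell_mass > 0"
proof -
  have "(\<integral>z. 1/4 * indicator (ball (0::complex) 1) z \<partial>lborel) \<le> bell_mass"
    unfolding bell_mass_def
  proof (rule integral_mono[OF _ integrable_bell])
    show "integrable lborel (\<lambda>z. 1/4 * indicator (ball (0::complex) 1) z :: real)"
      using emeasure_lborel_ball_finite[of "0::complex" 1] by (intro integrable_mult_right integrable_real_indicator) auto
    fix z :: complex
    show "1/4 * indicator (ball (0::complex) 1) z \<le> bell z"
    proof (cases "norm z < 1")
      case True
      then have "(norm z)\<^sup>2 \<le> 1" by (simp add: power_le_one)
      then have "(1 + (norm z)\<^sup>2)\<^sup>2 \<le> 2\<^sup>2" by (intro power_mono) auto
      moreover have "1 + (norm z)\<^sup>2 > 0" by (simp add: add_pos_nonneg)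
      ultimately have "1 / 2\<^sup>2 \<le> bell z" unfolding bell_def
        by (intro divide_left_mono) simp_all
      with True show ?thesis by simp
    qed (auto simp: bell_def)
  qed
  moreover have "(\<integral>z. 1/4 * indicator (ball (0::complex) 1) z \<partial>lborel) = unit_area / 4"
    by (simp add: unit_area_def)
  ultimately show ?thesis using unit_area_pos by linarith
qed

lemma integral_translate_complex:
  fixes f :: "complex \<Rightarrow> 'b::{banach, second_countable_topology}"
  assumes [measurable]: "f \<in> borel_measurable borel"
  shows "(\<integral>z. f (c + z) \<partial>lborel) = (\<integral>z. f z \<partial>lborel)"
    and "integrable lborel (\<lambda>z. f (c + z)) \<longleftrightarrow> integrable lborel f"
proof -
  have d: "distr lborel borel ((+) c) = (lborel :: complex measure)" by (rule lborel_distr_plus)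
  show "(\<integral>z. f (c + z) \<partial>lborel) = (\<integral>z. f z \<partial>lborel)"
    using integral_distr[of "(+) c" lborel borel f] by (simp add: d)
  show "integrable lborel (\<lambda>z. f (c + z)) \<longleftrightarrow> integrable lborel f"
    using integrable_distr_eq[of "(+) c" lborel borel f] by (simp add: d)
qed

lemma integral_scale_complex:
  fixes f :: "complex \<Rightarrow> complex"
  assumes [measurable]: "f \<in> borel_measurable borel" and r: "r > 0"
  shows "(CLBINT z. f z) = r\<^sup>2 *\<^sub>R (CLBINT z. f (r *\<^sub>R z))"
proof -
  have "(CLBINT z. f z) = (\<integral>z. f z \<partial>density (distr lborel borel (\<lambda>x::complex. 0 + r *\<^sub>R x)) (\<lambda>_. \<bar>r\<bar> ^ DIM(complex)))"
    using r by (subst lborel_affine[of r 0]) auto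
  also have "\<dots> = (\<integral>z. (r\<^sup>2) *\<^sub>R f z \<partial>distr lborel borel (\<lambda>x::complex. r *\<^sub>R x))"
    using r by (subst integral_density) auto
  also have "\<dots> = (CLBINT z. (r\<^sup>2) *\<^sub>R f (r *\<^sub>R z))"
    by (subst integral_distr) auto
  finally show ?thesis by simp
qed

text \<open>The bound is uniform in \<open>z\<close>: within distance 1 of \<open>z\<close> the
  kernel is a translate of \<open>local_kernel\<close>, and further away it is at most 1 on the ball
  carrying \<mu>.\<close>

lemma Cauchy_kernel_integral:
  fixes \<mu> :: "complex \<Rightarrow> complex"
  assumes [measurable]: "\<mu> \<in> borel_measurable borel" and B: "\<And>y. norm (\<mu> y) \<le> B" and R: "R \<ge> 0"
    and supp: "\<And>y. y \<notin> ball c R \<Longrightarrow> \<mu> y = 0"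
  shows "integrable lborel (\<lambda>y. \<mu> y / (y - z))"
    and "norm (CLBINT y. \<mu> y / (y - z)) \<le> B * ((\<integral>y. local_kernel y \<partial>lborel) + R\<^sup>2 * unit_area)"
proof -
  have B0: "B \<ge> 0" using B[of 0] norm_ge_zero order_trans by blast
  define g where "g y = B * (local_kernel (- z + y) + indicator (ball c R) y)" for y
  have m: "measure lborel (ball c R) = R\<^sup>2 * unit_area"
    using emeasure_complex_ball[OF R, of c] unit_area_pos by (simp add: measure_def)
  have i1: "integrable lborel (\<lambda>y. local_kernel (- z + y))"
    by (subst integral_translate_complex(2)) (auto intro: integrable_local_kernel)
  have i2: "integrable lborel (indicator (ball c R) :: complex \<Rightarrow> real)"
    using emeasure_lborel_ball_finite[of c R] by (intro integrable_real_indicator) auto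
  have ig: "integrable lborel g"
    unfolding g_def by (intro integrable_mult_right Bochner_Integration.integrable_add i1 i2)
  have le: "norm (\<mu> y / (y - z)) \<le> g y" for y
  proof (cases "y \<in> ball c R")
    case True
    have "norm (\<mu> y / (y - z)) \<le> B * (1 / norm (y - z))"
      using B[of y] by (simp add: norm_divide divide_right_mono)
    also have "1 / norm (y - z) \<le> local_kernel (- z + y) + 1"
    proof (cases "norm (y - z) < 1")
      case True then show ?thesis by (simp add: local_kernel_def norm_minus_commute)
    next
      case False then show ?thesis by (simp add: local_kernel_def norm_minus_commute divide_le_eq)
    qed
    finally show ?thesis using True B0 by (simp add: g_def mult_left_mono)
  next
    case False then show ?thesis using supp B0 by (simp add: g_def local_kernel_def)
  qed
  show "integrable lborel (\<lambda>y. \<mu> y / (y - z))"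
    by (rule Bochner_Integration.integrable_bound[OF ig]) (use order_trans[OF le abs_ge_self] in \<open>auto intro!: AE_I2\<close>)
  then have "norm (CLBINT y. \<mu> y / (y - z)) \<le> (\<integral>y. norm (\<mu> y / (y - z)) \<partial>lborel)"
    by simp
  also have "\<dots> \<le> (\<integral>y. g y \<partial>lborel)"
    by (rule integral_mono[OF integrable_norm ig le]) fact
  also have "\<dots> = B * ((\<integral>y. local_kernel y \<partial>lborel) + R\<^sup>2 * unit_area)"
    unfolding g_def using i1 i2 integral_translate_complex(1)[of local_kernel "-z"] m by simp
  finally show "norm (CLBINT y. \<mu> y / (y - z)) \<le> B * ((\<integral>y. local_kernel y \<partial>lborel) + R\<^sup>2 * unit_area)" .
qed

lemma continuous_compact_support:
  fixes f :: "complex \<Rightarrow> complex"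
  assumes f: "continuous_on UNIV f" and supp: "\<And>z. norm z \<ge> R \<Longrightarrow> f z = 0"
  obtains B where "B > 0" "\<And>z. norm (f z) \<le> B" "integrable lborel f"
proof -
  have cont: "continuous_on (cball 0 R) f" using f continuous_on_subset by blast
  then have "bounded (f ` cball 0 R)" by (intro compact_imp_bounded compact_continuous_image) auto
  then obtain B where B: "B > 0" "\<And>z. z \<in> cball 0 R \<Longrightarrow> norm (f z) \<le> B"
    unfolding bounded_pos by (metis imageI)
  then have "norm (f z) \<le> B" for z by (cases "norm z \<le> R") (auto simp: supp)
  moreover have "(\<lambda>z. indicator (cball 0 R) z *\<^sub>R f z) = f"
    using supp by (fastforce simp: indicator_def fun_eq_iff)
  then have "integrable lborel f" using borel_integrable_compact[OF _ cont] by simp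
  ultimately show ?thesis using B(1) that by blast
qed

text \<open>The integral is the limit of the vanishing integrals of difference quotients.\<close>

lemma integral_directional_derivative_eq_0:
  fixes v :: "complex \<Rightarrow> complex"
  assumes v: "\<And>z. (v has_derivative v' z) (at z)" and cont: "continuous_on UNIV (\<lambda>z. v' z e)"
    and supp: "\<And>z. norm z \<ge> R \<Longrightarrow> v z = 0" "\<And>z. norm z \<ge> R \<Longrightarrow> v' z e = 0"
  shows "(CLBINT z. v' z e) = 0"
proof -
  have vc: "continuous_on UNIV v"
    using v by (meson continuous_at_imp_continuous_on has_derivative_continuous)
  then have [measurable]: "v \<in> borel_measurable borel" by (rule borel_measurable_continuous_onI)
  have [measurable]: "(\<lambda>z. v' z e) \<in> borel_measurable borel" by (rule borel_measurable_continuous_onI[OF cont])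
  obtain B where B: "B > 0" "\<And>z. norm (v' z e) \<le> B"
    using continuous_compact_support[OF cont supp(2)] by blast
  have vi: "integrable lborel v" using continuous_compact_support[OF vc supp(1)] by blast
  define h where "h n = inverse (real (Suc n))" for n
  have h: "h n > 0" "h n \<le> 1" for n by (auto simp: h_def inverse_le_1_iff)
  have hlim: "h \<longlonglongrightarrow> 0" unfolding h_def by (rule LIMSEQ_inverse_real_of_nat)
  define s where "s n z = (v (h n *\<^sub>R e + z) - v z) /\<^sub>R h n" for n z
  have s0: "(CLBINT z. s n z) = 0" for n
    unfolding s_def using vi integral_translate_complex[of v "h n *\<^sub>R e"] by simp
  \<comment> \<open>The dominating function: the mean value inequality bounds the quotients by
    \<open>B\<close>, and steps of size at most 1 keep their supports in one ball.\<close>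
  have bound: "norm (s n z) \<le> B * indicator (cball 0 (\<bar>R\<bar> + norm e)) z" for n z
  proof (cases "z \<in> cball 0 (\<bar>R\<bar> + norm e)")
    case True
    have "\<exists>t\<in>{0<..<h n}. norm (v (z + h n *\<^sub>R e) - v (z + 0 *\<^sub>R e)) \<le> norm (v' (z + t *\<^sub>R e) ((h n - 0) *\<^sub>R e))"
    proof (rule mvt_general)
      show "continuous_on {0..h n} (\<lambda>t. v (z + t *\<^sub>R e))"
        by (intro continuous_on_compose2[OF vc] continuous_intros) auto
      show "((\<lambda>t. v (z + t *\<^sub>R e)) has_derivative (\<lambda>x. v' (z + t *\<^sub>R e) (x *\<^sub>R e))) (at t)" for t
        by (rule has_derivative_compose[OF _ v]) (auto intro!: derivative_eq_intros)
    qed (use h in auto)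
    then obtain t where "norm (v (z + h n *\<^sub>R e) - v z) \<le> norm (v' (z + t *\<^sub>R e) (h n *\<^sub>R e))" by auto
    also have "v' (z + t *\<^sub>R e) (h n *\<^sub>R e) = h n *\<^sub>R v' (z + t *\<^sub>R e) e"
      by (rule linear_simps[OF has_derivative_bounded_linear[OF v]])
    also have "norm \<dots> \<le> h n * B" using h[of n] B(2) by (simp add: mult_left_mono)
    finally have "norm (v (h n *\<^sub>R e + z) - v z) / h n \<le> B" using h(1)[of n]
      by (simp add: pos_divide_le_eq add.commute mult.commute)
    then show ?thesis using True h(1)[of n] by (simp add: s_def divide_inverse mult.commute)
  next
    case False
    then have "norm z \<ge> \<bar>R\<bar> + norm e" by simp
    moreover have "norm (h n *\<^sub>R e) \<le> norm e" using h[of n] by (simp add: mult_left_le_one_le)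
    moreover have "norm z \<le> norm (h n *\<^sub>R e + z) + norm (h n *\<^sub>R e)"
      using norm_triangle_ineq4[of "h n *\<^sub>R e + z" "h n *\<^sub>R e"] by simp
    moreover have "R \<le> \<bar>R\<bar>" "0 \<le> norm e" by simp_all
    ultimately have "norm (h n *\<^sub>R e + z) \<ge> R" "norm z \<ge> R" by linarith+
    then have "s n z = 0" by (simp add: s_def supp)
    then show ?thesis using False by simp
  qed
  have lim: "(\<lambda>n. s n z) \<longlonglongrightarrow> v' z e" for z
  proof -
    have "((\<lambda>t. v (z + t *\<^sub>R e)) has_derivative (\<lambda>x. v' (z + 0 *\<^sub>R e) (x *\<^sub>R e))) (at 0)"
      by (rule has_derivative_compose[OF _ v]) (auto intro!: derivative_eq_intros)
    then have "((\<lambda>t. v (z + t *\<^sub>R e)) has_vector_derivative v' z e) (at 0)"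
      unfolding has_vector_derivative_def
      by (simp add: linear_simps[OF has_derivative_bounded_linear[OF v]])
    then have "((\<lambda>t. norm (v (z + t *\<^sub>R e) - v z - t *\<^sub>R v' z e) / norm t) \<longlongrightarrow> 0) (at 0)"
      by (simp add: has_vector_derivative_def has_derivative_iff_norm)
    then have "((\<lambda>t. norm ((v (z + t *\<^sub>R e) - v z) /\<^sub>R t - v' z e)) \<longlongrightarrow> 0) (at 0)"
    proof (rule Lim_transform_eventually)
      have "norm (a - t *\<^sub>R b) / norm t = norm (a /\<^sub>R t - b)" if "t \<noteq> 0" for t and a b :: complex
      proof -
        have "a /\<^sub>R t - b = (a - t *\<^sub>R b) /\<^sub>R t" using that by (simp add: algebra_simps)
        then show ?thesis by (simp add: divide_inverse mult.commute)
      qed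
      then show "\<forall>\<^sub>F t in at 0. norm (v (z + t *\<^sub>R e) - v z - t *\<^sub>R v' z e) / norm t
          = norm ((v (z + t *\<^sub>R e) - v z) /\<^sub>R t - v' z e)"
        by (auto simp: eventually_at_filter)
    qed
    then have "((\<lambda>t. (v (z + t *\<^sub>R e) - v z) /\<^sub>R t) \<longlongrightarrow> v' z e) (at 0)"
      by (simp add: tendsto_norm_zero_iff LIM_zero_iff)
    moreover have "filterlim h (at 0) sequentially"
      using hlim h(1) by (intro filterlim_atI) (auto simp: less_imp_neq[symmetric] intro!: always_eventually)
    ultimately have "(\<lambda>n. (v (z + h n *\<^sub>R e) - v z) /\<^sub>R h n) \<longlonglongrightarrow> v' z e"
      by (rule filterlim_compose)
    then show ?thesis by (simp add: s_def add.commute)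
  qed
  have "(\<lambda>n. \<integral>z. s n z \<partial>lborel) \<longlonglongrightarrow> (CLBINT z. v' z e)"
  proof (rule integral_dominated_convergence)
    show "integrable lborel (\<lambda>z. B * indicator (cball 0 (\<bar>R\<bar> + norm e)) (z::complex) :: real)"
      using emeasure_lborel_cball_finite by (intro integrable_mult_right integrable_real_indicator) auto
    show "s n \<in> borel_measurable lborel" for n unfolding s_def by measurable
  qed (use bound lim in auto)
  then show ?thesis by (simp add: s0 LIMSEQ_const_iff)
qed


text \<open>The Wirtinger derivative with respect to cnj z, where \<open>u' z\<close> is the real
  derivative of \<open>u\<close> at \<open>z\<close>; it is 0 when \<open>u' z\<close> is complex
  linear.\<close>

definition dbar :: "(complex \<Rightarrow> complex \<Rightarrow> complex) \<Rightarrow> complex \<Rightarrow> complex" where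
  "dbar u' z = (u' z 1 + \<i> * u' z \<i>) / 2"

lemma continuous_on_dbar:
  assumes "continuous_on S (\<lambda>z. u' z 1)" "continuous_on S (\<lambda>z. u' z \<i>)"
  shows "continuous_on S (dbar u')"
  unfolding dbar_def[abs_def] by (auto intro!: continuous_intros assms)

text \<open>
  A Cauchy--Pompeiu formula; the constant \<open>bell_mass\<close> is \<open>\<pi>\<close>, but only its positivity matters.
  The kernel \<open>1 / y\<close> is regularised to \<open>cnj y / (\<bar>y\<bar>\<^sup>2 + \<epsilon>\<^sup>2)\<close>, whose \<open>dbar\<close> is \<open>\<epsilon>\<^sup>2 / (\<bar>y\<bar>\<^sup>2 + \<epsilon>\<^sup>2)\<^sup>2\<close>.
\<close>

lemma Cauchy_Pompeiu_0:
  fixes u :: "complex \<Rightarrow> complex"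
  assumes u: "\<And>z. (u has_derivative u' z) (at z)"
    and cont: "continuous_on UNIV (\<lambda>z. u' z 1)" "continuous_on UNIV (\<lambda>z. u' z \<i>)"
    and supp: "\<And>z. norm z \<ge> R \<Longrightarrow> u z = 0" "\<And>z h. norm z \<ge> R \<Longrightarrow> u' z h = 0"
  shows "(CLBINT y. dbar u' y / y) = - of_real bell_mass * u 0"
proof -
  define \<epsilon> where "\<epsilon> n = inverse (real (Suc n))" for n
  have \<epsilon>: "\<epsilon> n > 0" for n by (simp add: \<epsilon>_def)
  have \<epsilon>lim: "\<epsilon> \<longlonglongrightarrow> 0" unfolding \<epsilon>_def by (rule LIMSEQ_inverse_real_of_nat)
  define c where "c n = complex_of_real ((\<epsilon> n)\<^sup>2)" for n
  define N where "N n y = y * cnj y + c n" for n y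
  have N_real: "N n y = of_real ((norm y)\<^sup>2 + (\<epsilon> n)\<^sup>2)" for n y
    unfolding N_def c_def of_real_add complex_norm_square ..
  have Npos: "(norm y)\<^sup>2 + (\<epsilon> n)\<^sup>2 > 0" for n y using \<epsilon>[of n] by (simp add: add_nonneg_pos)
  have N0: "N n y \<noteq> 0" for n y unfolding N_real using Npos[of y n] by (simp only: of_real_eq_0_iff)
  define w where "w n y = cnj y / N n y" for n y
  define w' where "w' n y h = (cnj h * N n y - cnj y * (h * cnj y + y * cnj h)) / (N n y)\<^sup>2" for n y h
  have w: "(w n has_derivative w' n y) (at y)" for n y
  proof -
    have "((\<lambda>y. cnj y) has_derivative cnj) (at y)"
      by (rule bounded_linear_imp_has_derivative) (rule bounded_linear_cnj)
    then show ?thesis unfolding w_def[abs_def] w'_def N_def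
      by (auto intro!: derivative_eq_intros simp: N0[unfolded N_def] fun_eq_iff power2_eq_square divide_simps)
  qed
  have wc: "continuous_on UNIV (w n)" "continuous_on UNIV (\<lambda>z. w' n z h)" for n h
    unfolding w_def w'_def N_def by (auto intro!: continuous_intros simp: N0[unfolded N_def])
  have dw: "w' n y 1 + \<i> * w' n y \<i> = 2 * c n / (N n y)\<^sup>2" for n y
  proof -
    have "w' n y 1 + \<i> * w' n y \<i> = (2 * N n y - 2 * (y * cnj y)) / (N n y)\<^sup>2"
      unfolding w'_def by (simp add: add_divide_distrib[symmetric] algebra_simps)
    then show ?thesis by (simp add: N_def)
  qed
  define b where "b n y = c n / (N n y)\<^sup>2" for n y
  have uc: "continuous_on UNIV u"
    using u by (meson continuous_at_imp_continuous_on has_derivative_continuous)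
  have dc: "continuous_on UNIV (dbar u')" by (rule continuous_on_dbar[OF cont])
  have dsupp: "dbar u' z = 0" if "norm z \<ge> R" for z using supp that by (simp add: dbar_def)
  obtain Bu where Bu: "\<And>z. norm (u z) \<le> Bu" using continuous_compact_support[OF uc supp(1)] by metis
  obtain Bd where Bd: "\<And>z. norm (dbar u' z) \<le> Bd" using continuous_compact_support[OF dc dsupp] by metis
  have [measurable]: "u \<in> borel_measurable borel" "dbar u' \<in> borel_measurable borel" "w n \<in> borel_measurable borel"
      "b n \<in> borel_measurable borel" for n
    unfolding b_def N_def using uc dc wc(1)
    by (auto intro!: borel_measurable_continuous_onI continuous_intros simp: N0[unfolded N_def])
  \<comment> \<open>Integration by parts: \<open>b n\<close> is the \<open>dbar\<close> of
    \<open>w n\<close>, and the \<open>dbar\<close> of the compactly supported product of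
    \<open>u\<close> and \<open>w n\<close> has integral 0.\<close>
  have parts: "(CLBINT y. dbar u' y * w n y) = - (CLBINT y. u y * b n y)" for n
  proof -
    define v' where "v' y h = u y * w' n y h + u' y h * w n y" for y h
    have v: "((\<lambda>y. u y * w n y) has_derivative v' z) (at z)" for z
      unfolding v'_def using has_derivative_mult[OF u w] by blast
    have vc: "continuous_on UNIV (\<lambda>y. v' y 1)" "continuous_on UNIV (\<lambda>y. v' y \<i>)"
      unfolding v'_def by (intro continuous_intros uc wc cont)+
    have vs: "u z * w n z = 0" "v' z h = 0" if "norm z \<ge> R" for z h
      using supp that by (auto simp: v'_def)
    have v0: "(CLBINT z. v' z 1) = 0" "(CLBINT z. v' z \<i>) = 0"
      using integral_directional_derivative_eq_0[OF v vc(1) vs] integral_directional_derivative_eq_0[OF v vc(2) vs]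
      by simp_all
    have vi: "integrable lborel (\<lambda>z. v' z 1)" "integrable lborel (\<lambda>z. v' z \<i>)"
      using continuous_compact_support[OF vc(1) vs(2)] continuous_compact_support[OF vc(2) vs(2)] by blast+
    have i1: "integrable lborel (\<lambda>y. dbar u' y * w n y)"
      by (rule continuous_compact_support[of "\<lambda>y. dbar u' y * w n y" R])
         (auto intro!: continuous_intros dc wc simp: dsupp)
    have bc: "continuous_on UNIV (b n)"
      unfolding b_def N_def by (auto intro!: continuous_intros simp: N0[unfolded N_def])
    have i2: "integrable lborel (\<lambda>y. u y * b n y)"
      by (rule continuous_compact_support[of "\<lambda>y. u y * b n y" R])
         (auto intro!: continuous_intros uc bc simp: supp)
    have "v' z 1 + \<i> * v' z \<i> = 2 * (dbar u' z * w n z + u z * b n z)" for z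
    proof -
      have "v' z 1 + \<i> * v' z \<i> = u z * (w' n z 1 + \<i> * w' n z \<i>) + (u' z 1 + \<i> * u' z \<i>) * w n z"
        by (simp add: v'_def algebra_simps)
      then show ?thesis unfolding dw by (simp add: dbar_def b_def algebra_simps)
    qed
    then have "(CLBINT z. 2 * (dbar u' z * w n z + u z * b n z)) = (CLBINT z. v' z 1 + \<i> * v' z \<i>)"
      by simp
    also have "\<dots> = 0" using vi v0 by simp
    finally have "2 * ((CLBINT z. dbar u' z * w n z) + (CLBINT z. u z * b n z)) = 0"
      using i1 i2 by (simp add: distrib_left)
    then have "(CLBINT z. dbar u' z * w n z) + (CLBINT z. u z * b n z) = 0"
      by (simp only: mult_eq_0_iff) simp
    then show ?thesis by (simp add: add_eq_0_iff2)
  qed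
  \<comment> \<open>The substitution y = \<epsilon> \<eta> has Jacobian \<epsilon>^2 and turns
    \<open>b n\<close> into \<open>bell\<close>, so that \<open>n\<close> is left only in the
    argument of \<open>u\<close>.\<close>
  have rhs: "(CLBINT y. u y * b n y) = (CLBINT \<eta>. u (\<epsilon> n *\<^sub>R \<eta>) * of_real (bell \<eta>))" for n
  proof -
    have e: "(\<epsilon> n)\<^sup>2 *\<^sub>R b n (\<epsilon> n *\<^sub>R \<eta>) = of_real (bell \<eta>)" for \<eta>
    proof -
      have "(norm (\<epsilon> n *\<^sub>R \<eta>))\<^sup>2 + (\<epsilon> n)\<^sup>2 = (\<epsilon> n)\<^sup>2 * (1 + (norm \<eta>)\<^sup>2)"
        by (simp add: power_mult_distrib algebra_simps)
      then have "b n (\<epsilon> n *\<^sub>R \<eta>) = of_real ((\<epsilon> n)\<^sup>2 / ((\<epsilon> n)\<^sup>2 * (1 + (norm \<eta>)\<^sup>2))\<^sup>2)"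
        unfolding b_def N_real c_def by (simp only: of_real_divide of_real_power)
      moreover have "(\<epsilon> n)\<^sup>2 * ((\<epsilon> n)\<^sup>2 / ((\<epsilon> n)\<^sup>2 * (1 + (norm \<eta>)\<^sup>2))\<^sup>2) = bell \<eta>"
        unfolding bell_def power_mult_distrib using \<epsilon>[of n] by (simp add: power2_eq_square)
      ultimately show ?thesis by (simp only: scaleR_conv_of_real of_real_mult[symmetric])
    qed
    have "(CLBINT y. u y * b n y) = (\<epsilon> n)\<^sup>2 *\<^sub>R (CLBINT \<eta>. u (\<epsilon> n *\<^sub>R \<eta>) * b n (\<epsilon> n *\<^sub>R \<eta>))"
      by (rule integral_scale_complex) (use \<epsilon> in auto)
    also have "\<dots> = (CLBINT \<eta>. u (\<epsilon> n *\<^sub>R \<eta>) * ((\<epsilon> n)\<^sup>2 *\<^sub>R b n (\<epsilon> n *\<^sub>R \<eta>)))"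
      by (simp flip: integral_scaleR_right)
    finally show ?thesis by (simp only: e)
  qed
  have "(\<lambda>n. \<integral>\<eta>. u (\<epsilon> n *\<^sub>R \<eta>) * of_real (bell \<eta>) \<partial>lborel) \<longlonglongrightarrow> (CLBINT \<eta>. u 0 * of_real (bell \<eta>))"
  proof (rule integral_dominated_convergence)
    show "integrable lborel (\<lambda>\<eta>. Bu * bell \<eta>)" by (intro integrable_mult_right integrable_bell)
    show "AE \<eta> in lborel. (\<lambda>n. u (\<epsilon> n *\<^sub>R \<eta>) * of_real (bell \<eta>)) \<longlonglongrightarrow> u 0 * of_real (bell \<eta>)"
    proof (rule AE_I2)
      fix \<eta> :: complex
      have "(\<lambda>n. \<epsilon> n *\<^sub>R \<eta>) \<longlonglongrightarrow> 0 *\<^sub>R \<eta>" by (intro tendsto_intros \<epsilon>lim)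
      moreover have "isCont u 0" using uc by (simp add: continuous_on_eq_continuous_at)
      ultimately have "(\<lambda>n. u (\<epsilon> n *\<^sub>R \<eta>)) \<longlonglongrightarrow> u 0" by (auto intro: isCont_tendsto_compose)
      then show "(\<lambda>n. u (\<epsilon> n *\<^sub>R \<eta>) * of_real (bell \<eta>)) \<longlonglongrightarrow> u 0 * of_real (bell \<eta>)"
        by (intro tendsto_intros)
    qed
    show "AE \<eta> in lborel. norm (u (\<epsilon> n *\<^sub>R \<eta>) * of_real (bell \<eta>)) \<le> Bu * bell \<eta>" for n
      unfolding norm_mult norm_of_real abs_of_nonneg[OF bell_nonneg]
      by (intro AE_I2 mult_right_mono Bu bell_nonneg)
  qed auto
  moreover have "(CLBINT \<eta>. u 0 * of_real (bell \<eta>)) = u 0 * of_real bell_mass"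
    by (simp add: bell_mass_def)
  ultimately have lim1: "(\<lambda>n. \<integral>y. dbar u' y * w n y \<partial>lborel) \<longlonglongrightarrow> - (u 0 * of_real bell_mass)"
    unfolding parts rhs by (intro tendsto_minus) (simp only:)
  have "(\<lambda>n. \<integral>y. dbar u' y * w n y \<partial>lborel) \<longlonglongrightarrow> (CLBINT y. dbar u' y / y)"
  proof (rule integral_dominated_convergence)
    have "integrable lborel (\<lambda>y. dbar u' y / (y - 0))"
      by (rule Cauchy_kernel_integral(1)[OF _ Bd, where R = "\<bar>R\<bar>" and c = 0]) (auto simp: dsupp)
    then show "integrable lborel (\<lambda>y. norm (dbar u' y / y))" by simp
    \<comment> \<open>The unregularised kernel dominates, and its product with the bounded,
      compactly supported \<open>dbar u'\<close> is integrable. At 0 both sides are 0 by division by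
      zero.\<close>
    have "norm (w n y) \<le> norm (1 / y)" for n y
    proof (cases "y = 0")
      case False
      have "norm (w n y) = norm y / ((norm y)\<^sup>2 + (\<epsilon> n)\<^sup>2)"
        unfolding w_def N_real norm_divide norm_of_real complex_mod_cnj using Npos[of y n] by simp
      also have "\<dots> \<le> norm y / (norm y)\<^sup>2" using False by (intro frac_le) auto
      finally show ?thesis using False by (simp add: norm_divide power2_eq_square)
    qed (simp add: w_def)
    then show "AE y in lborel. norm (dbar u' y * w n y) \<le> norm (dbar u' y / y)" for n
      by (intro AE_I2) (simp add: norm_mult norm_divide divide_inverse norm_inverse mult_left_mono)
    show "AE y in lborel. (\<lambda>n. dbar u' y * w n y) \<longlonglongrightarrow> dbar u' y / y"
    proof (rule AE_I2)
      fix y :: complex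
      show "(\<lambda>n. dbar u' y * w n y) \<longlonglongrightarrow> dbar u' y / y"
      proof (cases "y = 0")
        case False
        have "(\<lambda>n. dbar u' y * w n y) \<longlonglongrightarrow> dbar u' y * (cnj y / (y * cnj y + of_real (0\<^sup>2)))"
          unfolding w_def N_def c_def using False by (intro tendsto_intros \<epsilon>lim) auto
        then show ?thesis using False by simp
      qed (simp add: w_def)
    qed
  qed auto
  with lim1 have "(CLBINT y. dbar u' y / y) = - (u 0 * of_real bell_mass)"
    by (rule LIMSEQ_unique[rotated])
  then show ?thesis by simp
qed

lemma Cauchy_Pompeiu:
  fixes u :: "complex \<Rightarrow> complex"
  assumes u: "\<And>z. (u has_derivative u' z) (at z)"
    and cont: "continuous_on UNIV (\<lambda>z. u' z 1)" "continuous_on UNIV (\<lambda>z. u' z \<i>)"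
    and supp: "\<And>z. z \<notin> ball c R \<Longrightarrow> u z = 0" "\<And>z h. z \<notin> ball c R \<Longrightarrow> u' z h = 0"
  shows "(CLBINT y. dbar u' y / (y - z)) = - of_real bell_mass * u z"
proof -
  have "(CLBINT y. dbar (\<lambda>y. u' (z + y)) y / y) = - of_real bell_mass * u (z + 0)"
  proof (rule Cauchy_Pompeiu_0[where R = "\<bar>R\<bar> + norm (c - z)"])
    show "((\<lambda>y. u (z + y)) has_derivative u' (z + y)) (at y)" for y
      using has_derivative_compose[OF has_derivative_add[OF has_derivative_const has_derivative_ident] u, of z y UNIV]
      by simp
    show "continuous_on UNIV (\<lambda>y. u' (z + y) 1)" "continuous_on UNIV (\<lambda>y. u' (z + y) \<i>)"
      by (rule continuous_on_compose2[OF cont(1)] continuous_on_compose2[OF cont(2)]; auto intro!: continuous_intros)+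
    have "z + y \<notin> ball c R" if "\<bar>R\<bar> + norm (c - z) \<le> norm y" for y
      using that norm_triangle_ineq4[of "c - z" "c - (z + y)"] by (auto simp: dist_norm)
    then show "u (z + y) = 0" "u' (z + y) h = 0" if "\<bar>R\<bar> + norm (c - z) \<le> norm y" for y h
      using supp that by blast+
  qed
  moreover have "continuous_on UNIV (dbar u')" by (rule continuous_on_dbar[OF cont])
  then have [measurable]: "dbar u' \<in> borel_measurable borel" by (rule borel_measurable_continuous_onI)
  have "(CLBINT y. dbar u' (z + y) / ((z + y) - z)) = (CLBINT y. dbar u' y / (y - z))"
    by (rule integral_translate_complex(1)) measurable
  ultimately show ?thesis by (simp add: dbar_def)
qed

section \<open>Localisation by a partition of unity\<close>

definition pos_sq :: "real \<Rightarrow> real" where "pos_sq t = (max 0 t)\<^sup>2"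

lemma pos_sq_deriv: "(pos_sq has_real_derivative 2 * max 0 t) (at t)"
proof -
  consider "t > 0" | "t < 0" | "t = 0" by linarith
  then show ?thesis
  proof cases
    case 1
    have "((\<lambda>t. t\<^sup>2) has_real_derivative 2 * max 0 t) (at t)"
      using 1 by (auto intro!: derivative_eq_intros)
    then show ?thesis
      by (rule has_field_derivative_transform_within_open[where S = "{0<..}"]) (use 1 in \<open>auto simp: pos_sq_def\<close>)
  next
    case 2
    have "((\<lambda>t. 0) has_real_derivative 2 * max 0 t) (at t)"
      using 2 by (auto intro!: derivative_eq_intros)
    then show ?thesis
      by (rule has_field_derivative_transform_within_open[where S = "{..<0}"]) (use 2 in \<open>auto simp: pos_sq_def\<close>)
  next
    case 3
    have "((\<lambda>h. \<bar>h\<bar>) \<longlongrightarrow> 0) (at (0::real))" by (auto intro!: tendsto_eq_intros)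
    moreover have "norm (pos_sq h / h) \<le> \<bar>h\<bar>" for h
    proof (cases "h > 0")
      case True
      then have "pos_sq h / h = h" by (simp add: pos_sq_def power2_eq_square)
      then show ?thesis by simp
    qed (simp add: pos_sq_def)
    then have "\<forall>\<^sub>F h in at 0. norm (pos_sq h / h) \<le> \<bar>h\<bar>" by (rule always_eventually[OF allI])
    ultimately have "((\<lambda>h. pos_sq h / h) \<longlongrightarrow> 0) (at 0)"
      by (rule Lim_null_comparison[rotated])
    then show ?thesis using 3 by (simp add: DERIV_def pos_sq_def)
  qed
qed

text \<open>A continuously differentiable step: 2 t^2 on [0, 1/2] and 1 - 2 (1 - t)^2 on [1/2, 1],
  constant elsewhere. In terms of \<open>pos_sq\<close> the derivative is a single formula.\<close>

definition ramp :: "real \<Rightarrow> real" where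
  "ramp t = 2 * pos_sq t - 4 * pos_sq (t - 1/2) + 2 * pos_sq (t - 1)"

definition ramp' :: "real \<Rightarrow> real" where
  "ramp' t = 4 * max 0 t - 8 * max 0 (t - 1/2) + 4 * max 0 (t - 1)"

lemma ramp_deriv: "(ramp has_real_derivative ramp' t) (at t)"
proof -
  have "((\<lambda>t. pos_sq (t - a)) has_real_derivative 2 * max 0 (t - a)) (at t)" for a
    using pos_sq_deriv[of "t + - a"] DERIV_shift[of pos_sq _ t "- a"] by simp
  note d = DERIV_add[OF DERIV_diff[OF DERIV_cmult[OF pos_sq_deriv[of t], of 2] DERIV_cmult[OF this, of 4 "1/2"]]
      DERIV_cmult[OF this, of 2 1]]
  show ?thesis unfolding ramp_def[abs_def] by (rule DERIV_cong[OF d]) (simp add: ramp'_def)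
qed

lemma ramp_simps: "t \<le> 0 \<Longrightarrow> ramp t = 0" "t \<ge> 1 \<Longrightarrow> ramp t = 1"
    "t \<le> 0 \<Longrightarrow> ramp' t = 0" "t \<ge> 1 \<Longrightarrow> ramp' t = 0"
proof -
  show "ramp t = 0" "ramp' t = 0" if "t \<le> 0"
    using that by (simp_all add: ramp_def ramp'_def pos_sq_def max_absorb1)
  assume "t \<ge> 1"
  then have "max 0 t = t" "max 0 (t - 1/2) = t - 1/2" "max 0 (t - 1) = t - 1" by linarith+
  then show "ramp t = 1" "ramp' t = 0"
    unfolding ramp_def ramp'_def pos_sq_def by (simp_all only: power2_diff) (simp_all add: power2_eq_square)
qed

text \<open>A difference of consecutive steps, so that sums over integer translates telescope; it
  vanishes off [-1, 1].\<close>

definition hat :: "real \<Rightarrow> real" where "hat t = ramp (t + 1) - ramp t"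
definition hat' :: "real \<Rightarrow> real" where "hat' t = ramp' (t + 1) - ramp' t"

lemma hat_deriv: "(hat has_real_derivative hat' t) (at t)"
proof -
  have "((\<lambda>t. ramp (t + 1)) has_real_derivative ramp' (t + 1)) (at t)"
    using ramp_deriv[of "t + 1"] DERIV_shift[of ramp _ t 1] by simp
  then show ?thesis
    unfolding hat_def[abs_def] hat'_def by (intro DERIV_diff ramp_deriv)
qed

lemma hat_outside: "\<bar>t\<bar> \<ge> 1 \<Longrightarrow> hat t = 0" "\<bar>t\<bar> \<ge> 1 \<Longrightarrow> hat' t = 0"
proof -
  assume "\<bar>t\<bar> \<ge> 1"
  then have "t + 1 \<le> 0 \<and> t \<le> 0 \<or> t + 1 \<ge> 1 \<and> t \<ge> 1" by linarith
  then show "hat t = 0" "hat' t = 0" by (auto simp: hat_def hat'_def ramp_simps)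
qed

lemma hat_continuous: "continuous_on UNIV hat" "continuous_on UNIV hat'"
proof -
  show "continuous_on UNIV hat"
    using hat_deriv DERIV_isCont by (metis continuous_at_imp_continuous_on)
  show "continuous_on UNIV hat'"
    unfolding hat'_def[abs_def] ramp'_def by (intro continuous_intros)
qed

lemma sum_hat: "(\<Sum>j=0..n. hat (t - of_int (int j - m))) = ramp (t + of_int m + 1) - ramp (t + of_int m - real n)"
proof (induction n)
  case (Suc n)
  have "hat (t - of_int (int (Suc n) - m)) = ramp (t + of_int m - real n) - ramp (t + of_int m - real (Suc n))"
    by (simp add: hat_def diff_diff_eq2) (simp add: algebra_simps)
  then show ?case using Suc by simp
qed (simp add: hat_def algebra_simps)

definition tent :: "complex \<Rightarrow> complex" where
  "tent z = of_real (hat (Re z) * hat (Im z))"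

definition tent' :: "complex \<Rightarrow> complex \<Rightarrow> complex" where
  "tent' z h = of_real (hat' (Re z) * hat (Im z) * Re h + hat (Re z) * hat' (Im z) * Im h)"

lemma tent_deriv: "(tent has_derivative tent' z) (at z)"
proof -
  have h: "(hat has_derivative (\<lambda>h. hat' t * h)) (at t)" for t
    using hat_deriv unfolding has_field_derivative_def .
  have 1: "((\<lambda>z. hat (Re z)) has_derivative (\<lambda>h. hat' (Re z) * Re h)) (at z)"
    by (rule has_derivative_compose[OF _ h]) (auto intro!: derivative_eq_intros)
  have 2: "((\<lambda>z. hat (Im z)) has_derivative (\<lambda>h. hat' (Im z) * Im h)) (at z)"
    by (rule has_derivative_compose[OF _ h]) (auto intro!: derivative_eq_intros)
  show ?thesis unfolding tent_def[abs_def]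
    using has_derivative_of_real[OF has_derivative_mult[OF 1 2]]
    by (rule has_derivative_eq_rhs) (simp add: tent'_def fun_eq_iff algebra_simps)
qed

text \<open>The square carrying \<open>tent\<close> has half-diagonal sqrt 2; 3/2 is a convenient
  radius between sqrt 2 and 2.\<close>

lemma norm_le_Re_Im: "\<bar>Re z\<bar> \<le> 1 \<Longrightarrow> \<bar>Im z\<bar> \<le> 1 \<Longrightarrow> norm z < 3/2"
proof -
  assume "\<bar>Re z\<bar> \<le> 1" "\<bar>Im z\<bar> \<le> 1"
  then have "(Re z)\<^sup>2 \<le> 1" "(Im z)\<^sup>2 \<le> 1" by (simp_all add: abs_square_le_1)
  then have "(norm z)\<^sup>2 < (3/2)\<^sup>2" unfolding cmod_power2 by (simp add: power2_eq_square)
  then show "norm z < 3/2" by (rule power_less_imp_less_base) simp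
qed

lemma tent_outside: "norm z \<ge> 3/2 \<Longrightarrow> tent z = 0" "norm z \<ge> 3/2 \<Longrightarrow> tent' z h = 0"
proof -
  assume "norm z \<ge> 3/2"
  then have "\<bar>Re z\<bar> \<ge> 1 \<or> \<bar>Im z\<bar> \<ge> 1" using norm_le_Re_Im[of z] by linarith
  then have "hat (Re z) = 0 \<and> hat' (Re z) = 0 \<or> hat (Im z) = 0 \<and> hat' (Im z) = 0"
    using hat_outside by blast
  then show "tent z = 0" "tent' z h = 0" by (auto simp: tent_def tent'_def)
qed

lemma tent_continuous: "continuous_on UNIV tent" "continuous_on UNIV (\<lambda>z. tent' z h)"
proof -
  have h: "continuous_on UNIV (\<lambda>z::complex. hat (g z))" "continuous_on UNIV (\<lambda>z::complex. hat' (g z))"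
    if "continuous_on UNIV g" for g
    by (rule continuous_on_compose2[OF hat_continuous(1) that], simp)
       (rule continuous_on_compose2[OF hat_continuous(2) that], simp)
  show "continuous_on UNIV tent" "continuous_on UNIV (\<lambda>z. tent' z h)"
    unfolding tent_def[abs_def] tent'_def by (intro continuous_intros h)+
qed

lemma dbar_tent_continuous: "continuous_on UNIV (dbar tent')"
  by (rule continuous_on_dbar; rule tent_continuous)

lemma dbar_tent_outside: "norm z \<ge> 3/2 \<Longrightarrow> dbar tent' z = 0"
  by (simp add: dbar_def tent_outside)

lemma tent_bounded:
  obtains M where "M > 0" "\<And>z. norm (tent z) \<le> M" "\<And>z. norm (dbar tent' z) \<le> M"
proof -
  obtain A where A: "A > 0" "\<And>z. norm (tent z) \<le> A"
    using continuous_compact_support[OF tent_continuous(1) tent_outside(1)] by metis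
  obtain B where B: "B > 0" "\<And>z. norm (dbar tent' z) \<le> B"
    using continuous_compact_support[OF dbar_tent_continuous dbar_tent_outside] by metis
  show ?thesis by (rule that[of "max A B"]) (use A B in \<open>auto intro: order_trans max.coboundedI1 max.coboundedI2\<close>)
qed

text \<open>Vitushkin's localisation operator. For smooth \<open>f\<close> it is - 1 /
  \<open>bell_mass\<close> times the integral of tent (y - c) * (dbar f)(y) / (y - z); integration
  by parts gives the present form, which makes sense for continuous \<open>f\<close>.\<close>

definition localise :: "complex \<Rightarrow> (complex \<Rightarrow> complex) \<Rightarrow> complex \<Rightarrow> complex" where
  "localise c f z = tent (z - c) * f z
     + (CLBINT y. f y * dbar tent' (y - c) / (y - z)) / of_real bell_mass"

text \<open>Cauchy--Pompeiu for \<open>tent (z - c) * f z\<close>, whose \<open>dbar\<close> is \<open>f z * dbar tent' (z - c)\<close>.\<close>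

lemma localise_eq_0:
  assumes f: "f holomorphic_on U" "open U" "cball c 2 \<subseteq> U"
  shows "localise c f z = 0"
proof -
  define u where "u z = tent (z - c) * f z" for z
  define u' where "u' z h = tent' (z - c) h * f z + tent (z - c) * (deriv f z * h)" for z h
  \<comment> \<open>The cut-off vanishes on \<open>V\<close>, so \<open>u\<close> is differentiable
    there whatever \<open>f\<close> does; \<open>U\<close> and \<open>V\<close> are open and cover
    the plane because 3/2 < 2.\<close>
  define V where "V = - cball c (3/2)"
  have V: "tent (z - c) = 0" "tent' (z - c) h = 0" if "z \<in> V" for z h
    using that by (auto simp: V_def dist_norm norm_minus_commute intro!: tent_outside)
  have UV: "U \<union> V = UNIV" using f(3) by (auto simp: V_def subset_iff)
  have "open V" by (auto simp: V_def)
  have tc: "((\<lambda>z. tent (z - c)) has_derivative tent' (z - c)) (at z)" for z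
    using has_derivative_compose[OF has_derivative_diff[OF has_derivative_ident has_derivative_const] tent_deriv, of c z UNIV]
    by simp
  have deriv: "(u has_derivative u' z) (at z)" for z
  proof (cases "z \<in> U")
    case True
    then have "(f has_field_derivative deriv f z) (at z)" using f holomorphic_derivI by blast
    then have "(f has_derivative (\<lambda>h. deriv f z * h)) (at z)" by (simp add: has_field_derivative_def)
    from has_derivative_mult[OF tc this] show ?thesis
      unfolding u_def[abs_def] by (rule has_derivative_eq_rhs) (simp add: u'_def fun_eq_iff)
  next
    case False
    then have z: "z \<in> V" using UV by auto
    have "((\<lambda>z. 0) has_derivative u' z) (at z)"
      using V[OF z] by (simp add: u'_def[abs_def])
    then show ?thesis
      by (rule has_derivative_transform_within_open[OF _ \<open>open V\<close> z]) (simp add: u_def V)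
  qed
  have cont: "continuous_on UNIV (\<lambda>z. u' z h)" for h
  proof -
    have "continuous_on U (\<lambda>z. u' z h)"
      unfolding u'_def using f
      by (intro continuous_intros continuous_on_compose2[OF tent_continuous(1)] continuous_on_compose2[OF tent_continuous(2)]
            holomorphic_on_imp_continuous_on holomorphic_deriv) auto
    moreover have "continuous_on V (\<lambda>z. u' z h)"
      by (rule continuous_on_eq[OF continuous_on_const[of _ 0]]) (simp add: u'_def V)
    ultimately show ?thesis using continuous_on_open_Un[OF f(2) \<open>open V\<close>] UV by metis
  qed
  have out: "u z = 0" "u' z h = 0" if "z \<notin> ball c 2" for z h
    using that by (auto simp: u_def u'_def V V_def)
  have "(CLBINT y. dbar u' y / (y - z)) = - of_real bell_mass * u z"
    by (rule Cauchy_Pompeiu[OF deriv cont cont out])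
  moreover have "dbar u' y = f y * dbar tent' (y - c)" for y
    by (simp add: dbar_def u'_def algebra_simps)
  ultimately show ?thesis using bell_mass_pos by (simp add: localise_def u_def)
qed

lemma localise_measurable:
  assumes "continuous_on UNIV f"
  shows "(\<lambda>y. f y * dbar tent' (y - c)) \<in> borel_measurable borel"
  by (intro borel_measurable_continuous_onI continuous_intros assms continuous_on_compose2[OF dbar_tent_continuous]) auto

lemma localise_integrable:
  assumes f: "continuous_on UNIV f"
  shows "integrable lborel (\<lambda>y. f y * dbar tent' (y - c) / (y - z))"
proof -
  have c: "continuous_on UNIV (\<lambda>y. f y * dbar tent' (y - c))"
    by (intro continuous_intros f continuous_on_compose2[OF dbar_tent_continuous]) auto
  have out: "f y * dbar tent' (y - c) = 0" if "y \<notin> ball c 2" for y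
    using that by (auto simp: dist_norm norm_minus_commute dbar_tent_outside)
  have "f y * dbar tent' (y - c) = 0" if "norm y \<ge> norm c + 2" for y
    by (rule out) (use that norm_triangle_ineq2[of y c] in \<open>auto simp: dist_norm norm_minus_commute\<close>)
  then obtain B where "\<And>y. norm (f y * dbar tent' (y - c)) \<le> B"
    using continuous_compact_support[OF c] by metis
  then show ?thesis
    by (intro Cauchy_kernel_integral(1)[where R = 2 and c = c] localise_measurable f out) auto
qed

text \<open>Constants localise to 0. Subtracting \<open>f c\<close> therefore turns bounds by the
  size of \<open>f\<close> into bounds by its oscillation near \<open>c\<close>.\<close>

lemma localise_diff_const:
  assumes "continuous_on UNIV f"
  shows "localise c f z = localise c (\<lambda>z. f z - a) z"
proof -
  have "localise c (\<lambda>z. a) z = 0" by (rule localise_eq_0[of _ UNIV]) auto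
  moreover have "localise c (\<lambda>z. f z - a) z = localise c f z - localise c (\<lambda>z. a) z"
    using localise_integrable[OF assms, of c z] localise_integrable[of "\<lambda>z. a" c z]
    by (simp add: localise_def left_diff_distrib right_diff_distrib diff_divide_distrib)
  ultimately show ?thesis by simp
qed

text \<open>Far from \<open>c\<close> only the integral survives. With t = z - m, the kernel 1 / (y
  - z) is - 1 / t - (y - m) / t^2 + (y - m)^2 / (t^2 (y - z)), so \<alpha> and \<beta> are moments
  of the density and the last term is the remainder. The centre \<open>m\<close> is left free within
  distance 4 of \<open>c\<close>, since it has to agree with the centre of the approximant matching
  these terms.\<close>

lemma localise_bounds:
  obtains K where "K > 0"
    "\<And>f c \<omega> z. continuous_on UNIV f \<Longrightarrow> (\<And>y. y \<in> ball c 2 \<Longrightarrow> norm (f y - f c) \<le> \<omega>) \<Longrightarrow> norm (localise c f z) \<le> K * \<omega>"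
    "\<And>f c \<omega> m. continuous_on UNIV f \<Longrightarrow> (\<And>y. y \<in> ball c 2 \<Longrightarrow> norm (f y - f c) \<le> \<omega>) \<Longrightarrow> norm (m - c) \<le> 4 \<Longrightarrow>
       \<exists>\<alpha> \<beta>. norm \<alpha> \<le> K * \<omega> \<and> norm \<beta> \<le> K * \<omega> \<and> (\<forall>z. norm (z - m) \<ge> 12 \<longrightarrow>
          norm (localise c f z - \<alpha> / (z - m) - \<beta> / (z - m)\<^sup>2) \<le> K * \<omega> / norm (z - m) ^ 3)"
proof -
  obtain M where M: "M > 0" "\<And>z. norm (tent z) \<le> M" "\<And>z. norm (dbar tent' z) \<le> M"
    using tent_bounded by blast
  define L where "L = (\<integral>y. local_kernel y \<partial>lborel)"
  have L: "L \<ge> 0" unfolding L_def by (intro integral_nonneg_AE) (auto simp: local_kernel_def)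
  \<comment> \<open>The sum of the constants of both estimates. The 72 comes from |y - m| \<le> 6
    and |y - z| \<ge> |t| / 2, which bound the remainder by 36 / (|t|^2 |t| / 2); the ball of radius
    2 has area 4 \<open>unit_area\<close>.\<close>
  define K where "K = M + M * (L + 4 * unit_area) / bell_mass + M * 72 * 4 * unit_area / bell_mass"
  have K: "K > 0" unfolding K_def using M L unit_area_pos bell_mass_pos
    by (intro add_pos_nonneg) auto
  have K1: "M + M * (L + 4 * unit_area) / bell_mass \<le> K" and K2: "M * 72 * 4 * unit_area / bell_mass \<le> K"
    unfolding K_def using M L unit_area_pos bell_mass_pos by (auto intro!: add_nonneg_nonneg)
  have pre: "norm ((f y - f c) * dbar tent' (y - c)) \<le> \<omega> * M \<and> (y \<notin> ball c 2 \<longrightarrow> (f y - f c) * dbar tent' (y - c) = 0) \<and> \<omega> \<ge> 0"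
    if "\<And>y. y \<in> ball c 2 \<Longrightarrow> norm (f y - f c) \<le> \<omega>" for f :: "complex \<Rightarrow> complex" and c \<omega> y
  proof -
    have \<omega>: "\<omega> \<ge> 0" using that[of c] by simp
    have out: "y \<notin> ball c 2 \<longrightarrow> dbar tent' (y - c) = 0"
      by (auto simp: dist_norm norm_minus_commute dbar_tent_outside)
    have "norm ((f y - f c) * dbar tent' (y - c)) \<le> \<omega> * M"
    proof (cases "y \<in> ball c 2")
      case True then show ?thesis using that[of y] M \<omega> by (auto simp: norm_mult intro!: mult_mono)
    next
      case False then show ?thesis using out \<omega> M by simp
    qed
    then show ?thesis using out \<omega> by auto
  qed
  show ?thesis
  proof (rule that[OF K])
    fix f :: "complex \<Rightarrow> complex" and c \<omega> z
    assume f: "continuous_on UNIV f" and osc: "\<And>y. y \<in> ball c 2 \<Longrightarrow> norm (f y - f c) \<le> \<omega>"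
    note p = pre[where f = f and c = c and \<omega> = \<omega>, OF osc]
    have \<omega>: "\<omega> \<ge> 0" using p by blast
    have fc: "continuous_on UNIV (\<lambda>z. f z - f c)" by (intro continuous_intros f)
    have "norm (tent (z - c) * (f z - f c)) \<le> M * \<omega>"
    proof (cases "z \<in> ball c 2")
      case True then show ?thesis using osc[of z] M \<omega> by (auto simp: norm_mult intro!: mult_mono)
    next
      case False then show ?thesis using \<omega> M by (simp add: dist_norm norm_minus_commute tent_outside)
    qed
    moreover have "norm (CLBINT y. (f y - f c) * dbar tent' (y - c) / (y - z)) \<le> (\<omega> * M) * (L + 2\<^sup>2 * unit_area)"
      unfolding L_def using p by (intro Cauchy_kernel_integral(2)[where c = c] localise_measurable fc) auto
    then have "norm ((CLBINT y. (f y - f c) * dbar tent' (y - c) / (y - z)) / of_real bell_mass)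
        \<le> (\<omega> * M) * (L + 2\<^sup>2 * unit_area) / bell_mass"
      using bell_mass_pos by (simp add: norm_divide divide_right_mono)
    ultimately have "norm (localise c f z) \<le> M * \<omega> + (\<omega> * M) * (L + 2\<^sup>2 * unit_area) / bell_mass"
      unfolding localise_diff_const[OF f, of c z "f c"] unfolding localise_def by (rule norm_triangle_mono)
    also have "\<dots> = (M + M * (L + 4 * unit_area) / bell_mass) * \<omega>" by (simp add: algebra_simps add_divide_distrib)
    also have "\<dots> \<le> K * \<omega>" using K1 \<omega> by (rule mult_right_mono)
    finally show "norm (localise c f z) \<le> K * \<omega>" .
  next
    fix f :: "complex \<Rightarrow> complex" and c \<omega> m
    assume f: "continuous_on UNIV f" and osc: "\<And>y. y \<in> ball c 2 \<Longrightarrow> norm (f y - f c) \<le> \<omega>" and m: "norm (m - c) \<le> 4"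
    note p = pre[where f = f and c = c and \<omega> = \<omega>, OF osc]
    have \<omega>: "\<omega> \<ge> 0" using p by blast
    have fc: "continuous_on UNIV (\<lambda>z. f z - f c)" by (intro continuous_intros f)
    define \<mu> where "\<mu> y = (f y - f c) * dbar tent' (y - c)" for y
    have \<mu>c: "continuous_on UNIV \<mu>" unfolding \<mu>_def
      by (intro continuous_intros fc continuous_on_compose2[OF dbar_tent_continuous]) auto
    have \<mu>m [measurable]: "\<mu> \<in> borel_measurable borel" using \<mu>c by (rule borel_measurable_continuous_onI)
    have \<mu>0: "\<mu> y = 0" if "y \<notin> ball c 2" for y using p that by (simp add: \<mu>_def)
    have \<mu>le: "norm (\<mu> y) \<le> \<omega> * M" for y using p by (simp add: \<mu>_def)
    have near: "norm (y - m) \<le> 6" if "y \<in> ball c 2" for y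
      using that m norm_triangle_ineq4[of "y - c" "m - c"] by (simp add: dist_norm norm_minus_commute)
    have meas: "measure lborel (ball c 2) = 4 * unit_area"
      using emeasure_complex_ball[of 2 c] unit_area_pos by (simp add: measure_def)
    have ib: "integrable lborel (\<lambda>y. C * indicator (ball c 2) y :: real)" for C
      using emeasure_lborel_ball_finite[of c 2] by (intro integrable_mult_right integrable_real_indicator) auto
    have est: "integrable lborel (\<lambda>y. \<mu> y * g y) \<and> norm ((CLBINT y. \<mu> y * g y) / of_real bell_mass) \<le> \<omega> * M * C * 4 * unit_area / bell_mass"
      if [measurable]: "g \<in> borel_measurable borel" and g: "\<And>y. y \<in> ball c 2 \<Longrightarrow> norm (g y) \<le> C" for g C
    proof -
      have le: "norm (\<mu> y * g y) \<le> (\<omega> * M * C) * indicator (ball c 2) y" for y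
      proof (cases "y \<in> ball c 2")
        case True
        have "norm (\<mu> y * g y) \<le> (\<omega> * M) * C" unfolding norm_mult
          using \<mu>le[of y] g[OF True] \<omega> M by (intro mult_mono) auto
        then show ?thesis using True by simp
      qed (simp add: \<mu>0)
      have i: "integrable lborel (\<lambda>y. \<mu> y * g y)"
        by (rule Bochner_Integration.integrable_bound[OF ib]) (use order_trans[OF le abs_ge_self] in \<open>auto intro!: AE_I2\<close>)
      have "norm (CLBINT y. \<mu> y * g y) \<le> (\<integral>y. norm (\<mu> y * g y) \<partial>lborel)" by simp
      also have "\<dots> \<le> (\<integral>y. (\<omega> * M * C) * indicator (ball c 2) y \<partial>lborel)"
        by (rule integral_mono[OF integrable_norm[OF i] ib le])
      also have "\<dots> = \<omega> * M * C * 4 * unit_area" using meas by simp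
      finally show ?thesis using i bell_mass_pos by (simp add: norm_divide divide_right_mono)
    qed
    define \<alpha> where "\<alpha> = - ((CLBINT y. \<mu> y * 1) / of_real bell_mass)"
    define \<beta> where "\<beta> = - ((CLBINT y. \<mu> y * (y - m)) / of_real bell_mass)"
    have le_K: "\<omega> * M * C * 4 * unit_area / bell_mass \<le> K * \<omega>" if "0 \<le> C" "C \<le> 72" for C
    proof -
      have "\<omega> * M * C * 4 * unit_area / bell_mass \<le> \<omega> * M * 72 * 4 * unit_area / bell_mass"
        using that \<omega> M unit_area_pos bell_mass_pos by (intro divide_right_mono mult_right_mono mult_left_mono) auto
      also have "\<dots> = (M * 72 * 4 * unit_area / bell_mass) * \<omega>" by simp
      also have "\<dots> \<le> K * \<omega>" using K2 \<omega> by (rule mult_right_mono)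
      finally show ?thesis .
    qed
    have ea: "integrable lborel (\<lambda>y. \<mu> y * 1)" "norm \<alpha> \<le> K * \<omega>"
      using est[of "\<lambda>y. 1" 1] le_K[of 1] unfolding \<alpha>_def norm_minus_cancel by auto
    have eb: "integrable lborel (\<lambda>y. \<mu> y * (y - m))" "norm \<beta> \<le> K * \<omega>"
      using est[of "\<lambda>y. y - m" 6] near le_K[of 6] unfolding \<beta>_def norm_minus_cancel by auto
    have "norm (localise c f z - \<alpha> / (z - m) - \<beta> / (z - m)\<^sup>2) \<le> K * \<omega> / norm (z - m) ^ 3"
      if z: "norm (z - m) \<ge> 12" for z
    proof -
      define t where "t = z - m"
      have t: "norm t \<ge> 12" "t \<noteq> 0" using z by (auto simp: t_def)
      define g where "g y = (y - m)\<^sup>2 / (t\<^sup>2 * (y - z))" for y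
      have gm: "g \<in> borel_measurable borel" unfolding g_def by measurable
      have g: "norm (g y) \<le> 72 / norm t ^ 3" if y: "y \<in> ball c 2" for y
      proof -
        have "norm (y - z) \<ge> norm t / 2"
          using near[OF y] t norm_triangle_ineq4[of "y - m" "y - z"] by (simp add: t_def)
        moreover have "norm (y - m) ^ 2 \<le> 6\<^sup>2" using near[OF y] by (intro power_mono) auto
        ultimately have "norm (y - m) ^ 2 / (norm t ^ 2 * norm (y - z)) \<le> 36 / (norm t ^ 2 * (norm t / 2))"
          using t by (intro frac_le mult_mono) auto
        then show ?thesis by (simp add: g_def norm_divide norm_mult norm_power power2_eq_square power3_eq_cube)
      qed
      note eg = est[OF gm g]
      have far: "localise c f z = (CLBINT y. \<mu> y / (y - z)) / of_real bell_mass"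
      proof -
        have "norm (z - c) \<ge> 3/2" using z m norm_triangle_ineq4[of "z - c" "m - c"] by simp
        then show ?thesis unfolding localise_diff_const[OF f, of c z "f c"] unfolding localise_def \<mu>_def
          by (simp add: tent_outside)
      qed
      have "\<mu> y / (y - z) = \<mu> y * g y - (\<mu> y * 1) / t - (\<mu> y * (y - m)) / t\<^sup>2" for y
      proof (cases "y \<in> ball c 2")
        case True
        then have "y \<noteq> z" using near[OF True] z by auto
        then have 1: "y - z \<noteq> 0" by simp
        have "1 / (y - z) = g y - 1 / t - (y - m) / t\<^sup>2"
        proof -
          have e: "y - m = (y - z) + t" by (simp add: t_def)
          show ?thesis unfolding g_def e using 1 t(2) by (simp add: field_simps power2_eq_square)
        qed
        then have "\<mu> y * (1 / (y - z)) = \<mu> y * (g y - 1 / t - (y - m) / t\<^sup>2)" by simp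
        then show ?thesis by (simp add: algebra_simps)
      qed (simp add: \<mu>0)
      then have "(CLBINT y. \<mu> y / (y - z)) = (CLBINT y. \<mu> y * g y) - (CLBINT y. \<mu> y * 1) / t - (CLBINT y. \<mu> y * (y - m)) / t\<^sup>2"
        using ea(1) eb(1) eg by simp
      then have "localise c f z - \<alpha> / t - \<beta> / t\<^sup>2 = (CLBINT y. \<mu> y * g y) / of_real bell_mass"
        unfolding far \<alpha>_def \<beta>_def by (simp add: diff_divide_distrib mult.commute)
      then have "norm (localise c f z - \<alpha> / t - \<beta> / t\<^sup>2) \<le> \<omega> * M * (72 / norm t ^ 3) * 4 * unit_area / bell_mass"
        using eg by simp
      also have "\<dots> = (\<omega> * M * 72 * 4 * unit_area / bell_mass) / norm t ^ 3" by simp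
      also have "\<dots> \<le> K * \<omega> / norm t ^ 3" using le_K[of 72] by (intro divide_right_mono) auto
      finally show ?thesis by (simp add: t_def)
    qed
    then show "\<exists>\<alpha> \<beta>. norm \<alpha> \<le> K * \<omega> \<and> norm \<beta> \<le> K * \<omega> \<and> (\<forall>z. norm (z - m) \<ge> 12 \<longrightarrow>
          norm (localise c f z - \<alpha> / (z - m) - \<beta> / (z - m)\<^sup>2) \<le> K * \<omega> / norm (z - m) ^ 3)"
      using ea(2) eb(2) by blast
  qed
qed

section \<open>Mergelyan's theorem\<close>

lemma sum_hat': "(\<Sum>j=0..n. hat' (t - of_int (int j - m))) = ramp' (t + of_int m + 1) - ramp' (t + of_int m - real n)"
proof (induction n)
  case (Suc n)
  have "hat' (t - of_int (int (Suc n) - m)) = ramp' (t + of_int m - real n) - ramp' (t + of_int m - real (Suc n))"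
    by (simp add: hat'_def diff_diff_eq2) (simp add: algebra_simps)
  then show ?case using Suc by simp
qed (simp add: hat'_def algebra_simps)

text \<open>The shift by \<open>m\<close> lets pairs of naturals in \<open>lattice_ix m\<close>
  enumerate the Gaussian integers of the square of half-side \<open>m\<close>.\<close>

definition lattice_pt :: "nat \<Rightarrow> nat \<times> nat \<Rightarrow> complex" where
  "lattice_pt m = (\<lambda>(j, k). Complex (of_int (int j - int m)) (of_int (int k - int m)))"

abbreviation lattice_ix :: "nat \<Rightarrow> (nat \<times> nat) set" where
  "lattice_ix m \<equiv> {0..2 * m} \<times> {0..2 * m}"

lemma sum_hat_1:
  assumes "\<bar>t\<bar> \<le> real m"
  shows "(\<Sum>j=0..2*m. hat (t - of_int (int j - int m))) = 1" "(\<Sum>j=0..2*m. hat' (t - of_int (int j - int m))) = 0"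
  using assms unfolding sum_hat sum_hat' by (simp_all add: ramp_simps abs_le_iff)

lemma Re_Im_lattice_pt:
  "Re (z - lattice_pt m (j, k)) = Re z - of_int (int j - int m)"
  "Im (z - lattice_pt m (j, k)) = Im z - of_int (int k - int m)"
  by (simp_all add: lattice_pt_def)

lemma tent_partition:
  assumes "norm z \<le> real m"
  shows "(\<Sum>i\<in>lattice_ix m. tent (z - lattice_pt m i)) = 1" "(\<Sum>i\<in>lattice_ix m. dbar tent' (z - lattice_pt m i)) = 0"
proof -
  define X where "X j = hat (Re z - of_int (int j - int m))" for j
  define Y where "Y j = hat (Im z - of_int (int j - int m))" for j
  define X' where "X' j = hat' (Re z - of_int (int j - int m))" for j
  define Y' where "Y' j = hat' (Im z - of_int (int j - int m))" for j
  have *: "\<bar>Re z\<bar> \<le> real m" "\<bar>Im z\<bar> \<le> real m" using assms abs_Re_le_cmod[of z] abs_Im_le_cmod[of z] by linarith+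
  have s: "(\<Sum>j=0..2*m. X j) = 1" "(\<Sum>j=0..2*m. Y j) = 1" "(\<Sum>j=0..2*m. X' j) = 0" "(\<Sum>j=0..2*m. Y' j) = 0"
    using sum_hat_1[OF *(1)] sum_hat_1[OF *(2)] by (simp_all add: X_def Y_def X'_def Y'_def)
  have t: "tent (z - lattice_pt m (j, k)) = of_real (X j * Y k)" for j k
    unfolding tent_def Re_Im_lattice_pt X_def Y_def ..
  have d: "dbar tent' (z - lattice_pt m (j, k)) = (of_real (X' j * Y k) + \<i> * of_real (X j * Y' k)) / 2" for j k
    unfolding dbar_def tent'_def Re_Im_lattice_pt X_def Y_def X'_def Y'_def by simp
  have cart: "(\<Sum>i\<in>lattice_ix m. h i) = (\<Sum>j=0..2*m. \<Sum>k=0..2*m. h (j, k))" for h :: "nat \<times> nat \<Rightarrow> complex"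
    by (simp add: sum.cartesian_product case_prod_unfold)
  have "(\<Sum>i\<in>lattice_ix m. tent (z - lattice_pt m i)) = (\<Sum>j=0..2*m. \<Sum>k=0..2*m. of_real (X j * Y k))"
    by (simp only: cart t)
  also have "\<dots> = of_real ((\<Sum>j=0..2*m. X j) * (\<Sum>k=0..2*m. Y k))"
    by (simp add: sum_product)
  finally show "(\<Sum>i\<in>lattice_ix m. tent (z - lattice_pt m i)) = 1" by (simp add: s)
  have "(\<Sum>i\<in>lattice_ix m. dbar tent' (z - lattice_pt m i))
      = (\<Sum>j=0..2*m. \<Sum>k=0..2*m. (of_real (X' j * Y k) + \<i> * of_real (X j * Y' k)) / 2)"
    by (simp only: cart d)
  also have "\<dots> = (of_real ((\<Sum>j=0..2*m. X' j) * (\<Sum>k=0..2*m. Y k)) + \<i> * of_real ((\<Sum>j=0..2*m. X j) * (\<Sum>k=0..2*m. Y' k))) / 2"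
  proof -
    have "of_real ((\<Sum>j=0..2*m. X' j) * (\<Sum>k=0..2*m. Y k)) = (\<Sum>j=0..2*m. \<Sum>k=0..2*m. complex_of_real (X' j * Y k))"
      "of_real ((\<Sum>j=0..2*m. X j) * (\<Sum>k=0..2*m. Y' k)) = (\<Sum>j=0..2*m. \<Sum>k=0..2*m. complex_of_real (X j * Y' k))"
      by (simp_all add: sum_product)
    then show ?thesis
      by (simp only: sum_divide_distrib[symmetric] sum.distrib sum_distrib_left)
  qed
  finally show "(\<Sum>i\<in>lattice_ix m. dbar tent' (z - lattice_pt m i)) = 0" by (simp add: s)
qed

text \<open>The cut-offs add up to 1, which returns \<open>f\<close>. Their \<open>dbar\<close>s add
  up to 0 wherever \<open>f\<close> is nonzero, so the integrals cancel.\<close>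

lemma sum_localise:
  assumes f: "continuous_on UNIV f" and supp: "\<And>z. norm z \<ge> real m \<Longrightarrow> f z = 0" and z: "norm z \<le> real m"
  shows "(\<Sum>i\<in>lattice_ix m. localise (lattice_pt m i) f z) = f z"
proof -
  have "(\<Sum>i\<in>lattice_ix m. \<integral>y. f y * dbar tent' (y - lattice_pt m i) / (y - z) \<partial>lborel)
      = (CLBINT y. (\<Sum>i\<in>lattice_ix m. f y * dbar tent' (y - lattice_pt m i) / (y - z)))"
    by (rule Bochner_Integration.integral_sum[symmetric]) (rule localise_integrable[OF f])
  also have "\<dots> = integral\<^sup>L (lborel :: complex measure) (\<lambda>y. 0)"
  proof (rule Bochner_Integration.integral_cong[OF refl])
    fix y :: complex
    have "(\<Sum>i\<in>lattice_ix m. f y * dbar tent' (y - lattice_pt m i) / (y - z))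
        = f y * (\<Sum>i\<in>lattice_ix m. dbar tent' (y - lattice_pt m i)) / (y - z)"
      by (simp add: sum_distrib_left sum_divide_distrib)
    also have "\<dots> = 0" using tent_partition(2)[of y m] supp[of y] by (cases "norm y \<le> real m") auto
    finally show "(\<Sum>i\<in>lattice_ix m. f y * dbar tent' (y - lattice_pt m i) / (y - z)) = 0" .
  qed
  finally have "(\<Sum>i\<in>lattice_ix m. \<integral>y. f y * dbar tent' (y - lattice_pt m i) / (y - z) \<partial>lborel) = 0" by simp
  then have "(\<Sum>i\<in>lattice_ix m. localise (lattice_pt m i) f z) = (\<Sum>i\<in>lattice_ix m. tent (z - lattice_pt m i)) * f z"
    by (simp add: localise_def sum.distrib flip: sum_divide_distrib sum_distrib_right)
  then show ?thesis using tent_partition(1)[OF z] by simp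
qed

text \<open>The inverse cube of a planar distance is split evenly between the two coordinates; 3/2 >
  1 makes each factor summable. The maximum repairs i = 0, where \<open>powr\<close> would give 0
  instead of 1.\<close>

definition tail_weight :: "nat \<Rightarrow> real" where "tail_weight i = max 1 (real i) powr (-3/2)"

lemma summable_tail_weight: "summable tail_weight"
proof -
  have "summable (\<lambda>i. real i powr (-3/2))" by (simp add: summable_real_powr_iff)
  moreover have "eventually (\<lambda>i. real i powr (-3/2) = tail_weight i) sequentially"
    using eventually_ge_at_top[of 1] by eventually_elim (simp add: tail_weight_def max_absorb2)
  ultimately show ?thesis using summable_cong[of "\<lambda>i. real i powr (-3/2)" tail_weight] by blast
qed

text \<open>With \<open>q\<close> the floor of \<open>s\<close>, each value of |q - j| occurs at
  most once for j \<le> q and at most once for j > q; hence the factor 2 and a bound free of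
  \<open>s\<close> and \<open>n\<close>.\<close>

lemma line_lattice_sum: "(\<Sum>j=0..n. (1 + \<bar>s - real j\<bar>) powr (-3/2)) \<le> 2 * suminf tail_weight"
proof -
  define q where "q = \<lfloor>s\<rfloor>"
  have le: "(1 + \<bar>s - real j\<bar>) powr (-3/2) \<le> tail_weight (nat \<bar>q - int j\<bar>)" for j
  proof -
    have "real_of_int \<bar>q - int j\<bar> \<le> 1 + \<bar>s - real j\<bar>" unfolding q_def by linarith
    then have "max 1 (real (nat \<bar>q - int j\<bar>)) \<le> 1 + \<bar>s - real j\<bar>" by simp
    then show ?thesis unfolding tail_weight_def by (intro powr_mono2') auto
  qed
  have part: "(\<Sum>j\<in>J. tail_weight (nat \<bar>q - int j\<bar>)) \<le> suminf tail_weight"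
    if "finite J" "inj_on (\<lambda>j. nat \<bar>q - int j\<bar>) J" for J
  proof -
    have "(\<Sum>j\<in>J. tail_weight (nat \<bar>q - int j\<bar>)) = sum tail_weight ((\<lambda>j. nat \<bar>q - int j\<bar>) ` J)"
      using sum.reindex[OF that(2), of tail_weight] by (simp add: o_def)
    also have "\<dots> \<le> suminf tail_weight"
      using that by (intro sum_le_suminf summable_tail_weight) (auto simp: tail_weight_def)
    finally show ?thesis .
  qed
  have "(\<Sum>j=0..n. (1 + \<bar>s - real j\<bar>) powr (-3/2)) \<le> (\<Sum>j=0..n. tail_weight (nat \<bar>q - int j\<bar>))"
    by (rule sum_mono) (rule le)
  also have "\<dots> = (\<Sum>j\<in>{j\<in>{0..n}. int j \<le> q}. tail_weight (nat \<bar>q - int j\<bar>)) + (\<Sum>j\<in>{j\<in>{0..n}. \<not> int j \<le> q}. tail_weight (nat \<bar>q - int j\<bar>))"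
    by (subst sum.union_disjoint[symmetric]) (auto intro!: sum.cong)
  also have "\<dots> \<le> suminf tail_weight + suminf tail_weight"
    by (intro add_mono part) (auto simp: inj_on_def)
  finally show ?thesis by simp
qed

text \<open>As (1 + |w|)^2 dominates (1 + |Re w|) (1 + |Im w|), the sum is at most a product of two
  line sums. A single \<open>S\<close> serves all \<open>m\<close> and \<open>z\<close>.\<close>

lemma lattice_sum:
  obtains S where "S > 0" "\<And>m z. (\<Sum>i\<in>lattice_ix m. 1 / (1 + norm (z - lattice_pt m i)) ^ 3) \<le> S"
proof
  define T where "T = 2 * suminf tail_weight"
  have T: "T \<ge> 0" using suminf_nonneg[OF summable_tail_weight] by (simp add: T_def tail_weight_def)
  show "T * T + 1 > 0" using T by (simp add: add_nonneg_pos)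
  fix m :: nat and z :: complex
  define p where "p t = (1 + \<bar>t\<bar>) powr (-3/2)" for t :: real
  have le: "1 / (1 + norm w) ^ 3 \<le> p (Re w) * p (Im w)" for w
  proof -
    have "(1 + \<bar>Re w\<bar>) * (1 + \<bar>Im w\<bar>) \<le> (1 + norm w) * (1 + norm w)"
      using abs_Re_le_cmod[of w] abs_Im_le_cmod[of w] by (intro mult_mono) auto
    then have "((1 + norm w) * (1 + norm w)) powr (-3/2) \<le> ((1 + \<bar>Re w\<bar>) * (1 + \<bar>Im w\<bar>)) powr (-3/2)"
      by (intro powr_mono2') auto
    also have "\<dots> = p (Re w) * p (Im w)" unfolding p_def by (rule powr_mult)
    also have "((1 + norm w) * (1 + norm w)) powr (-3/2) = (1 + norm w) powr (- 3)"
      by (subst powr_mult) (auto simp flip: powr_add)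
    also have "\<dots> = 1 / (1 + norm w) ^ 3"
      by (simp add: powr_minus_divide powr_numeral add_pos_nonneg)
    finally show ?thesis .
  qed
  have lines: "(\<Sum>j=0..2*m. p (t - of_int (int j - int m))) \<le> T" for t
    using line_lattice_sum[where n = "2*m" and s = "t + real m"] unfolding p_def T_def by (simp add: algebra_simps)
  have "(\<Sum>i\<in>lattice_ix m. 1 / (1 + norm (z - lattice_pt m i)) ^ 3)
      \<le> (\<Sum>i\<in>lattice_ix m. p (Re (z - lattice_pt m i)) * p (Im (z - lattice_pt m i)))"
    by (intro sum_mono le)
  also have "\<dots> = (\<Sum>(j, k)\<in>lattice_ix m. p (Re z - of_int (int j - int m)) * p (Im z - of_int (int k - int m)))"
    by (rule sum.cong) (auto simp: lattice_pt_def)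
  also have "\<dots> = (\<Sum>j=0..2*m. p (Re z - of_int (int j - int m))) * (\<Sum>k=0..2*m. p (Im z - of_int (int k - int m)))"
    by (simp add: sum_product sum.cartesian_product)
  also have "\<dots> \<le> T * T"
    by (intro mult_mono lines T sum_nonneg) (auto simp: p_def)
  finally show "(\<Sum>i\<in>lattice_ix m. 1 / (1 + norm (z - lattice_pt m i)) ^ 3) \<le> T * T + 1" by simp
qed

text \<open>\<open>C\<close> depends on none of \<open>X\<close>, \<open>f\<close>, \<open>m\<close>
  and \<omega>. This is what makes rescaling effective: magnifying the plane keeps \<open>C\<close>
  and makes the oscillation over distance 2 small.\<close>

lemma approximate_at_unit_scale:
  obtains C where "C > 0"
    "\<And>X f \<omega> m. compact X \<Longrightarrow> connected (- X) \<Longrightarrow> continuous_on UNIV f \<Longrightarrow> f holomorphic_on interior X \<Longrightarrow>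
       X \<subseteq> cball 0 (real m) \<Longrightarrow> (\<And>z. norm z \<ge> real m \<Longrightarrow> f z = 0) \<Longrightarrow>
       (\<And>z w. dist z w \<le> 2 \<Longrightarrow> norm (f z - f w) \<le> \<omega>) \<Longrightarrow>
       \<exists>g. poly_limit X g \<and> (\<forall>z\<in>X. norm (f z - g z) \<le> C * \<omega>)"
proof -
  obtain K where K: "K > 0"
    and K1: "\<And>f c \<omega> z. continuous_on UNIV f \<Longrightarrow> (\<And>y. y \<in> ball c 2 \<Longrightarrow> norm (f y - f c) \<le> \<omega>) \<Longrightarrow> norm (localise c f z) \<le> K * \<omega>"
    and K2: "\<And>f c \<omega> m. continuous_on UNIV f \<Longrightarrow> (\<And>y. y \<in> ball c 2 \<Longrightarrow> norm (f y - f c) \<le> \<omega>) \<Longrightarrow> norm (m - c) \<le> 4 \<Longrightarrow>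
       \<exists>\<alpha> \<beta>. norm \<alpha> \<le> K * \<omega> \<and> norm \<beta> \<le> K * \<omega> \<and> (\<forall>z. norm (z - m) \<ge> 12 \<longrightarrow>
          norm (localise c f z - \<alpha> / (z - m) - \<beta> / (z - m)\<^sup>2) \<le> K * \<omega> / norm (z - m) ^ 3)"
    using localise_bounds by blast
  obtain S where S: "S > 0" "\<And>m z. (\<Sum>i\<in>lattice_ix m. 1 / (1 + norm (z - lattice_pt m i)) ^ 3) \<le> S"
    using lattice_sum by blast
  \<comment> \<open>40001 is 40000 for the approximant plus 1 for \<open>localise\<close> itself. In
    \<open>C1\<close>, 4913 is 17^3: if |z - b| < 12 then 1 + |z - c| is at most 17, and the trivial
    bound A * \<omega> already has the cubic form.\<close>
  define A where "A = 40001 * K"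
  define C1 where "C1 = A * 4913"
  have A: "A > 0" "C1 > 0" using K by (auto simp: A_def C1_def)
  show ?thesis
  proof (rule that[of "C1 * S"])
    show "C1 * S > 0" using A S by simp
    fix X f \<omega> and m :: nat
    assume X: "compact X" "connected (- X)" and f: "continuous_on UNIV f" "f holomorphic_on interior X"
      and Xm: "X \<subseteq> cball 0 (real m)" and supp: "\<And>z. norm z \<ge> real m \<Longrightarrow> f z = 0"
      and osc: "\<And>z w. dist z w \<le> 2 \<Longrightarrow> norm (f z - f w) \<le> \<omega>"
    have \<omega>: "\<omega> \<ge> 0" using osc[of 0 0] by simp
    have local: "\<exists>g. poly_limit X g \<and> (\<forall>z\<in>X. norm (localise c f z - g z) \<le> C1 * \<omega> * (1 / (1 + norm (z - c)) ^ 3))" for c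
    proof (cases "cball c 2 \<subseteq> interior X")
      case True
      then have "localise c f z = 0" for z using localise_eq_0[OF f(2)] by simp
      then show ?thesis using A \<omega> by (intro exI[of _ "\<lambda>z. 0"]) auto
    next
      case False
      then obtain x where x: "x \<in> cball c 2" "x \<notin> interior X" by blast
      \<comment> \<open>A point of \<open>- X\<close> lies within 1 of \<open>x\<close>, hence
        within 3 of \<open>c\<close>; the centre \<open>b\<close> of its local approximants is then
        within 4 of \<open>c\<close>, as \<open>K2\<close> requires.\<close>
      then have "\<not> ball x 1 \<subseteq> X" by (meson centre_in_ball interior_maximal open_ball subsetD zero_less_one)
      then obtain p where p: "p \<in> ball x 1" "p \<notin> X" by blast
      have pc: "norm (p - c) \<le> 3"
        using p x dist_triangle[of p c x] by (simp add: dist_norm norm_minus_commute)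
      obtain b where b: "norm (b - p) \<le> 1" and appr:
        "\<And>\<alpha> \<beta> \<omega>. norm \<alpha> \<le> \<omega> \<Longrightarrow> norm \<beta> \<le> \<omega> \<Longrightarrow> \<exists>g. poly_limit X g \<and> (\<forall>z\<in>X. norm (g z) \<le> 40000 * \<omega> \<and>
           (norm (z - b) \<ge> 12 \<longrightarrow> norm (g z - \<alpha> / (z - b) - \<beta> / (z - b)\<^sup>2) \<le> 40000 * \<omega> / norm (z - b) ^ 3))"
        using exists_local_approximant[OF X p(2)] by metis
      have bc: "norm (b - c) \<le> 4" using b pc norm_triangle_ineq[of "b - p" "p - c"] by simp
      have oc: "norm (f y - f c) \<le> \<omega>" if "y \<in> ball c 2" for y using osc that by (simp add: dist_commute)
      obtain \<alpha> \<beta> where ab: "norm \<alpha> \<le> K * \<omega>" "norm \<beta> \<le> K * \<omega>"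
        and loc: "\<And>z. norm (z - b) \<ge> 12 \<Longrightarrow> norm (localise c f z - \<alpha> / (z - b) - \<beta> / (z - b)\<^sup>2) \<le> K * \<omega> / norm (z - b) ^ 3"
        using K2[OF f(1) oc bc] by blast
      obtain g where g: "poly_limit X g" and g1: "\<And>z. z \<in> X \<Longrightarrow> norm (g z) \<le> 40000 * (K * \<omega>)"
        and g2: "\<And>z. z \<in> X \<Longrightarrow> norm (z - b) \<ge> 12 \<Longrightarrow> norm (g z - \<alpha> / (z - b) - \<beta> / (z - b)\<^sup>2) \<le> 40000 * (K * \<omega>) / norm (z - b) ^ 3"
        using appr[OF ab] by blast
      have "norm (localise c f z - g z) \<le> C1 * \<omega> * (1 / (1 + norm (z - c)) ^ 3)" if z: "z \<in> X" for z
      proof (cases "norm (z - b) \<ge> 12")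
        case True
        define s where "s = norm (z - b)"
        have s: "s \<ge> 12" using True by (simp add: s_def)
        have sc: "1 + norm (z - c) \<le> 2 * s"
          using bc s norm_triangle_ineq[of "z - b" "b - c"] by (simp add: s_def)
        have "norm (localise c f z - g z) \<le> K * \<omega> / s ^ 3 + 40000 * (K * \<omega>) / s ^ 3"
          using norm_triangle_ineq4[of "localise c f z - \<alpha> / (z - b) - \<beta> / (z - b)\<^sup>2" "g z - \<alpha> / (z - b) - \<beta> / (z - b)\<^sup>2"]
            loc[OF True] g2[OF z True] unfolding s_def by simp
        also have "\<dots> = A * \<omega> * (1 / s ^ 3)" by (simp add: A_def add_divide_distrib[symmetric])
        also have "\<dots> \<le> A * \<omega> * (8 * (1 / (1 + norm (z - c)) ^ 3))"
        proof (rule mult_left_mono)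
          have "(1 + norm (z - c)) ^ 3 \<le> (2 * s) ^ 3" using sc by (rule power_mono) simp
          then have "1 / (2 * s) ^ 3 \<le> 1 / (1 + norm (z - c)) ^ 3"
            using s by (intro divide_left_mono mult_pos_pos zero_less_power add_pos_nonneg) auto
          then show "1 / s ^ 3 \<le> 8 * (1 / (1 + norm (z - c)) ^ 3)" by (simp add: power_mult_distrib)
        qed (use A \<omega> in auto)
        also have "\<dots> = (A * 8) * \<omega> * (1 / (1 + norm (z - c)) ^ 3)" by simp
        also have "\<dots> \<le> C1 * \<omega> * (1 / (1 + norm (z - c)) ^ 3)"
          unfolding C1_def using A \<omega> by (intro mult_right_mono mult_left_mono) auto
        finally show ?thesis .
      next
        case False
        then have zc: "1 + norm (z - c) \<le> 17" using bc norm_triangle_ineq[of "z - b" "b - c"] by simp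
        have "norm (localise c f z - g z) \<le> norm (localise c f z) + norm (g z)" by (rule norm_triangle_ineq4)
        also have "\<dots> \<le> K * \<omega> + 40000 * (K * \<omega>)" using K1[OF f(1) oc] g1[OF z] by (rule add_mono)
        also have "\<dots> = A * \<omega> * 1" by (simp add: A_def)
        also have "\<dots> \<le> A * \<omega> * (4913 * (1 / (1 + norm (z - c)) ^ 3))"
        proof (rule mult_left_mono)
          have "(1 + norm (z - c)) ^ 3 \<le> 17 ^ 3" using zc by (rule power_mono) simp
          moreover have "(1 + norm (z - c)) ^ 3 > 0" by (simp add: add_pos_nonneg)
          ultimately show "1 \<le> 4913 * (1 / (1 + norm (z - c)) ^ 3)" by simp
        qed (use A \<omega> in auto)
        also have "\<dots> = C1 * \<omega> * (1 / (1 + norm (z - c)) ^ 3)" by (simp add: C1_def)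
        finally show ?thesis .
      qed
      then show ?thesis using g by blast
    qed
    then obtain g where g: "\<And>c. poly_limit X (g c)"
      "\<And>c z. z \<in> X \<Longrightarrow> norm (localise c f z - g c z) \<le> C1 * \<omega> * (1 / (1 + norm (z - c)) ^ 3)"
      by metis
    define G where "G z = (\<Sum>i\<in>lattice_ix m. g (lattice_pt m i) z)" for z
    have "poly_limit X G" unfolding G_def by (intro poly_limit_sum g)
    moreover have "norm (f z - G z) \<le> C1 * S * \<omega>" if z: "z \<in> X" for z
    proof -
      have "f z = (\<Sum>i\<in>lattice_ix m. localise (lattice_pt m i) f z)"
        using sum_localise[OF f(1) supp] Xm z by auto
      then have "f z - G z = (\<Sum>i\<in>lattice_ix m. localise (lattice_pt m i) f z - g (lattice_pt m i) z)"
        by (simp add: G_def sum_subtractf)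
      also have "norm \<dots> \<le> (\<Sum>i\<in>lattice_ix m. C1 * \<omega> * (1 / (1 + norm (z - lattice_pt m i)) ^ 3))"
        by (intro sum_norm_le g z)
      also have "\<dots> = C1 * \<omega> * (\<Sum>i\<in>lattice_ix m. 1 / (1 + norm (z - lattice_pt m i)) ^ 3)"
        by (rule sum_distrib_left[symmetric])
      also have "\<dots> \<le> C1 * \<omega> * S" using A \<omega> by (intro mult_left_mono S) auto
      finally show ?thesis by (simp add: mult_ac)
    qed
    ultimately show "\<exists>g. poly_limit X g \<and> (\<forall>z\<in>X. norm (f z - g z) \<le> C1 * S * \<omega>)" by blast
  qed
qed

section \<open>Extension to the plane and rescaling\<close>

lemma extend_continuous_compact_support:
  fixes f :: "complex \<Rightarrow> complex"
  assumes X: "compact X" and f: "continuous_on X f"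
  obtains F R where "continuous_on UNIV F" "R > 0" "X \<subseteq> cball 0 R" "\<And>z. z \<in> X \<Longrightarrow> F z = f z"
    "\<And>z. norm z \<ge> R \<Longrightarrow> F z = 0"
proof -
  obtain R where R: "R > 0" "\<And>z. z \<in> X \<Longrightarrow> norm z \<le> R"
    using compact_imp_bounded[OF X] bounded_pos by metis
  obtain B where B: "B > 0" "\<And>z. z \<in> X \<Longrightarrow> norm (f z) \<le> B"
    using compact_imp_bounded[OF compact_continuous_image[OF f X]] unfolding bounded_pos by (metis imageI)
  obtain g where g: "continuous_on UNIV g" "\<And>z. z \<in> X \<Longrightarrow> g z = f z"
    by (rule Tietze[OF f, of UNIV B]) (use B compact_imp_closed[OF X] in auto)
  define F where "F z = of_real (max 0 (min 1 (R + 1 - norm z))) * g z" for z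
  show ?thesis
  proof (rule that[of F "R + 1"])
    show "continuous_on UNIV F" unfolding F_def by (intro continuous_intros g)
    show "F z = f z" if "z \<in> X" for z using R(2)[OF that] g(2)[OF that] by (simp add: F_def)
    show "X \<subseteq> cball 0 (R + 1)" using R(2) by (force)
  qed (use R in \<open>auto simp: F_def\<close>)
qed

lemma compact_support_uniform:
  fixes F :: "complex \<Rightarrow> complex"
  assumes F: "continuous_on UNIV F" and supp: "\<And>z. norm z \<ge> R \<Longrightarrow> F z = 0" and "e > 0"
  obtains d where "d > 0" "\<And>z w :: complex. dist z w \<le> d \<Longrightarrow> norm (F z - F w) \<le> e"
proof -
  have "uniformly_continuous_on (cball 0 (R + 1)) F"
    by (rule compact_uniformly_continuous) (auto intro: continuous_on_subset[OF F])
  then obtain d where d: "d > 0" "\<And>z w. z \<in> cball 0 (R + 1) \<Longrightarrow> w \<in> cball 0 (R + 1) \<Longrightarrow> dist w z < d \<Longrightarrow> dist (F w) (F z) < e"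
    unfolding uniformly_continuous_on_def using \<open>e > 0\<close> by metis
  \<comment> \<open>The distance is kept at most 1 so that, if one of the points leaves the ball of
    radius R + 1, both lie where \<open>F\<close> is 0.\<close>
  show ?thesis
  proof (rule that[of "min 1 (d/2)"])
    fix z w :: complex assume zw: "dist z w \<le> min 1 (d/2)"
    show "norm (F z - F w) \<le> e"
    proof (cases "norm z \<le> R + 1 \<and> norm w \<le> R + 1")
      case True then show ?thesis using d(2)[of w z] d(1) zw by (auto simp: dist_norm)
    next
      case False
      then have "norm z \<ge> R \<and> norm w \<ge> R"
        using zw norm_triangle_ineq2[of z w] norm_triangle_ineq2[of w z] by (auto simp: dist_norm norm_minus_commute)
      then show ?thesis using supp \<open>e > 0\<close> by simp
    qed
  qed (use d in auto)
qed

theorem Mergelyan: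
  assumes X: "compact X" "connected (- X)" and f: "continuous_on X f" "f holomorphic_on interior X"
  shows "poly_limit X f"
proof -
  obtain C where C: "C > 0"
    "\<And>X f \<omega> m. compact X \<Longrightarrow> connected (- X) \<Longrightarrow> continuous_on UNIV f \<Longrightarrow> f holomorphic_on interior X \<Longrightarrow>
       X \<subseteq> cball 0 (real m) \<Longrightarrow> (\<And>z. norm z \<ge> real m \<Longrightarrow> f z = 0) \<Longrightarrow>
       (\<And>z w. dist z w \<le> 2 \<Longrightarrow> norm (f z - f w) \<le> \<omega>) \<Longrightarrow>
       \<exists>g. poly_limit X g \<and> (\<forall>z\<in>X. norm (f z - g z) \<le> C * \<omega>)"
    using approximate_at_unit_scale by blast
  obtain F R where F: "continuous_on UNIV F" "R > 0" "X \<subseteq> cball 0 R" "\<And>z. z \<in> X \<Longrightarrow> F z = f z"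
    "\<And>z. norm z \<ge> R \<Longrightarrow> F z = 0"
    using extend_continuous_compact_support[OF X(1) f(1)] by metis
  have Fh: "F holomorphic_on interior X"
    using f(2) F(4) interior_subset by (metis holomorphic_transform subsetD)
  show ?thesis
  proof (rule poly_limit_closed)
    fix e :: real assume "e > 0"
    define \<omega> where "\<omega> = e / (2 * C)"
    have \<omega>: "\<omega> > 0" "C * \<omega> < e" using \<open>e > 0\<close> C(1) by (auto simp: \<omega>_def)
    obtain d where d: "d > 0" "\<And>z w. dist z w \<le> d \<Longrightarrow> norm (F z - F w) \<le> \<omega>"
      using compact_support_uniform[OF F(1,5) \<omega>(1)] by metis
    \<comment> \<open>After magnification by 1 / s, distance 2 corresponds to the old distance d,
      over which \<open>F\<close> oscillates by at most \<omega>.\<close>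
    define s where "s = d / 2"
    have s: "s > 0" using d by (simp add: s_def)
    define T :: "complex \<Rightarrow> complex" where "T = (*\<^sub>R) s"
    define X1 where "X1 = {z. T z \<in> X}"
    have inv: "inverse s *\<^sub>R T z = z" "T (inverse s *\<^sub>R z) = z" for z using s by (simp_all add: T_def)
    have pre: "{z. T z \<in> Y} = (*\<^sub>R) (inverse s) ` Y" for Y
    proof (intro set_eqI iffI)
      fix z assume "z \<in> {z. T z \<in> Y}"
      then show "z \<in> (*\<^sub>R) (inverse s) ` Y" using inv(1)[of z] by (metis image_eqI mem_Collect_eq)
    qed (use inv(2) in auto)
    have "- X1 = {z. T z \<in> - X}" by (auto simp: X1_def)
    then have X1: "X1 = (*\<^sub>R) (inverse s) ` X" "- X1 = (*\<^sub>R) (inverse s) ` (- X)"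
      unfolding X1_def pre by simp_all
    have c1: "compact X1" unfolding X1(1) by (rule compact_scaling[OF X(1)])
    have c2: "connected (- X1)" unfolding X1(2) by (intro connected_continuous_image X continuous_intros)
    have Tc: "continuous_on UNIV T" unfolding T_def by (intro continuous_intros)
    have TX: "T ` interior X1 \<subseteq> interior X"
    proof (rule interior_maximal)
      show "T ` interior X1 \<subseteq> X" using interior_subset[of X1] by (auto simp: X1_def)
      show "open (T ` interior X1)" unfolding T_def using s by (intro open_scaling) auto
    qed
    have Th: "T holomorphic_on interior X1"
    proof -
      have "T = (\<lambda>z. of_real s * z)" by (simp add: T_def fun_eq_iff scaleR_conv_of_real)
      then show ?thesis by (auto intro!: holomorphic_intros)
    qed
    have Fh1: "(F \<circ> T) holomorphic_on interior X1"
      by (rule holomorphic_on_compose_gen[OF Th Fh TX])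
    obtain m where m: "R / s \<le> real m" using real_arch_simple by blast
    have nT: "norm (T z) = s * norm z" for z using s by (simp add: T_def)
    have "X1 \<subseteq> cball 0 (real m)"
    proof
      fix z assume "z \<in> X1"
      then have "s * norm z \<le> R" using F(3) nT[of z] by (auto simp: X1_def subset_iff)
      then have "norm z \<le> R / s" using s by (simp add: field_simps)
      then show "z \<in> cball 0 (real m)" using m by simp
    qed
    moreover have "(F \<circ> T) z = 0" if "norm z \<ge> real m" for z
    proof -
      have "R / s \<le> norm z" using m that by linarith
      then have "R \<le> s * norm z" using s by (simp add: field_simps)
      then show ?thesis using F(5) nT[of z] by simp
    qed
    moreover have "norm ((F \<circ> T) z - (F \<circ> T) w) \<le> \<omega>" if "dist z w \<le> 2" for z w
    proof -
      have "dist (T z) (T w) = s * dist z w"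
        using s by (simp add: T_def dist_norm flip: scaleR_diff_right)
      also have "\<dots> \<le> s * 2" using s that by (intro mult_left_mono) auto
      finally show ?thesis using d(2) by (simp add: s_def)
    qed
    moreover have "continuous_on UNIV (F \<circ> T)"
      by (rule continuous_on_compose[OF Tc continuous_on_subset[OF F(1)]]) simp
    ultimately obtain g where g: "poly_limit X1 g" "\<forall>z\<in>X1. norm ((F \<circ> T) z - g z) \<le> C * \<omega>"
      using C(2)[OF c1 c2 _ Fh1] by blast
    define h where "h z = g (inverse s *\<^sub>R z)" for z
    have in1: "inverse s *\<^sub>R z \<in> X1" "T (inverse s *\<^sub>R z) = z" if "z \<in> X" for z
      using that s by (auto simp: X1_def T_def)
    have "poly_limit X h" unfolding poly_limit_def
    proof (intro allI impI)
      fix e :: real assume "e > 0"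
      then obtain p where p: "\<forall>z\<in>X1. norm (g z - poly p z) < e" using g(1) unfolding poly_limit_def by blast
      have "norm (h z - poly (pcompose p [:0, of_real (inverse s):]) z) < e" if "z \<in> X" for z
        using p in1(1)[OF that] by (simp add: h_def poly_pcompose scaleR_conv_of_real mult.commute)
      then show "\<exists>p. \<forall>z\<in>X. norm (h z - poly p z) < e" by blast
    qed
    moreover have "norm (f z - h z) < e" if "z \<in> X" for z
      using g(2) in1[OF that] F(4)[OF that] \<omega>(2) by (force simp: h_def)
    ultimately show "\<exists>g. poly_limit X g \<and> (\<forall>z\<in>X. norm (f z - g z) < e)" by blast
  qed
qed

section \<open>Integration along rectifiable paths\<close>

abbreviation riemann_sum :: "plane_path \<Rightarrow> (complex \<Rightarrow> complex) \<Rightarrow> (real \<times> real set) set \<Rightarrow> complex" where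
  "riemann_sum \<gamma> g p \<equiv> (\<Sum>(t, k)\<in>p. g (fn \<gamma> t) * (fn \<gamma> (Sup k) - fn \<gamma> (Inf k)))"

abbreviation fine_tagged :: "plane_path \<Rightarrow> real \<Rightarrow> (real \<times> real set) set \<Rightarrow> bool" where
  "fine_tagged \<gamma> \<delta> p \<equiv> p tagged_division_of {lo \<gamma>..hi \<gamma>} \<and> (\<lambda>t. ball t \<delta>) fine p"

text \<open>\<open>W\<close> dominates increments as arc length does. It is left arbitrary so that
  it can be linear for segments and can be halved in
  \<open>vanishing_subarc_integrals\<close>.\<close>

definition variation_bound :: "(real \<Rightarrow> real) \<Rightarrow> (real \<Rightarrow> complex) \<Rightarrow> real \<Rightarrow> real \<Rightarrow> bool" where
  "variation_bound W \<phi> a b \<longleftrightarrow> (\<forall>u v. a \<le> u \<and> u \<le> v \<and> v \<le> b \<longrightarrow> norm (\<phi> v - \<phi> u) \<le> W v - W u)"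

lemma variation_boundD:
  "variation_bound W \<phi> a b \<Longrightarrow> a \<le> u \<Longrightarrow> u \<le> v \<Longrightarrow> v \<le> b \<Longrightarrow> norm (\<phi> v - \<phi> u) \<le> W v - W u"
  by (simp add: variation_bound_def)

lemma variation_bound_subset:
  "variation_bound W \<phi> a b \<Longrightarrow> a \<le> c \<Longrightarrow> d \<le> b \<Longrightarrow> variation_bound W \<phi> c d"
  by (simp add: variation_bound_def)

lemma variation_bound_nonneg:
  "variation_bound W \<phi> a b \<Longrightarrow> a \<le> u \<Longrightarrow> u \<le> v \<Longrightarrow> v \<le> b \<Longrightarrow> 0 \<le> W v - W u"
  using variation_boundD norm_ge_zero order_trans by blast

lemma variation_sum_insert:
  assumes d: "d division_of {a..u}" and uv: "a \<le> u" "u < v"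
  shows "insert {u..v} d division_of {a..v}"
    and "variation_sum \<gamma> (insert {u..v} d) = variation_sum \<gamma> d + norm (fn \<gamma> v - fn \<gamma> u)"
proof -
  have "{{u..v}} division_of {u..v}" using uv division_of_self[of u v] by simp
  then have "d \<union> {{u..v}} division_of {a..u} \<union> {u..v}"
    by (intro division_disjoint_union[OF d]) auto
  moreover have "{a..u} \<union> {u..v} = {a..v}" using uv by auto
  ultimately show "insert {u..v} d division_of {a..v}" by simp
  have "{u..v} \<notin> d"
  proof
    assume "{u..v} \<in> d"
    then have "{u..v} \<subseteq> {a..u}" using division_ofD(2)[OF d] by blast
    then have "v \<in> {a..u}" using uv by (meson atLeastAtMost_iff less_imp_le order_refl subsetD)
    then show False using uv by simp
  qed
  then show "variation_sum \<gamma> (insert {u..v} d) = variation_sum \<gamma> d + norm (fn \<gamma> v - fn \<gamma> u)"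
    using division_of_finite[OF d] uv by (simp add: variation_sum_def)
qed

text \<open>\<open>W t\<close> is the variation up to \<open>t\<close>. Extending a division that
  ends at \<open>u\<close> by the interval from \<open>u\<close> to \<open>v\<close> shows that
  \<open>W\<close> grows by at least the length of the chord.\<close>

lemma rectifiable_variation_bound:
  assumes \<gamma>: "rectifiable \<gamma>" "lo \<gamma> < hi \<gamma>"
  obtains W where "variation_bound W (fn \<gamma>) (lo \<gamma>) (hi \<gamma>)" "W (hi \<gamma>) - W (lo \<gamma>) \<le> path_len \<gamma>"
proof -
  define V where "V t = variation_sum \<gamma> ` {d. d division_of {lo \<gamma>..t}}" for t
  define W where "W t = Sup (V t)" for t
  have ne: "V t \<noteq> {}" if "lo \<gamma> \<le> t" for t
    using division_of_self[of "lo \<gamma>" t] that by (auto simp: V_def)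
  have bdd: "bdd_above (V t)" if "lo \<gamma> \<le> t" "t \<le> hi \<gamma>" for t
  proof (cases "t = hi \<gamma>")
    case True then show ?thesis using \<gamma>(1) by (simp add: V_def rectifiable_def)
  next
    case False
    then have t: "t < hi \<gamma>" using that by simp
    obtain M where M: "\<And>d. d division_of {lo \<gamma>..hi \<gamma>} \<Longrightarrow> variation_sum \<gamma> d \<le> M"
      using \<gamma>(1) by (auto simp: rectifiable_def bdd_above_def)
    show ?thesis
    proof (rule bdd_aboveI[of _ M])
      fix x assume "x \<in> V t"
      then obtain d where d: "d division_of {lo \<gamma>..t}" "x = variation_sum \<gamma> d" by (auto simp: V_def)
      have "x \<le> variation_sum \<gamma> (insert {t..hi \<gamma>} d)"
        using variation_sum_insert(2)[OF d(1) that(1) t, of \<gamma>] d(2) by simp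
      also have "\<dots> \<le> M" by (intro M variation_sum_insert[OF d(1) that(1) t])
      finally show "x \<le> M" .
    qed
  qed
  have "norm (fn \<gamma> v - fn \<gamma> u) \<le> W v - W u" if uv: "lo \<gamma> \<le> u" "u \<le> v" "v \<le> hi \<gamma>" for u v
  proof (cases "u = v")
    case False
    then have lt: "u < v" using uv by simp
    have "W u \<le> W v - norm (fn \<gamma> v - fn \<gamma> u)" unfolding W_def[of u]
    proof (rule cSup_least[OF ne[OF uv(1)]])
      fix x assume "x \<in> V u"
      then obtain d where d: "d division_of {lo \<gamma>..u}" "x = variation_sum \<gamma> d" by (auto simp: V_def)
      have "variation_sum \<gamma> (insert {u..v} d) \<in> V v"
        unfolding V_def using variation_sum_insert(1)[OF d(1) uv(1) lt] by blast
      then have "variation_sum \<gamma> (insert {u..v} d) \<le> W v"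
        unfolding W_def using bdd[of v] uv by (intro cSup_upper) auto
      then show "x \<le> W v - norm (fn \<gamma> v - fn \<gamma> u)"
        using variation_sum_insert(2)[OF d(1) uv(1) lt, of \<gamma>] d(2) by simp
    qed
    then show ?thesis by simp
  qed simp
  then have "variation_bound W (fn \<gamma>) (lo \<gamma>) (hi \<gamma>)" by (simp add: variation_bound_def)
  moreover have "W (hi \<gamma>) = path_len \<gamma>" by (simp add: W_def V_def path_len_def)
  moreover have "W (lo \<gamma>) \<ge> 0"
  proof -
    have "{{lo \<gamma>..lo \<gamma>}} division_of {lo \<gamma>..lo \<gamma>}" using division_of_self[of "lo \<gamma>" "lo \<gamma>"] by simp
    then have "variation_sum \<gamma> {{lo \<gamma>..lo \<gamma>}} \<in> V (lo \<gamma>)" unfolding V_def by blast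
    then have "variation_sum \<gamma> {{lo \<gamma>..lo \<gamma>}} \<le> W (lo \<gamma>)"
      unfolding W_def using bdd[of "lo \<gamma>"] \<gamma>(2) by (intro cSup_upper) auto
    then show ?thesis by (simp add: variation_sum_def)
  qed
  ultimately show ?thesis by (intro that[of W]) auto
qed

section \<open>Estimates for sums over tagged divisions\<close>

lemma tagged_division_of_real_interval:
  fixes a b :: real
  assumes "p tagged_division_of {a..b}" "(t, k) \<in> p"
  obtains u v where "k = {u..v}" "u \<le> t" "t \<le> v" "a \<le> u" "v \<le> b" "Inf k = u" "Sup k = v"
proof -
  obtain u v where k: "k = {u..v}" using tagged_division_ofD(4)[OF assms] by auto
  have t: "t \<in> k" "k \<subseteq> {a..b}" using tagged_division_ofD(2,3)[OF assms] by auto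
  then have "u \<le> v" using k by auto
  then show ?thesis using that[of u v] k t by (auto simp: subset_iff)
qed

text \<open>The bounds add up because the increments of \<open>W\<close> telescope. The general
  summand \<open>h t u v\<close> covers Riemann sums as well as differences of additive
  functions.\<close>

lemma norm_tagged_sum_le:
  fixes a b :: real
  assumes p: "p tagged_division_of {a..b}" "a \<le> b"
    and le: "\<And>t u v. (t, {u..v}) \<in> p \<Longrightarrow> u \<le> t \<Longrightarrow> t \<le> v \<Longrightarrow> a \<le> u \<Longrightarrow> v \<le> b \<Longrightarrow> norm (h t u v) \<le> \<epsilon> * (W v - W u)"
  shows "norm (\<Sum>(t, k)\<in>p. h t (Inf k) (Sup k)) \<le> \<epsilon> * (W b - W a)"
proof -
  have "norm (\<Sum>(t, k)\<in>p. h t (Inf k) (Sup k)) \<le> (\<Sum>(t, k)\<in>p. \<epsilon> * (W (Sup k) - W (Inf k)))"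
  proof (rule sum_norm_le, clarify)
    fix t k assume tk: "(t, k) \<in> p"
    obtain u v where uv: "k = {u..v}" "u \<le> t" "t \<le> v" "a \<le> u" "v \<le> b" "Inf k = u" "Sup k = v"
      using tagged_division_of_real_interval[OF p(1) tk] .
    then show "norm (h t (Inf k) (Sup k)) \<le> \<epsilon> * (W (Sup k) - W (Inf k))"
      using le[of t u v] tk by simp
  qed
  also have "\<dots> = \<epsilon> * (\<Sum>(t, k)\<in>p. W (Sup k) - W (Inf k))"
    by (simp add: sum_distrib_left case_prod_unfold)
  also have "\<dots> = \<epsilon> * (W b - W a)" using additive_tagged_division_1[OF p(2,1), of W] by (simp only:)
  finally show ?thesis .
qed

text \<open>The terms with constant integrand \<open>c\<close> telescope. For c = 0 this is the
  length estimate for integrals; for c = g z it yields differentiability at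
  \<open>z\<close>.\<close>

lemma has_path_integral_near_const:
  assumes I: "has_path_integral g I \<gamma>" and le: "lo \<gamma> \<le> hi \<gamma>"
    and W: "variation_bound W (fn \<gamma>) (lo \<gamma>) (hi \<gamma>)"
    and g: "\<And>t. lo \<gamma> \<le> t \<Longrightarrow> t \<le> hi \<gamma> \<Longrightarrow> norm (g (fn \<gamma> t) - c) \<le> \<epsilon>"
  shows "norm (I - c * (end_pt \<gamma> - start_pt \<gamma>)) \<le> \<epsilon> * (W (hi \<gamma>) - W (lo \<gamma>))"
proof (rule field_le_epsilon)
  fix e :: real assume "e > 0"
  from I[unfolded has_path_integral_def, rule_format, OF this]
  obtain \<delta> where \<delta>: "\<delta> > 0" "\<forall>p. fine_tagged \<gamma> \<delta> p \<longrightarrow>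
      norm (riemann_sum \<gamma> g p - I) < e"
    by blast
  have "gauge (\<lambda>t::real. ball t \<delta>)" using \<delta>(1) by (intro gauge_ball_dependent) auto
  then obtain p where p: "p tagged_division_of {lo \<gamma>..hi \<gamma>}" "(\<lambda>t. ball t \<delta>) fine p"
    by (rule fine_division_exists_real)
  define S where "S = riemann_sum \<gamma> g p"
  have \<epsilon>: "\<epsilon> \<ge> 0" using g[of "lo \<gamma>"] le norm_ge_zero order_trans by blast
  have "S - c * (end_pt \<gamma> - start_pt \<gamma>) = (\<Sum>(t, k)\<in>p. (g (fn \<gamma> t) - c) * (fn \<gamma> (Sup k) - fn \<gamma> (Inf k)))"
    unfolding S_def end_pt_def start_pt_def additive_tagged_division_1[OF le p(1), of "fn \<gamma>", symmetric]
    by (simp add: sum_distrib_left case_prod_unfold left_diff_distrib flip: sum_subtractf)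
  also have "norm \<dots> \<le> \<epsilon> * (W (hi \<gamma>) - W (lo \<gamma>))"
  proof (rule norm_tagged_sum_le[OF p(1) le])
    fix t u v assume *: "u \<le> t" "t \<le> v" "lo \<gamma> \<le> u" "v \<le> hi \<gamma>"
    show "norm ((g (fn \<gamma> t) - c) * (fn \<gamma> v - fn \<gamma> u)) \<le> \<epsilon> * (W v - W u)"
      unfolding norm_mult using * \<epsilon> by (intro mult_mono g variation_boundD[OF W]) auto
  qed
  finally have "norm (S - c * (end_pt \<gamma> - start_pt \<gamma>)) \<le> \<epsilon> * (W (hi \<gamma>) - W (lo \<gamma>))" .
  moreover have "norm (S - I) < e" using \<delta>(2) p unfolding S_def by blast
  ultimately show "norm (I - c * (end_pt \<gamma> - start_pt \<gamma>)) \<le> \<epsilon> * (W (hi \<gamma>) - W (lo \<gamma>)) + e"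
    using norm_triangle_ineq4[of "S - c * (end_pt \<gamma> - start_pt \<gamma>)" "S - I"] by simp
qed

text \<open>A mean value inequality along a curve that need not be differentiable. The neighbourhood
  in which differentiability at \<phi> t can be used depends on \<open>t\<close>; a division fine
  for the corresponding gauge (Cousin's lemma) reduces to finitely many of them.\<close>

lemma derivative_along_path:
  assumes \<phi>: "continuous_on {a..b} \<phi>" "\<phi> ` {a..b} \<subseteq> X" and ab: "a \<le> b" and W: "variation_bound W \<phi> a b"
    and f: "\<And>z. z \<in> X \<Longrightarrow> (f has_field_derivative f' z) (at z within X)"
    and c: "\<And>t. a \<le> t \<Longrightarrow> t \<le> b \<Longrightarrow> norm (f' (\<phi> t) - c) \<le> \<epsilon>"
  shows "norm (f (\<phi> b) - f (\<phi> a) - c * (\<phi> b - \<phi> a)) \<le> \<epsilon> * (W b - W a)"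
proof -
  define M where "M = W b - W a"
  have M: "M \<ge> 0" unfolding M_def using variation_bound_nonneg[OF W] ab by simp
  have est: "norm (f (\<phi> b) - f (\<phi> a) - c * (\<phi> b - \<phi> a)) \<le> (\<epsilon> + \<eta>) * M" if \<eta>: "\<eta> > 0" for \<eta>
  proof -
    have "\<exists>\<delta>>0. \<forall>s\<in>{a..b}. \<bar>s - t\<bar> < \<delta> \<longrightarrow> norm (f (\<phi> s) - f (\<phi> t) - f' (\<phi> t) * (\<phi> s - \<phi> t)) \<le> \<eta> * norm (\<phi> s - \<phi> t)"
      if t: "t \<in> {a..b}" for t
    proof -
      have "(f has_derivative (\<lambda>h. f' (\<phi> t) * h)) (at (\<phi> t) within X)"
        using f[of "\<phi> t"] imageI[OF t, of \<phi>] \<phi>(2) unfolding has_field_derivative_def by blast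
      then obtain d where d: "d > 0" "\<And>z. z \<in> X \<Longrightarrow> norm (z - \<phi> t) < d \<Longrightarrow>
          norm (f z - f (\<phi> t) - f' (\<phi> t) * (z - \<phi> t)) \<le> \<eta> * norm (z - \<phi> t)"
        unfolding has_derivative_within_alt using \<eta> by blast
      obtain \<delta> where "\<delta> > 0" "\<And>s. s \<in> {a..b} \<Longrightarrow> dist s t < \<delta> \<Longrightarrow> dist (\<phi> s) (\<phi> t) < d"
        using \<phi>(1) t d(1) unfolding continuous_on_iff by metis
      then show ?thesis using d(2) \<phi>(2) by (intro exI[of _ \<delta>]) (auto simp: dist_norm image_subset_iff)
    qed
    then obtain \<delta> where \<delta>: "\<And>t. t \<in> {a..b} \<Longrightarrow> \<delta> t > 0"
      "\<And>t s. t \<in> {a..b} \<Longrightarrow> s \<in> {a..b} \<Longrightarrow> \<bar>s - t\<bar> < \<delta> t \<Longrightarrow> norm (f (\<phi> s) - f (\<phi> t) - f' (\<phi> t) * (\<phi> s - \<phi> t)) \<le> \<eta> * norm (\<phi> s - \<phi> t)"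
      by metis
    have "gauge (\<lambda>t. ball t (if t \<in> {a..b} then \<delta> t else 1))"
      using \<delta>(1) by (intro gauge_ball_dependent) auto
    then obtain p where p: "p tagged_division_of {a..b}" "(\<lambda>t. ball t (if t \<in> {a..b} then \<delta> t else 1)) fine p"
      by (rule fine_division_exists_real)
    define h where "h t u v = f (\<phi> v) - f (\<phi> u) - c * (\<phi> v - \<phi> u)" for t u v :: real
    have "f (\<phi> b) - f (\<phi> a) - c * (\<phi> b - \<phi> a) = (\<Sum>(t, k)\<in>p. h t (Inf k) (Sup k))"
      using additive_tagged_division_1[OF ab p(1), of "\<lambda>t. f (\<phi> t) - c * \<phi> t"]
      by (simp add: h_def algebra_simps case_prod_unfold)
    also have "norm \<dots> \<le> (\<epsilon> + \<eta>) * (W b - W a)"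
    proof (rule norm_tagged_sum_le[OF p(1) ab])
      fix t u v assume tp: "(t, {u..v}) \<in> p" and *: "u \<le> t" "t \<le> v" "a \<le> u" "v \<le> b"
      have t: "t \<in> {a..b}" "u \<in> {a..b}" "v \<in> {a..b}" using * by auto
      have "{u..v} \<subseteq> ball t (\<delta> t)" using fineD[OF p(2) tp] t(1) by simp
      moreover have "u \<in> {u..v}" "v \<in> {u..v}" using * by auto
      ultimately have "\<bar>u - t\<bar> < \<delta> t" "\<bar>v - t\<bar> < \<delta> t" by (auto simp: subset_iff dist_real_def abs_minus_commute)
      then have 1: "norm (f (\<phi> u) - f (\<phi> t) - f' (\<phi> t) * (\<phi> u - \<phi> t)) \<le> \<eta> * (W t - W u)"
        and 2: "norm (f (\<phi> v) - f (\<phi> t) - f' (\<phi> t) * (\<phi> v - \<phi> t)) \<le> \<eta> * (W v - W t)"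
      proof -
        have "\<eta> * norm (\<phi> u - \<phi> t) \<le> \<eta> * (W t - W u)" "\<eta> * norm (\<phi> v - \<phi> t) \<le> \<eta> * (W v - W t)"
          using variation_boundD[OF W, of u t] variation_boundD[OF W, of t v] * \<eta>
          by (simp_all add: norm_minus_commute)
        then show "norm (f (\<phi> u) - f (\<phi> t) - f' (\<phi> t) * (\<phi> u - \<phi> t)) \<le> \<eta> * (W t - W u)"
          "norm (f (\<phi> v) - f (\<phi> t) - f' (\<phi> t) * (\<phi> v - \<phi> t)) \<le> \<eta> * (W v - W t)"
          using \<delta>(2)[OF t(1,2)] \<delta>(2)[OF t(1,3)] \<open>\<bar>u - t\<bar> < \<delta> t\<close> \<open>\<bar>v - t\<bar> < \<delta> t\<close> by linarith+
      qed
      have 3: "norm ((f' (\<phi> t) - c) * (\<phi> v - \<phi> u)) \<le> \<epsilon> * (W v - W u)"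
        unfolding norm_mult using * c[of t] order_trans[OF norm_ge_zero c[of t]]
        by (intro mult_mono variation_boundD[OF W]) auto
      \<comment> \<open>The increment is split at the tag, because the linear approximation is
        available only from \<phi> t.\<close>
      have "h t u v = (f (\<phi> v) - f (\<phi> t) - f' (\<phi> t) * (\<phi> v - \<phi> t)) - (f (\<phi> u) - f (\<phi> t) - f' (\<phi> t) * (\<phi> u - \<phi> t))
          + (f' (\<phi> t) - c) * (\<phi> v - \<phi> u)"
        by (simp add: h_def algebra_simps)
      then have "norm (h t u v) \<le> \<eta> * (W v - W t) + \<eta> * (W t - W u) + \<epsilon> * (W v - W u)"
        using norm_triangle_mono[OF order_trans[OF norm_triangle_ineq4 add_mono[OF 2 1]] 3] by simp
      also have "\<dots> = (\<epsilon> + \<eta>) * (W v - W u)" by (simp add: algebra_simps)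
      finally show "norm (h t u v) \<le> (\<epsilon> + \<eta>) * (W v - W u)" .
    qed
    finally show ?thesis by (simp add: M_def)
  qed
  have "norm (f (\<phi> b) - f (\<phi> a) - c * (\<phi> b - \<phi> a)) \<le> \<epsilon> * M"
  proof (rule field_le_epsilon)
    fix e :: real assume e: "e > 0"
    have "e / (M + 1) > 0" using M e by simp
    from est[OF this] have "norm (f (\<phi> b) - f (\<phi> a) - c * (\<phi> b - \<phi> a)) \<le> \<epsilon> * M + e * (M / (M + 1))"
      by (simp add: distrib_right)
    also have "e * (M / (M + 1)) \<le> e * 1" using M e by (intro mult_left_mono) auto
    finally show "norm (f (\<phi> b) - f (\<phi> a) - c * (\<phi> b - \<phi> a)) \<le> \<epsilon> * M + e" by simp
  qed
  then show ?thesis by (simp add: M_def)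
qed

text \<open>On each interval of a fine division \<open>derivative_along_path\<close>, with
  \<open>c\<close> the value of \<open>f'\<close> at the tag, controls one term of the sum; uniform
  continuity along the path makes the errors small relative to the variation.\<close>

lemma has_path_integral_derivative:
  assumes \<gamma>: "path_in X \<gamma>" "rectifiable \<gamma>"
    and f: "\<And>z. z \<in> X \<Longrightarrow> (f has_field_derivative f' z) (at z within X)" and f': "continuous_on X f'"
  shows "has_path_integral f' (f (end_pt \<gamma>) - f (start_pt \<gamma>)) \<gamma>"
  unfolding has_path_integral_def
proof (intro allI impI)
  fix e :: real assume e: "e > 0"
  define a b \<phi> where "a = lo \<gamma>" and "b = hi \<gamma>" and "\<phi> = fn \<gamma>"
  have ab: "a < b" and \<phi>: "continuous_on {a..b} \<phi>" "\<phi> ` {a..b} \<subseteq> X"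
    using \<gamma>(1) by (auto simp: path_in_def a_def b_def \<phi>_def)
  obtain W where W: "variation_bound W \<phi> a b"
    using rectifiable_variation_bound[OF \<gamma>(2)] ab unfolding a_def b_def \<phi>_def by metis
  define M where "M = W b - W a"
  have M: "M \<ge> 0" unfolding M_def using variation_bound_nonneg[OF W] ab by simp
  define \<epsilon> where "\<epsilon> = e / (M + 1)"
  have \<epsilon>: "\<epsilon> > 0" "\<epsilon> * M < e"
  proof -
    show "\<epsilon> > 0" using e M by (simp add: \<epsilon>_def)
    have "\<epsilon> * (M + 1) = e" using M by (simp add: \<epsilon>_def)
    then show "\<epsilon> * M < e" using \<open>\<epsilon> > 0\<close> by (simp add: distrib_left)
  qed
  have "continuous_on {a..b} (\<lambda>t. f' (\<phi> t))" by (rule continuous_on_compose2[OF f' \<phi>])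
  then have "uniformly_continuous_on {a..b} (\<lambda>t. f' (\<phi> t))" by (simp add: compact_uniformly_continuous)
  then obtain \<delta> where \<delta>: "\<delta> > 0" "\<And>s t. s \<in> {a..b} \<Longrightarrow> t \<in> {a..b} \<Longrightarrow> dist t s < \<delta> \<Longrightarrow> dist (f' (\<phi> t)) (f' (\<phi> s)) < \<epsilon>"
    unfolding uniformly_continuous_on_def using \<epsilon> by metis
  have "norm ((\<Sum>(t, k)\<in>p. f' (\<phi> t) * (\<phi> (Sup k) - \<phi> (Inf k))) - (f (\<phi> b) - f (\<phi> a))) < e"
    if p: "p tagged_division_of {a..b}" "(\<lambda>t. ball t \<delta>) fine p" for p
  proof -
    define h where "h t u v = f' (\<phi> t) * (\<phi> v - \<phi> u) - (f (\<phi> v) - f (\<phi> u))" for t u v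
    have "(\<Sum>(t, k)\<in>p. f' (\<phi> t) * (\<phi> (Sup k) - \<phi> (Inf k))) - (f (\<phi> b) - f (\<phi> a)) = (\<Sum>(t, k)\<in>p. h t (Inf k) (Sup k))"
      using additive_tagged_division_1[OF less_imp_le[OF ab] p(1), of "\<lambda>t. f (\<phi> t)"]
      by (simp add: h_def case_prod_unfold sum_subtractf)
    also have "norm \<dots> \<le> \<epsilon> * (W b - W a)"
    proof (rule norm_tagged_sum_le[OF p(1) less_imp_le[OF ab]])
      fix t u v assume tp: "(t, {u..v}) \<in> p" and *: "u \<le> t" "t \<le> v" "a \<le> u" "v \<le> b"
      have "norm (f (\<phi> v) - f (\<phi> u) - f' (\<phi> t) * (\<phi> v - \<phi> u)) \<le> \<epsilon> * (W v - W u)"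
      proof (rule derivative_along_path[OF _ _ _ _ f])
        show "continuous_on {u..v} \<phi>" "\<phi> ` {u..v} \<subseteq> X" "u \<le> v"
          using * \<phi> continuous_on_subset[OF \<phi>(1), of "{u..v}"] by auto
        show "variation_bound W \<phi> u v" using variation_bound_subset[OF W] * by simp
        fix s assume s: "u \<le> s" "s \<le> v"
        then have "s \<in> ball t \<delta>" using fineD[OF p(2) tp] by auto
        then have "dist (f' (\<phi> s)) (f' (\<phi> t)) < \<epsilon>" using \<delta>(2)[of t s] * s by (auto simp: dist_commute)
        then show "norm (f' (\<phi> s) - f' (\<phi> t)) \<le> \<epsilon>" by (simp add: dist_norm)
      qed
      then show "norm (h t u v) \<le> \<epsilon> * (W v - W u)" by (simp add: h_def norm_minus_commute)
    qed
    finally show ?thesis using \<epsilon>(2) by (simp add: M_def)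
  qed
  then show "\<exists>\<delta>>0. \<forall>p. fine_tagged \<gamma> \<delta> p \<longrightarrow>
        norm (riemann_sum \<gamma> f' p - (f (end_pt \<gamma>) - f (start_pt \<gamma>))) < e"
    using \<delta>(1) unfolding end_pt_def start_pt_def a_def b_def \<phi>_def by blast
qed

lemma has_path_integral_cong:
  assumes "path_in X \<gamma>" "\<And>z. z \<in> X \<Longrightarrow> g z = h z" "has_path_integral g I \<gamma>"
  shows "has_path_integral h I \<gamma>"
proof -
  have eq: "riemann_sum \<gamma> g p = riemann_sum \<gamma> h p"
    if "p tagged_division_of {lo \<gamma>..hi \<gamma>}" for p
  proof (rule sum.cong[OF refl], clarify)
    fix t k assume tk: "(t, k) \<in> p"
    have "t \<in> {lo \<gamma>..hi \<gamma>}" using tagged_division_ofD(2,3)[OF that tk] by blast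
    then show "g (fn \<gamma> t) * (fn \<gamma> (Sup k) - fn \<gamma> (Inf k)) = h (fn \<gamma> t) * (fn \<gamma> (Sup k) - fn \<gamma> (Inf k))"
      using assms(1,2) by (auto simp: path_in_def image_subset_iff)
  qed
  show ?thesis unfolding has_path_integral_def
  proof (intro allI impI)
    fix e :: real assume "e > 0"
    from assms(3)[unfolded has_path_integral_def, rule_format, OF this]
    obtain \<delta> where \<delta>: "\<delta> > 0" "\<forall>p. fine_tagged \<gamma> \<delta> p \<longrightarrow>
        norm (riemann_sum \<gamma> g p - I) < e"
      by blast
    show "\<exists>\<delta>>0. \<forall>p. fine_tagged \<gamma> \<delta> p \<longrightarrow>
        norm (riemann_sum \<gamma> h p - I) < e"
    proof (intro exI[of _ \<delta>] conjI allI impI \<delta>(1))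
      fix p assume p: "fine_tagged \<gamma> \<delta> p"
      show "norm (riemann_sum \<gamma> h p - I) < e"
        using \<delta>(2)[rule_format, OF p] unfolding eq[OF conjunct1[OF p]] .
    qed
  qed
qed

lemma has_path_integral_diff:
  assumes "has_path_integral g I \<gamma>" "has_path_integral h J \<gamma>"
  shows "has_path_integral (\<lambda>z. g z - h z) (I - J) \<gamma>"
  unfolding has_path_integral_def
proof (intro allI impI)
  fix e :: real assume "e > 0"
  then have e2: "e / 2 > 0" by simp
  define S where "S g p = riemann_sum \<gamma> g p" for g and p :: "(real \<times> real set) set"
  obtain d1 where d1: "d1 > 0" "\<And>p. fine_tagged \<gamma> d1 p \<Longrightarrow> norm (S g p - I) < e / 2"
    using assms(1) e2 unfolding has_path_integral_def S_def by meson
  obtain d2 where d2: "d2 > 0" "\<And>p. fine_tagged \<gamma> d2 p \<Longrightarrow> norm (S h p - J) < e / 2"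
    using assms(2) e2 unfolding has_path_integral_def S_def by meson
  have "norm (S (\<lambda>z. g z - h z) p - (I - J)) < e"
    if "fine_tagged \<gamma> (min d1 d2) p" for p
  proof -
    have f: "(\<lambda>t. ball t d1) fine p" "(\<lambda>t. ball t d2) fine p"
      using that by (auto simp: fine_def subset_iff)
    have "S (\<lambda>z. g z - h z) p = S g p - S h p"
      by (simp add: S_def left_diff_distrib case_prod_unfold sum_subtractf)
    then have "S (\<lambda>z. g z - h z) p - (I - J) = (S g p - I) - (S h p - J)" by simp
    then have "norm (S (\<lambda>z. g z - h z) p - (I - J)) \<le> norm (S g p - I) + norm (S h p - J)"
      by (simp only: norm_triangle_ineq4)
    moreover have "norm (S g p - I) < e / 2" "norm (S h p - J) < e / 2"
      using d1(2)[of p] d2(2)[of p] f that by blast+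
    ultimately show ?thesis by linarith
  qed
  then show "\<exists>\<delta>>0. \<forall>p. fine_tagged \<gamma> \<delta> p \<longrightarrow>
        norm ((\<Sum>(t, k)\<in>p. (g (fn \<gamma> t) - h (fn \<gamma> t)) * (fn \<gamma> (Sup k) - fn \<gamma> (Inf k))) - (I - J)) < e"
    using d1(1) d2(1) unfolding S_def by (intro exI[of _ "min d1 d2"]) simp
qed

text \<open>
  If the integrals over all subarcs vanish but \<open>d (fn \<gamma> t) \<noteq> 0\<close>, then near \<open>t\<close> every dominating
  function \<open>W\<close> may be halved; iterating, \<open>fn \<gamma>\<close> is constant near \<open>t\<close>.
\<close>

lemma vanishing_subarc_integrals:
  assumes \<gamma>: "jordan_arc_in X \<gamma>" "rectifiable \<gamma>" and d: "continuous_on X d"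
    and int0: "\<And>a b. lo \<gamma> \<le> a \<Longrightarrow> a < b \<Longrightarrow> b \<le> hi \<gamma> \<Longrightarrow> has_path_integral d 0 (subarc a b \<gamma>)"
    and t: "t \<in> {lo \<gamma>..hi \<gamma>}"
  shows "d (fn \<gamma> t) = 0"
proof (rule ccontr)
  assume nz: "d (fn \<gamma> t) \<noteq> 0"
  define c where "c = d (fn \<gamma> t)"
  define a b \<phi> where "a = lo \<gamma>" and "b = hi \<gamma>" and "\<phi> = fn \<gamma>"
  have ab: "a < b" and \<phi>: "continuous_on {a..b} \<phi>" "\<phi> ` {a..b} \<subseteq> X" and inj: "inj_on \<phi> {a..b}"
    using \<gamma>(1) by (auto simp: jordan_arc_in_def path_in_def a_def b_def \<phi>_def)
  obtain W where W: "variation_bound W \<phi> a b"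
    using rectifiable_variation_bound[OF \<gamma>(2)] ab unfolding a_def b_def \<phi>_def by metis
  have "continuous_on {a..b} (\<lambda>t. d (\<phi> t))" by (rule continuous_on_compose2[OF d \<phi>])
  then obtain \<delta> where \<delta>: "\<delta> > 0" "\<And>s. s \<in> {a..b} \<Longrightarrow> dist s t < \<delta> \<Longrightarrow> dist (d (\<phi> s)) (d (\<phi> t)) < norm c / 2"
    using t nz unfolding continuous_on_iff a_def b_def c_def by (metis half_gt_zero zero_less_norm_iff)
  define x where "x = max a (t - \<delta> / 2)"
  define y where "y = min b (t + \<delta> / 2)"
  have xy: "a \<le> x" "x < y" "y \<le> b" using t ab \<delta>(1) by (auto simp: x_def y_def a_def b_def)
  have near: "norm (d (\<phi> s) - c) \<le> norm c / 2" if "x \<le> s" "s \<le> y" for s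
  proof -
    have "s \<in> {a..b}" "dist s t < \<delta>" using that xy \<delta>(1) by (auto simp: x_def y_def dist_real_def)
    then show ?thesis using \<delta>(2)[of s] by (simp add: dist_norm c_def \<phi>_def less_imp_le)
  qed
  \<comment> \<open>On [x, y] the integrand is within |c| / 2 of \<open>c\<close>, so a vanishing
    integral gives |c| |\<phi> v - \<phi> u| \<le> (|c| / 2) (V v - V u).\<close>
  have half: "variation_bound (\<lambda>s. V s / 2) \<phi> x y" if V: "variation_bound V \<phi> x y" for V
    unfolding variation_bound_def
  proof (intro allI impI)
    fix u v assume uv: "x \<le> u \<and> u \<le> v \<and> v \<le> y"
    show "norm (\<phi> v - \<phi> u) \<le> V v / 2 - V u / 2"
    proof (cases "u = v")
      case False
      then have lt: "u < v" using uv by simp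
      have "variation_bound V (fn (subarc u v \<gamma>)) u v"
        using V uv by (simp add: variation_bound_def subarc_def \<phi>_def)
      then have "norm (0 - c * (end_pt (subarc u v \<gamma>) - start_pt (subarc u v \<gamma>))) \<le> norm c / 2 * (V v - V u)"
        using has_path_integral_near_const[OF int0[of u v], of V c "norm c / 2"] uv lt xy near
        by (simp add: subarc_def a_def b_def \<phi>_def)
      then have "norm c * norm (\<phi> v - \<phi> u) \<le> norm c * ((V v - V u) / 2)"
        using lt by (simp add: end_pt_def start_pt_def subarc_def \<phi>_def norm_mult)
      then have "norm (\<phi> v - \<phi> u) \<le> (V v - V u) / 2"
        using nz by (simp add: c_def)
      then show ?thesis by (simp add: diff_divide_distrib)
    qed simp
  qed
  have "variation_bound (\<lambda>s. W s / 2 ^ n) \<phi> x y" for n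
  proof (induction n)
    case 0 show ?case using variation_bound_subset[OF W xy(1,3)] by simp
  next
    case (Suc n) then show ?case using half by (fastforce simp: mult.commute)
  qed
  then have le: "norm (\<phi> y - \<phi> x) \<le> (W y - W x) / 2 ^ n" for n
    using variation_boundD[of "\<lambda>s. W s / 2 ^ n" \<phi> x y x y] xy by (simp add: diff_divide_distrib)
  have "(\<lambda>n. (W y - W x) * (1/2) ^ n) \<longlonglongrightarrow> (W y - W x) * 0"
    by (intro tendsto_intros) auto
  moreover have "norm (\<phi> y - \<phi> x) \<le> (W y - W x) * (1/2) ^ n" for n
    unfolding power_one_over times_divide_eq_right mult_1_right by (rule le)
  ultimately have "norm (\<phi> y - \<phi> x) \<le> (W y - W x) * 0"
    by (intro LIMSEQ_le_const[of "\<lambda>n. (W y - W x) * (1/2) ^ n"]) blast+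
  then have "\<phi> y = \<phi> x" by simp
  then show False using inj_onD[OF inj, of y x] xy by auto
qed

text \<open>Segments are the paths whose membership in \<open>F\<close> will be inferred from their
  length. \<open>restrict\<close> makes the map extensional, as \<open>path_in\<close> asks.\<close>

lemma segment_path:
  fixes a b :: complex
  assumes "a \<noteq> b" "closed_segment a b \<subseteq> X"
  defines "\<sigma> \<equiv> Plane_Path 0 1 (restrict (linepath a b) {0..1})"
  shows "jordan_arc_in X \<sigma>" "rectifiable \<sigma>" "path_len \<sigma> \<le> dist a b"
    "variation_bound (\<lambda>t. dist a b * t) (fn \<sigma>) 0 1" "start_pt \<sigma> = a" "end_pt \<sigma> = b"
    "lo \<sigma> = 0" "hi \<sigma> = 1" "\<And>t. t \<in> {0..1} \<Longrightarrow> fn \<sigma> t \<in> closed_segment a b"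
proof -
  show lh: "lo \<sigma> = 0" "hi \<sigma> = 1" by (simp_all add: \<sigma>_def)
  have fn: "fn \<sigma> t = linepath a b t" if "t \<in> {0..1}" for t using that by (simp add: \<sigma>_def)
  show "start_pt \<sigma> = a" "end_pt \<sigma> = b" by (simp_all add: start_pt_def end_pt_def \<sigma>_def linepath_def)
  show seg: "fn \<sigma> t \<in> closed_segment a b" if "t \<in> {0..1}" for t
    using fn[OF that] that by (metis imageI linepath_image_01)
  have diff: "linepath a b v - linepath a b u = (v - u) *\<^sub>R (b - a)" for u v
    by (simp add: linepath_def algebra_simps)
  have nd: "norm (fn \<sigma> v - fn \<sigma> u) = dist a b * (v - u)" if "0 \<le> u" "u \<le> v" "v \<le> 1" for u v
    using that fn[of u] fn[of v] by (simp add: diff dist_norm norm_minus_commute mult.commute)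
  then show "variation_bound (\<lambda>t. dist a b * t) (fn \<sigma>) 0 1"
    by (simp add: variation_bound_def right_diff_distrib)
  have inj: "inj_on (fn \<sigma>) {0..1}"
  proof (rule inj_onI)
    fix s t :: real assume st: "s \<in> {0..1}" "t \<in> {0..1}" "fn \<sigma> s = fn \<sigma> t"
    then have "(s - t) *\<^sub>R (b - a) = 0" unfolding diff[symmetric] using fn[OF st(1)] fn[OF st(2)] by simp
    then show "s = t" using assms(1) by simp
  qed
  have cont: "continuous_on {0..1} (fn \<sigma>)"
    using continuous_on_linepath[of "{0..1}" a b] by (rule continuous_on_eq) (simp add: fn)
  show "jordan_arc_in X \<sigma>"
    unfolding jordan_arc_in_def path_in_def using inj cont seg assms(2)
    by (auto simp: lh) (simp add: \<sigma>_def)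
  \<comment> \<open>Chords of a segment are proportional to parameter lengths, which add up to 1
    over any division.\<close>
  have vs: "variation_sum \<sigma> D = dist a b" if D: "D division_of {0..1}" for D
  proof -
    have "variation_sum \<sigma> D = (\<Sum>k\<in>D. dist a b * measure lborel k)" unfolding variation_sum_def
    proof (rule sum.cong[OF refl])
      fix k assume k: "k \<in> D"
      obtain u v where uv: "k = {u..v}" using division_ofD(4)[OF D k] by auto
      have "k \<noteq> {}" "k \<subseteq> {0..1}" using division_ofD(2,3)[OF D k] by auto
      then have "u \<le> v" "0 \<le> u" "v \<le> 1" using uv by auto
      then show "norm (fn \<sigma> (Sup k) - fn \<sigma> (Inf k)) = dist a b * measure lborel k"
        using nd[of u v] uv by simp
    qed
    also have "\<dots> = dist a b * (\<Sum>k\<in>D. measure lborel k)" by (simp add: sum_distrib_left)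
    also have "(\<Sum>k\<in>D. measure lborel k) = 1" using additive_content_division[of D 0 "1::real"] D by simp
    finally show ?thesis by simp
  qed
  show "rectifiable \<sigma>" unfolding rectifiable_def lh
    by (rule bdd_aboveI[of _ "dist a b"]) (auto simp: vs)
  show "path_len \<sigma> \<le> dist a b" unfolding path_len_def lh
  proof (rule cSUP_least)
    show "{D. D division_of {0..1::real}} \<noteq> {}" using division_of_self[of 0 "1::real"] by auto
  qed (simp add: vs)
qed

section \<open>Density of the polynomials\<close>

lemma exists_poly_antiderivative:
  fixes p :: "complex poly"
  obtains P where "pderiv P = p"
proof
  have sum: "finite I \<Longrightarrow> pderiv (\<Sum>i\<in>I. f i) = (\<Sum>i\<in>I. pderiv (f i))" for f :: "nat \<Rightarrow> complex poly" and I
    by (induction I rule: finite_induct) (auto simp: pderiv_add)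
  have m: "pderiv (monom (coeff p i / of_nat (Suc i)) (Suc i)) = monom (coeff p i) i" for i
  proof -
    have "of_nat (Suc i) * (coeff p i / of_nat (Suc i)) = coeff p i"
      using of_nat_neq_0[of i, where 'a = complex] by (simp del: of_nat_Suc)
    then show ?thesis unfolding pderiv_monom by simp
  qed
  show "pderiv (\<Sum>i\<le>degree p. monom (coeff p i / of_nat (Suc i)) (Suc i)) = p"
    unfolding sum[OF finite_atMost] m by (rule poly_as_sum_of_monoms)
qed

definition smoothstep :: "complex poly" where "smoothstep = [:0, 0, 3, -2:]"

text \<open>The symmetry under w \<mapsto> 1 - w transfers the estimates from 0 to 1, so one small
  \<open>w\<close> handles both values of an indicator. Within 1/100 of 0 the value shrinks by half
  and the derivative is at most 1/2.\<close>

lemma smoothstep_near_0: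
  assumes "norm w \<le> s" "s \<le> 1/100"
  shows "norm (poly smoothstep w) \<le> s / 2" "norm (poly (pderiv smoothstep) w) \<le> 1/2"
    "poly smoothstep (1 - w) = 1 - poly smoothstep w"
    "poly (pderiv smoothstep) (1 - w) = poly (pderiv smoothstep) w"
proof -
  have s: "s \<ge> 0" using assms(1) norm_ge_zero order_trans by blast
  have q: "poly smoothstep w = w * (w * (3 - 2 * w))"
    by (simp add: smoothstep_def algebra_simps)
  have d: "poly (pderiv smoothstep) w = w * (6 - 6 * w)"
    by (simp add: smoothstep_def pderiv_pCons algebra_simps)
  have 3: "norm (3 - 2 * w) \<le> 4" and 6: "norm (6 - 6 * w) \<le> 7"
    using assms norm_triangle_ineq4[of 3 "2 * w"] norm_triangle_ineq4[of 6 "6 * w"]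
    by (simp_all add: norm_mult)
  have "norm (w * (3 - 2 * w)) \<le> 1/100 * 4"
    unfolding norm_mult using assms 3 by (intro mult_mono) auto
  then have "norm w * norm (w * (3 - 2 * w)) \<le> s * (1/100 * 4)"
    using assms(1) s by (intro mult_mono) simp_all
  moreover have "norm (poly smoothstep w) = norm w * norm (w * (3 - 2 * w))"
    unfolding q by (rule norm_mult)
  ultimately show "norm (poly smoothstep w) \<le> s / 2" using s by simp
  have "norm (w * (6 - 6 * w)) \<le> 1/100 * 7"
    unfolding norm_mult using assms 6 by (intro mult_mono) auto
  then show "norm (poly (pderiv smoothstep) w) \<le> 1/2" unfolding d by simp
  show "poly smoothstep (1 - w) = 1 - poly smoothstep w"
    by (simp add: smoothstep_def algebra_simps)
  show "poly (pderiv smoothstep) (1 - w) = poly (pderiv smoothstep) w"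
    by (simp add: smoothstep_def pderiv_pCons algebra_simps)
qed

text \<open>
  Composing an approximation of the indicator function with \<open>w \<mapsto> 3 w\<^sup>2 - 2 w\<^sup>3\<close>, whose derivative
  vanishes at \<open>0\<close> and \<open>1\<close>, again and again makes its derivative small as well.
\<close>

lemma clopen_indicator_poly:
  fixes X A :: "complex set"
  assumes X: "compact X" "connected (- X)"
    and A: "openin (top_of_set X) A" "closedin (top_of_set X) A" and "\<eta> > 0"
  obtains p where "\<And>z. z \<in> A \<Longrightarrow> norm (1 - poly p z) \<le> \<eta>" "\<And>z. z \<in> X - A \<Longrightarrow> norm (poly p z) \<le> \<eta>"
    "\<And>z. z \<in> X \<Longrightarrow> norm (poly (pderiv p) z) \<le> \<eta>"
proof -
  define f where "f z = (if z \<in> A then 1 else 0 :: complex)" for z :: complex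
  have AX: "A \<subseteq> X" "A \<union> (X - A) = X" using openin_imp_subset[OF A(1)] by auto
  have XA: "openin (top_of_set X) (X - A)" using A(2) by (simp add: closedin_def)
  have "continuous_on (A \<union> (X - A)) f" unfolding f_def
    by (rule continuous_on_cases_local_open) (use A(1) XA AX in auto)
  then have cont: "continuous_on X f" using AX by simp
  obtain T where T: "open T" "A = X \<inter> T" using A(1) by (auto simp: openin_open)
  obtain S where S: "open S" "X - A = X \<inter> S" using XA by (auto simp: openin_open)
  have "f holomorphic_on (interior X \<inter> T) \<union> (interior X \<inter> S)"
  proof (rule holomorphic_on_Un)
    show "f holomorphic_on interior X \<inter> T"
      by (rule holomorphic_transform[of "\<lambda>z. 1"]) (use T interior_subset[of X] in \<open>auto simp: f_def\<close>)
    show "f holomorphic_on interior X \<inter> S"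
      by (rule holomorphic_transform[of "\<lambda>z. 0"]) (use S interior_subset[of X] in \<open>auto simp: f_def\<close>)
  qed (use T S in auto)
  moreover have "(interior X \<inter> T) \<union> (interior X \<inter> S) = interior X"
    using T S AX interior_subset[of X] by blast
  ultimately have "poly_limit X f" using Mergelyan[OF X cont] by simp
  then obtain p where p: "\<And>z. z \<in> X \<Longrightarrow> norm (f z - poly p z) < 1/100"
    unfolding poly_limit_def by (meson divide_pos_pos zero_less_numeral zero_less_one)
  obtain B where B: "B > 0" "\<And>z. z \<in> X \<Longrightarrow> norm (poly (pderiv p) z) \<le> B"
    using poly_limit_bounded[OF X(1) poly_limit_poly] by metis
  define P where "P n = (pcompose smoothstep ^^ n) p" for n
  have P: "P 0 = p" "P (Suc n) = pcompose smoothstep (P n)" for n by (simp_all add: P_def)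
  \<comment> \<open>All bounds halve at each step: by the chain rule the derivative is multiplied by
    that of \<open>smoothstep\<close> near 0 or 1. The initial derivative bound \<open>B\<close> may
    be large, but it is fixed before \<open>n\<close> is chosen.\<close>
  have inv: "(z \<in> A \<longrightarrow> norm (1 - poly (P n) z) \<le> (1/100) / 2 ^ n) \<and>
      (z \<notin> A \<longrightarrow> norm (poly (P n) z) \<le> (1/100) / 2 ^ n) \<and> norm (poly (pderiv (P n)) z) \<le> B / 2 ^ n"
    if z: "z \<in> X" for z n
  proof (induction n)
    case 0
    then show ?case using p[OF z] B(2)[OF z] by (auto simp: P f_def)
  next
    case (Suc n)
    define s :: real where "s = (1/100) / 2 ^ n"
    have s: "s \<le> 1/100" unfolding s_def by (simp add: divide_le_eq)
    obtain w where w: "norm w \<le> s" and w': "poly (P n) z = (if z \<in> A then 1 - w else w)"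
      using Suc that[of "1 - poly (P n) z"] that[of "poly (P n) z"] unfolding s_def
      by (cases "z \<in> A") (auto intro: that)
    note st = smoothstep_near_0[OF w s]
    have e: "poly (P (Suc n)) z = (if z \<in> A then 1 - poly smoothstep w else poly smoothstep w)"
      using w' st(3) by (simp add: P poly_pcompose)
    have d: "poly (pderiv (P (Suc n))) z = poly (pderiv smoothstep) w * poly (pderiv (P n)) z"
      using w' st(4) by (simp add: P poly_pcompose pderiv_pcompose)
    have "norm (poly (pderiv (P (Suc n))) z) \<le> 1/2 * (B / 2 ^ n)"
      unfolding d norm_mult using Suc st(2) by (intro mult_mono) auto
    moreover have "norm (poly smoothstep w) \<le> (1/100) / 2 ^ Suc n" using st(1) by (simp add: s_def)
    ultimately show ?case using e by simp
  qed
  obtain n where n: "(1/2) ^ n < \<eta> / (B + 1)"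
    using real_arch_pow_inv[of "\<eta> / (B + 1)" "1/2"] \<open>\<eta> > 0\<close> B(1) by auto
  have "(B + 1) * (1/2) ^ n \<le> \<eta>" using n B(1) by (simp add: field_simps)
  moreover have "B / 2 ^ n \<le> (B + 1) * (1/2) ^ n" "(1/100) / 2 ^ n \<le> (B + 1) * (1/2) ^ n"
    unfolding power_one_over times_divide_eq_right mult_1_right
    using B(1) by (intro divide_right_mono; simp)+
  ultimately have le: "B / 2 ^ n \<le> \<eta>" "(1/100) / 2 ^ n \<le> \<eta>" by linarith+
  show ?thesis
  proof (rule that[of "P n"])
    show "norm (1 - poly (P n) z) \<le> \<eta>" if "z \<in> A" for z using inv[of z n] that le(2) AX(1) by (meson order_trans subsetD)
    show "norm (poly (P n) z) \<le> \<eta>" if "z \<in> X - A" for z using inv[of z n] that le(2) by (meson DiffD1 DiffD2 order_trans)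
    show "norm (poly (pderiv (P n)) z) \<le> \<eta>" if "z \<in> X" for z using inv[of z n] that le(1) by (meson order_trans)
  qed
qed

text \<open>
  A function that is nearly constant on each component is nearly constant on clopen neighbourhoods
  of the components; finitely many of these cover \<open>X\<close>.
\<close>

lemma approximate_nearly_locally_constant:
  fixes X :: "complex set" and u :: "complex \<Rightarrow> complex"
  assumes X: "compact X" "connected (- X)" and u: "continuous_on X u"
    and comp: "\<And>z w. connected_component X z w \<Longrightarrow> norm (u w - u z) < b" and \<eta>: "\<eta> > 0"
  obtains q where "\<And>z. z \<in> X \<Longrightarrow> norm (u z - poly q z) \<le> b + \<eta>" "\<And>z. z \<in> X \<Longrightarrow> norm (poly (pderiv q) z) \<le> \<eta>"
proof -
  have "\<exists>T. open T \<and> z \<in> T \<and> closedin (top_of_set X) (X \<inter> T) \<and> (\<forall>w\<in>X \<inter> T. norm (u w - u z) < b)" if z: "z \<in> X" for z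
  proof -
    define C where "C = connected_component_set X z"
    have "C \<in> components X" unfolding C_def using z by (simp add: componentsI)
    moreover have "compact C" using compact_components X(1) calculation by blast
    moreover have "locally compact X" using closed_imp_locally_compact compact_imp_closed[OF X(1)] by blast
    \<comment> \<open>The strict inequality makes this set relatively open. It contains the
      component \<open>C\<close>, so the Sura-Bura theorem places a clopen neighbourhood of
      \<open>C\<close> inside it.\<close>
    moreover have "openin (top_of_set X) (X \<inter> (\<lambda>w. norm (u w - u z)) -` {..<b})"
      by (intro continuous_openin_preimage_gen continuous_intros u)
    then obtain U where U: "open U" "X \<inter> (\<lambda>w. norm (u w - u z)) -` {..<b} = X \<inter> U" by (auto simp: openin_open)
    have "C \<subseteq> X" unfolding C_def by (rule connected_component_subset)
    moreover have "C \<subseteq> U"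
    proof
      fix w assume w: "w \<in> C"
      then have "w \<in> X \<inter> (\<lambda>w. norm (u w - u z)) -` {..<b}" using comp[of z w] \<open>C \<subseteq> X\<close> by (auto simp: C_def)
      then show "w \<in> U" using U(2) by blast
    qed
    ultimately obtain K where K: "openin (top_of_set X) K" "compact K" "C \<subseteq> K" "K \<subseteq> U"
      using Sura_Bura_clopen_subset[of X C U] U(1) by metis
    obtain T where T: "open T" "K = X \<inter> T" using K(1) by (auto simp: openin_open)
    have "z \<in> C" unfolding C_def using z by (simp add: connected_component_refl)
    then have "z \<in> T" using K(3) T(2) by blast
    moreover have "closedin (top_of_set X) (X \<inter> T)"
      using compact_imp_closed[OF K(2)] T(2) closed_subset[of K X] by auto
    moreover have "norm (u w - u z) < b" if "w \<in> X \<inter> T" for w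
    proof -
      have "w \<in> X \<inter> U" using that T(2) K(4) by blast
      then show ?thesis using U(2) by blast
    qed
    ultimately show ?thesis using T(1) by blast
  qed
  then obtain T where T: "\<And>z. z \<in> X \<Longrightarrow> open (T z)" "\<And>z. z \<in> X \<Longrightarrow> z \<in> T z"
    "\<And>z. z \<in> X \<Longrightarrow> closedin (top_of_set X) (X \<inter> T z)"
    "\<And>z w. z \<in> X \<Longrightarrow> w \<in> X \<inter> T z \<Longrightarrow> norm (u w - u z) < b"
    by metis
  have "X \<subseteq> (\<Union>z\<in>X. T z)" using T(2) by blast
  then obtain Z where Z: "Z \<subseteq> X" "finite Z" "X \<subseteq> (\<Union>z\<in>Z. T z)"
    using compactE_image[OF X(1), of X T] T(1) by metis
  \<comment> \<open>The claim concerns all of \<open>X\<close>: off the sets treated so far the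
    target is 0 without the allowance \<open>b\<close>, so each point pays \<open>b\<close> only
    once. \<eta> is quantified inside because every step passes half of it to the induction
    hypothesis.\<close>
  have "\<forall>\<eta>>0. \<exists>q. \<forall>w\<in>X. norm (poly (pderiv q) w) \<le> \<eta> \<and>
      norm ((if w \<in> (\<Union>z\<in>Z. T z) then u w else 0) - poly q w) \<le> (if w \<in> (\<Union>z\<in>Z. T z) then b else 0) + \<eta>"
    using Z(2,1)
  proof (induction Z rule: finite_induct)
    case empty
    then show ?case by (intro allI impI exI[of _ 0]) auto
  next
    case (insert z Z)
    have z: "z \<in> X" and ZX: "Z \<subseteq> X" using insert.prems by auto
    show ?case
    proof (intro allI impI)
      fix \<eta> :: real assume \<eta>: "\<eta> > 0"
      define N where "N = (\<Union>z\<in>Z. T z)"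
      have "\<eta> / 2 > 0" using \<eta> by simp
      then obtain q where q: "\<And>w. w \<in> X \<Longrightarrow> norm (poly (pderiv q) w) \<le> \<eta> / 2"
        "\<And>w. w \<in> X \<Longrightarrow> norm ((if w \<in> N then u w else 0) - poly q w) \<le> (if w \<in> N then b else 0) + \<eta> / 2"
        using insert.IH[OF ZX] unfolding N_def by meson
      \<comment> \<open>The part of \<open>T z\<close> not yet covered: clopen, and disjoint from
        the region where \<open>q\<close> already approximates \<open>u\<close>.\<close>
      define A where "A = X \<inter> T z - X \<inter> N"
      define K where "K = norm (u z) + 1"
      define \<theta> where "\<theta> = \<eta> / (2 * K)"
      have \<theta>: "\<theta> > 0" "norm (u z) * \<theta> \<le> \<eta> / 2"
      proof -
        have pos: "K > 0" by (simp add: K_def add_nonneg_pos)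
        then show "\<theta> > 0" using \<eta> by (simp add: \<theta>_def)
        have "norm (u z) * \<theta> \<le> K * \<theta>" using \<open>\<theta> > 0\<close> by (simp add: K_def)
        also have "\<dots> = \<eta> / 2" using pos by (simp add: \<theta>_def)
        finally show "norm (u z) * \<theta> \<le> \<eta> / 2" .
      qed
      have N: "openin (top_of_set X) (X \<inter> N)" "closedin (top_of_set X) (X \<inter> N)"
      proof -
        show "openin (top_of_set X) (X \<inter> N)" unfolding N_def using T(1) ZX by (intro openin_open_Int open_UN) auto
        have eq: "X \<inter> N = (\<Union>z\<in>Z. X \<inter> T z)" by (auto simp: N_def)
        show "closedin (top_of_set X) (X \<inter> N)"
          unfolding eq by (rule closedin_Union) (use T(3) ZX insert.hyps(1) in auto)
      qed
      have A: "openin (top_of_set X) A" "closedin (top_of_set X) A"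
        unfolding A_def using N T(1,3)[OF z] by (auto intro!: openin_diff closedin_diff openin_open_Int)
      obtain p where p: "\<And>w. w \<in> A \<Longrightarrow> norm (1 - poly p w) \<le> \<theta>" "\<And>w. w \<in> X - A \<Longrightarrow> norm (poly p w) \<le> \<theta>"
        "\<And>w. w \<in> X \<Longrightarrow> norm (poly (pderiv p) w) \<le> \<theta>"
        using clopen_indicator_poly[OF X A \<theta>(1)] by metis
      define Q where "Q = q + smult (u z) p"
      have small: "norm (u z * x) \<le> \<eta> / 2" if "norm x \<le> \<theta>" for x
        using \<theta>(2) mult_left_mono[OF that, of "norm (u z)"] by (simp add: norm_mult)
      have Un: "(\<Union>z\<in>insert z Z. T z) = T z \<union> N" by (simp add: N_def)
      have "norm (poly (pderiv Q) w) \<le> \<eta> \<and>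
          norm ((if w \<in> T z \<union> N then u w else 0) - poly Q w) \<le> (if w \<in> T z \<union> N then b else 0) + \<eta>"
        if w: "w \<in> X" for w
      proof
        show "norm (poly (pderiv Q) w) \<le> \<eta>"
          using norm_triangle_mono[OF q(1)[OF w] small[OF p(3)[OF w]]]
          by (simp add: Q_def pderiv_add pderiv_smult)
        show "norm ((if w \<in> T z \<union> N then u w else 0) - poly Q w) \<le> (if w \<in> T z \<union> N then b else 0) + \<eta>"
        proof (cases "w \<in> A")
          case True
          then have wN: "w \<notin> N" "w \<in> T z" using w by (auto simp: A_def)
          have q0: "norm (- poly q w) \<le> \<eta> / 2" using q(2)[OF w] wN by simp
          have "u w - poly Q w = (u w - u z) + (- poly q w + u z * (1 - poly p w))"
            by (simp add: Q_def algebra_simps)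
          also have "norm \<dots> \<le> b + (\<eta> / 2 + \<eta> / 2)"
            using T(4)[OF z, of w] w wN q0 small[OF p(1)[OF True]] by (intro norm_triangle_mono) auto
          finally show ?thesis using wN by simp
        next
          case False
          then have wT: "w \<in> T z \<union> N \<longleftrightarrow> w \<in> N" using w by (auto simp: A_def)
          have "(if w \<in> N then u w else 0) - poly Q w = ((if w \<in> N then u w else 0) - poly q w) - u z * poly p w"
            by (simp add: Q_def algebra_simps)
          also have "norm \<dots> \<le> ((if w \<in> N then b else 0) + \<eta> / 2) + \<eta> / 2"
            by (rule order_trans[OF norm_triangle_ineq4 add_mono[OF q(2)[OF w] small[OF p(2)]]]) (use w False in auto)
          finally show ?thesis unfolding wT by simp
        qed
      qed
      then show "\<exists>q. \<forall>w\<in>X. norm (poly (pderiv q) w) \<le> \<eta> \<and>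
        norm ((if w \<in> (\<Union>z\<in>insert z Z. T z) then u w else 0) - poly q w) \<le> (if w \<in> (\<Union>z\<in>insert z Z. T z) then b else 0) + \<eta>"
        unfolding Un by blast
    qed
  qed
  then obtain q where q: "\<forall>w\<in>X. norm (poly (pderiv q) w) \<le> \<eta> \<and>
      norm ((if w \<in> (\<Union>z\<in>Z. T z) then u w else 0) - poly q w) \<le> (if w \<in> (\<Union>z\<in>Z. T z) then b else 0) + \<eta>"
    using \<eta> by meson
  show ?thesis
  proof (rule that[of q])
    fix z assume z: "z \<in> X"
    then have "z \<in> (\<Union>z\<in>Z. T z)" using Z(3) by blast
    then show "norm (u z - poly q z) \<le> b + \<eta>" "norm (poly (pderiv q) z) \<le> \<eta>"
      using q[rule_format, OF z] by (simp_all only: if_True)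
  qed
qed

section \<open>Uniqueness of \<open>F\<close>-derivatives and comparison with ordinary
  derivatives\<close>

lemma perfect_islimpt: "perfect X \<Longrightarrow> a \<in> X \<Longrightarrow> a islimpt X"
  by (auto simp: perfect_def isolated_in_islimpt_iff)

text \<open>No point of a perfect set is isolated, so the filter is nontrivial and
  \<open>Lim\<close> returns the derivative.\<close>

lemma cderiv_eq:
  assumes "perfect X" "a \<in> X" "(f has_field_derivative D) (at a within X)"
  shows "cderiv X f a = D"
  unfolding cderiv_def using assms perfect_islimpt[OF assms(1,2)]
  by (intro tendsto_Lim) (auto simp: trivial_limit_within has_field_derivative_iff)

text \<open>The difference of two candidates has integral 0 over every path in \<open>F\<close> and
  over its subarcs, which belong to \<open>F\<close> as well. It therefore vanishes on the images,
  and on \<open>X\<close> by continuity. This gives \<open>THE\<close> in \<open>F_deriv\<close> its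
  meaning.\<close>

lemma F_derivative_unique:
  assumes F: "useful X F" "closure (\<Union>\<gamma>\<in>F. image_of \<gamma>) = X"
    and g: "F_derivative F X f g" and h: "F_derivative F X f h"
  shows "g = h"
proof -
  define d where "d z = g z - h z" for z
  have gh: "g \<in> extensional X" "h \<in> extensional X" "continuous_on X g" "continuous_on X h"
    using g h by (auto simp: F_derivative_def C_space_def)
  have dc: "continuous_on X d" unfolding d_def by (intro continuous_intros gh)
  have int0: "has_path_integral d 0 \<gamma>" if "\<gamma> \<in> F" for \<gamma>
    using has_path_integral_diff[of g "f (end_pt \<gamma>) - f (start_pt \<gamma>)" \<gamma> h "f (end_pt \<gamma>) - f (start_pt \<gamma>)"] g h that
    by (simp add: F_derivative_def d_def[abs_def])
  have "d z = 0" if z: "z \<in> (\<Union>\<gamma>\<in>F. image_of \<gamma>)" for z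
  proof -
    obtain \<gamma> t where \<gamma>: "\<gamma> \<in> F" "t \<in> {lo \<gamma>..hi \<gamma>}" "z = fn \<gamma> t"
      using z unfolding image_of_def by blast
    have "d (fn \<gamma> t) = 0"
      by (rule vanishing_subarc_integrals[OF _ _ dc _ \<gamma>(2)]) (use F(1) \<gamma>(1) int0 in \<open>auto simp: useful_def\<close>)
    then show ?thesis using \<gamma>(3) by simp
  qed
  then have "d z = 0" if "z \<in> X" for z
    using continuous_constant_on_closure[of "\<Union>\<gamma>\<in>F. image_of \<gamma>" d 0 z] F(2) dc that by metis
  then show ?thesis using gh by (intro extensionalityI[of _ X]) (auto simp: d_def)
qed

lemma F_deriv_eq:
  assumes "useful X F" "closure (\<Union>\<gamma>\<in>F. image_of \<gamma>) = X" "F_derivative F X f g"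
  shows "F_deriv F X f = g"
  unfolding F_deriv_def using F_derivative_unique[OF assms(1,2)] assms(3) by (blast intro: the_equality)

lemma useful_path_in: "useful X F \<Longrightarrow> \<gamma> \<in> F \<Longrightarrow> path_in X \<gamma> \<and> rectifiable \<gamma>"
  by (auto simp: useful_def jordan_arc_in_def)

lemma path_in_endpoints: "path_in X \<gamma> \<Longrightarrow> start_pt \<gamma> \<in> X \<and> end_pt \<gamma> \<in> X"
  by (auto simp: path_in_def start_pt_def end_pt_def image_subset_iff)

lemma F_derivative_of_derivative:
  assumes F: "useful X F" and f: "\<And>z. z \<in> X \<Longrightarrow> (f has_field_derivative f' z) (at z within X)" "continuous_on X f'"
  shows "F_derivative F X f (restrict f' X)"
proof -
  have "has_path_integral (restrict f' X) (f (end_pt \<gamma>) - f (start_pt \<gamma>)) \<gamma>" if "\<gamma> \<in> F" for \<gamma>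
  proof (rule has_path_integral_cong)
    show "has_path_integral f' (f (end_pt \<gamma>) - f (start_pt \<gamma>)) \<gamma>" "path_in X \<gamma>"
      using has_path_integral_derivative[of X \<gamma> f f'] useful_path_in[OF F that] f by blast+
  qed simp
  moreover have "continuous_on X (restrict f' X)" using f(2) by (rule continuous_on_eq) simp
  ultimately show ?thesis by (simp add: F_derivative_def C_space_def)
qed

lemma D1_F_derivative:
  assumes X: "perfect X" and F: "useful X F" and f: "f \<in> D1_space X"
  shows "F_derivative F X f (restrict (cderiv X f) X)" "f \<in> DF_space F X"
proof -
  have d: "(f has_field_derivative cderiv X f z) (at z within X)" if z: "z \<in> X" for z
  proof -
    obtain D where "(f has_field_derivative D) (at z within X)"
      using f z by (auto simp: D1_space_def field_differentiable_def)
    then show ?thesis using cderiv_eq[OF X z] by simp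
  qed
  show g: "F_derivative F X f (restrict (cderiv X f) X)"
    using F_derivative_of_derivative[OF F d] f by (simp add: D1_space_def)
  have "continuous_on X f"
    using d by (meson DERIV_continuous continuous_on_eq_continuous_within)
  then show "f \<in> DF_space F X" using g f by (auto simp: DF_space_def C_space_def D1_space_def)
qed

lemma poly_D1:
  assumes X: "perfect X"
  shows "(\<lambda>z\<in>X. poly p z) \<in> D1_space X" "\<And>z. z \<in> X \<Longrightarrow> cderiv X (\<lambda>z\<in>X. poly p z) z = poly (pderiv p) z"
proof -
  have d: "((\<lambda>z\<in>X. poly p z) has_field_derivative poly (pderiv p) z) (at z within X)" if "z \<in> X" for z
    by (rule has_field_derivative_transform_within[OF has_field_derivative_at_within[OF poly_DERIV] zero_less_one that]) simp
  then show c: "cderiv X (\<lambda>z\<in>X. poly p z) z = poly (pderiv p) z" if "z \<in> X" for z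
    using cderiv_eq[OF X that] that by blast
  have "continuous_on X (cderiv X (\<lambda>z\<in>X. poly p z))"
    by (rule continuous_on_eq[of _ "poly (pderiv p)"]) (auto intro: continuous_intros simp: c)
  then show "(\<lambda>z\<in>X. poly p z) \<in> D1_space X"
    using d by (auto simp: D1_space_def field_differentiable_def)
qed

lemma F_derivative_diff:
  assumes F: "useful X F" and g: "F_derivative F X f g" and h: "F_derivative F X f1 h"
  shows "F_derivative F X (\<lambda>z\<in>X. f z - f1 z) (\<lambda>z\<in>X. g z - h z)"
proof -
  have gh: "continuous_on X g" "continuous_on X h" using g h by (auto simp: F_derivative_def C_space_def)
  have "continuous_on X (\<lambda>z\<in>X. g z - h z)"
    by (rule continuous_on_eq[of _ "\<lambda>z. g z - h z"]) (auto intro!: continuous_intros gh)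
  moreover have "has_path_integral (\<lambda>z\<in>X. g z - h z) ((\<lambda>z\<in>X. f z - f1 z) (end_pt \<gamma>) - (\<lambda>z\<in>X. f z - f1 z) (start_pt \<gamma>)) \<gamma>"
    if "\<gamma> \<in> F" for \<gamma>
  proof (rule has_path_integral_cong)
    show p: "path_in X \<gamma>" using useful_path_in[OF F that] by blast
    have "has_path_integral (\<lambda>z. g z - h z) ((f (end_pt \<gamma>) - f (start_pt \<gamma>)) - (f1 (end_pt \<gamma>) - f1 (start_pt \<gamma>))) \<gamma>"
      using g h that by (intro has_path_integral_diff) (auto simp: F_derivative_def)
    then show "has_path_integral (\<lambda>z. g z - h z) ((\<lambda>z\<in>X. f z - f1 z) (end_pt \<gamma>) - (\<lambda>z\<in>X. f z - f1 z) (start_pt \<gamma>)) \<gamma>"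
      using path_in_endpoints[OF p] by (simp add: algebra_simps)
  qed simp
  ultimately show ?thesis by (simp add: F_derivative_def C_space_def)
qed

lemma sup_norm_le: "X \<noteq> {} \<Longrightarrow> (\<And>z. z \<in> X \<Longrightarrow> norm (f z) \<le> B) \<Longrightarrow> sup_norm X f \<le> B"
  unfolding sup_norm_def by (rule cSUP_least)

text \<open>Short segments inside \<open>X\<close> belong to \<open>F\<close>, so \<open>g\<close> is an ordinary derivative of \<open>f\<close> in the interior.\<close>

lemma F_derivative_holomorphic:
  assumes g: "F_derivative F X f g" and "r > 0"
    and short: "\<forall>\<gamma>. jordan_arc_in X \<gamma> \<and> rectifiable \<gamma> \<and> path_len \<gamma> \<le> r \<longrightarrow> \<gamma> \<in> F"
  shows "g holomorphic_on interior X"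
proof -
  have gc: "continuous_on X g" using g by (simp add: F_derivative_def C_space_def)
  have d: "(f has_field_derivative g z) (at z)" if z: "z \<in> interior X" for z
  proof -
    have "(f has_derivative (\<lambda>h. g z * h)) (at z)"
      unfolding has_derivative_within_alt
    proof (intro conjI allI impI)
      fix e :: real assume e: "e > 0"
      obtain \<rho> where \<rho>: "\<rho> > 0" "ball z \<rho> \<subseteq> X" using z mem_interior by blast
      have "z \<in> X" using z interior_subset by blast
      then obtain \<delta> where \<delta>: "\<delta> > 0" "\<And>w. w \<in> X \<Longrightarrow> dist w z < \<delta> \<Longrightarrow> dist (g w) (g z) < e"
        using gc e unfolding continuous_on_iff by metis
      \<comment> \<open>Within \<open>s\<close> of \<open>z\<close> the segment lies in
        \<open>X\<close>, \<open>g\<close> varies by less than \<open>e\<close>, and the segment is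
        short enough to belong to \<open>F\<close>.\<close>
      define s where "s = min (min \<rho> \<delta>) r"
      have s: "s > 0" "s \<le> \<rho>" "s \<le> \<delta>" "s \<le> r" using \<rho> \<delta> \<open>r > 0\<close> by (auto simp: s_def)
      have "norm (f w - f z - g z * (w - z)) \<le> e * norm (w - z)" if w: "norm (w - z) < s" for w
      proof (cases "w = z")
        case False
        have "closed_segment z w \<subseteq> ball z s"
          using w s by (intro closed_segment_subset) (auto simp: dist_norm norm_minus_commute)
        then have seg: "closed_segment z w \<subseteq> X" "\<And>x. x \<in> closed_segment z w \<Longrightarrow> dist x z < \<delta>"
          using \<rho>(2) s by (auto simp: subset_iff dist_commute)
        define \<sigma> where "\<sigma> = Plane_Path 0 1 (restrict (linepath z w) {0..1})"
        have \<sigma>: "jordan_arc_in X \<sigma>" "rectifiable \<sigma>" "path_len \<sigma> \<le> dist z w"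
            "variation_bound (\<lambda>t. dist z w * t) (fn \<sigma>) 0 1" "start_pt \<sigma> = z" "end_pt \<sigma> = w"
            "lo \<sigma> = 0" "hi \<sigma> = 1" "\<And>t. t \<in> {0..1} \<Longrightarrow> fn \<sigma> t \<in> closed_segment z w"
          using segment_path[OF _ seg(1)] False unfolding \<sigma>_def by blast+
        have "\<sigma> \<in> F" using short \<sigma>(1-3) w s by (auto simp: dist_norm norm_minus_commute)
        then have I: "has_path_integral g (f w - f z) \<sigma>" using g \<sigma>(5,6) by (auto simp: F_derivative_def)
        have "norm (f w - f z - g z * (end_pt \<sigma> - start_pt \<sigma>)) \<le> e * (dist z w * hi \<sigma> - dist z w * lo \<sigma>)"
        proof (rule has_path_integral_near_const[OF I])
          fix t assume "lo \<sigma> \<le> t" "t \<le> hi \<sigma>"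
          then have "fn \<sigma> t \<in> closed_segment z w" using \<sigma>(7-9) by simp
          then have "dist (g (fn \<sigma> t)) (g z) < e" using \<delta>(2) seg by blast
          then show "norm (g (fn \<sigma> t) - g z) \<le> e" by (simp add: dist_norm)
        qed (use \<sigma> in auto)
        then show ?thesis using \<sigma> by (simp add: dist_norm norm_minus_commute)
      qed simp
      then show "\<exists>d>0. \<forall>y\<in>UNIV. norm (y - z) < d \<longrightarrow> norm (f y - f z - g z * (y - z)) \<le> e * norm (y - z)"
        using s(1) by blast
    qed (rule bounded_linear_mult_right)
    then show ?thesis by (simp add: has_field_derivative_def)
  qed
  \<comment> \<open>So far \<open>g\<close> is only the derivative of \<open>f\<close>; it is
    holomorphic because derivatives of holomorphic functions are.\<close>
  then have "f holomorphic_on interior X" by (auto simp: holomorphic_on_open)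
  then have "deriv f holomorphic_on interior X" by (rule holomorphic_deriv) simp
  then show ?thesis by (rule holomorphic_transform) (simp add: DERIV_imp_deriv d)
qed

lemma polynomials_dense:
  fixes X :: "complex set" and r :: real and F :: "plane_path set"
  assumes X: "perfect X" "compact X" "connected (- X)" and "r > 0" and F: "useful X F"
    and dense: "closure (\<Union>\<gamma>\<in>F. image_of \<gamma>) = X" and bdd: "bdd_above (path_len ` F)"
    and join: "\<forall>z\<in>X. \<forall>w\<in>X. z \<noteq> w \<and> connected_component X z w \<longrightarrow>
           (\<exists>\<gamma>\<in>F. {start_pt \<gamma>, end_pt \<gamma>} = {z, w})"
    and short: "\<forall>\<gamma>. jordan_arc_in X \<gamma> \<and> rectifiable \<gamma> \<and> path_len \<gamma> \<le> r \<longrightarrow> \<gamma> \<in> F"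
    and f: "f \<in> DF_space F X" and e: "e > 0"
  shows "\<exists>p. DF_norm F X (\<lambda>z\<in>X. f z - (\<lambda>z\<in>X. poly p z) z) < e"
proof -
  have ne: "X \<noteq> {}" using X(1) by (simp add: perfect_def)
  obtain g where g: "F_derivative F X f g" and fc: "continuous_on X f"
    using f by (auto simp: DF_space_def C_space_def)
  obtain L0 where L0: "\<And>\<gamma>. \<gamma> \<in> F \<Longrightarrow> path_len \<gamma> \<le> L0" using bdd by (auto simp: bdd_above_def)
  \<comment> \<open>The added 1 makes \<open>L\<close> positive and strictly larger than all
    lengths, since \<open>approximate_nearly_locally_constant\<close> takes a strict bound.\<close>
  define L where "L = max L0 0 + 1"
  have L: "L > 0" "\<And>\<gamma>. \<gamma> \<in> F \<Longrightarrow> path_len \<gamma> < L" using L0 by (fastforce simp: L_def)+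
  \<comment> \<open>The final polynomial is within \<epsilon> L + \<epsilon> of \<open>f\<close> and
    its derivative within 2 \<epsilon> of \<open>g\<close>; the total \<epsilon> (L + 3) is less
    than \<open>e\<close>.\<close>
  define \<epsilon> where "\<epsilon> = e / (L + 4)"
  have \<epsilon>: "\<epsilon> > 0" "\<epsilon> * (L + 4) = e" using e L by (auto simp: \<epsilon>_def)
  have gc: "continuous_on X g" using g by (simp add: F_derivative_def C_space_def)
  have "poly_limit X g"
    by (rule Mergelyan[OF X(2,3) gc F_derivative_holomorphic[OF g \<open>r > 0\<close> short]])
  then obtain p where p: "\<And>z. z \<in> X \<Longrightarrow> norm (g z - poly p z) < \<epsilon>"
    unfolding poly_limit_def using \<epsilon>(1) by blast
  obtain P where P: "pderiv P = p" using exists_poly_antiderivative by blast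
  define u where "u z = f z - poly P z" for z
  have uc: "continuous_on X u" unfolding u_def by (intro continuous_intros fc)
  have poly_F: "F_derivative F X (\<lambda>z\<in>X. poly q z) (\<lambda>z\<in>X. poly (pderiv q) z)" for q
  proof -
    have "restrict (cderiv X (\<lambda>z\<in>X. poly q z)) X = (\<lambda>z\<in>X. poly (pderiv q) z)"
      by (rule restrict_ext) (rule poly_D1(2)[OF X(1)])
    then show ?thesis using D1_F_derivative(1)[OF X(1) F poly_D1(1)[OF X(1), of q]] by simp
  qed
  have uF: "F_derivative F X (\<lambda>z\<in>X. f z - (\<lambda>z\<in>X. poly P z) z) (\<lambda>z\<in>X. g z - (\<lambda>z\<in>X. poly p z) z)"
    using F_derivative_diff[OF F g poly_F[of P]] P by simp
  have small: "norm (u (end_pt \<gamma>) - u (start_pt \<gamma>)) < \<epsilon> * L" if \<gamma>: "\<gamma> \<in> F" for \<gamma>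
  proof -
    have pg: "path_in X \<gamma>" "rectifiable \<gamma>" using useful_path_in[OF F \<gamma>] by auto
    then have lh: "lo \<gamma> < hi \<gamma>" by (simp add: path_in_def)
    obtain W where W: "variation_bound W (fn \<gamma>) (lo \<gamma>) (hi \<gamma>)" "W (hi \<gamma>) - W (lo \<gamma>) \<le> path_len \<gamma>"
      using rectifiable_variation_bound[OF pg(2) lh] by metis
    have I: "has_path_integral (\<lambda>z\<in>X. g z - (\<lambda>z\<in>X. poly p z) z) (u (end_pt \<gamma>) - u (start_pt \<gamma>)) \<gamma>"
    proof -
      have "start_pt \<gamma> \<in> X" "end_pt \<gamma> \<in> X" using path_in_endpoints[OF pg(1)] by auto
      then have "u (end_pt \<gamma>) - u (start_pt \<gamma>)
          = (\<lambda>z\<in>X. f z - (\<lambda>z\<in>X. poly P z) z) (end_pt \<gamma>) - (\<lambda>z\<in>X. f z - (\<lambda>z\<in>X. poly P z) z) (start_pt \<gamma>)"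
        by (simp add: u_def)
      then show ?thesis using uF \<gamma> by (simp only: F_derivative_def)
    qed
    have "norm (u (end_pt \<gamma>) - u (start_pt \<gamma>) - 0 * (end_pt \<gamma> - start_pt \<gamma>)) \<le> \<epsilon> * (W (hi \<gamma>) - W (lo \<gamma>))"
    proof (rule has_path_integral_near_const[OF I less_imp_le[OF lh] W(1)])
      fix t assume "lo \<gamma> \<le> t" "t \<le> hi \<gamma>"
      then have "fn \<gamma> t \<in> X" using pg(1) by (auto simp: path_in_def image_subset_iff)
      then show "norm ((\<lambda>z\<in>X. g z - (\<lambda>z\<in>X. poly p z) z) (fn \<gamma> t) - 0) \<le> \<epsilon>" using p by (simp add: less_imp_le)
    qed
    also have "\<dots> < \<epsilon> * L" using W(2) L(2)[OF \<gamma>] \<epsilon>(1) by (intro mult_strict_left_mono) auto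
    finally show ?thesis by simp
  qed
  have comp: "norm (u w - u z) < \<epsilon> * L" if zw: "connected_component X z w" for z w
  proof (cases "z = w")
    case True then show ?thesis using \<epsilon>(1) L(1) by simp
  next
    case False
    have "z \<in> X" "w \<in> X" using connected_component_in[OF zw] by auto
    then obtain \<gamma> where \<gamma>: "\<gamma> \<in> F" "{start_pt \<gamma>, end_pt \<gamma>} = {z, w}" using join zw False by blast
    then have "start_pt \<gamma> = z \<and> end_pt \<gamma> = w \<or> start_pt \<gamma> = w \<and> end_pt \<gamma> = z"
      by (auto simp: doubleton_eq_iff)
    then show ?thesis using small[OF \<gamma>(1)] by (auto simp: norm_minus_commute)
  qed
  obtain q where q: "\<And>z. z \<in> X \<Longrightarrow> norm (u z - poly q z) \<le> \<epsilon> * L + \<epsilon>" "\<And>z. z \<in> X \<Longrightarrow> norm (poly (pderiv q) z) \<le> \<epsilon>"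
    using approximate_nearly_locally_constant[OF X(2,3) uc comp \<epsilon>(1)] by metis
  define h where "h = P + q"
  have hF: "F_derivative F X (\<lambda>z\<in>X. f z - (\<lambda>z\<in>X. poly h z) z) (\<lambda>z\<in>X. g z - (\<lambda>z\<in>X. poly (pderiv h) z) z)"
    by (rule F_derivative_diff[OF F g poly_F])
  have "sup_norm X (\<lambda>z\<in>X. f z - (\<lambda>z\<in>X. poly h z) z) \<le> \<epsilon> * L + \<epsilon>"
    using q(1) by (intro sup_norm_le[OF ne]) (simp add: u_def h_def algebra_simps)
  moreover have "sup_norm X (\<lambda>z\<in>X. g z - (\<lambda>z\<in>X. poly (pderiv h) z) z) \<le> \<epsilon> + \<epsilon>"
  proof (rule sup_norm_le[OF ne])
    fix z assume z: "z \<in> X"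
    have "norm ((g z - poly p z) - poly (pderiv q) z) \<le> \<epsilon> + \<epsilon>"
      by (rule order_trans[OF norm_triangle_ineq4 add_mono[OF less_imp_le[OF p[OF z]] q(2)[OF z]]])
    then show "norm ((\<lambda>z\<in>X. g z - (\<lambda>z\<in>X. poly (pderiv h) z) z) z) \<le> \<epsilon> + \<epsilon>"
      using z P by (simp add: h_def pderiv_add algebra_simps)
  qed
  ultimately have "DF_norm F X (\<lambda>z\<in>X. f z - (\<lambda>z\<in>X. poly h z) z) \<le> \<epsilon> * L + 3 * \<epsilon>"
    unfolding DF_norm_def F_deriv_eq[OF F dense hF] by linarith
  also have "\<dots> < e" using \<epsilon> by (simp add: distrib_left)
  finally show ?thesis by blast
qed

theorem theorem5p8:
  fixes X :: "complex set" and r :: real and F :: "plane_path set"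
  assumes "perfect X" and "compact X" and "connected (- X)" and "r > 0"
    and "useful X F"
    and "closure (\<Union>\<gamma>\<in>F. image_of \<gamma>) = X"
    and "bdd_above (path_len ` F)"
    and "\<forall>z\<in>X. \<forall>w\<in>X. z \<noteq> w \<and> connected_component X z w \<longrightarrow>
           (\<exists>\<gamma>\<in>F. {start_pt \<gamma>, end_pt \<gamma>} = {z, w})"
    and "\<forall>\<gamma>. jordan_arc_in X \<gamma> \<and> rectifiable \<gamma> \<and> path_len \<gamma> \<le> r \<longrightarrow> \<gamma> \<in> F"
  shows "DF_space F X = D_R F X \<and> D_R F X = D_P F X \<and> DF_completes_D1 F X"
proof -
  have poly_D1: "polynomial_funs X \<subseteq> D1_space X"
    using poly_D1(1)[OF assms(1)] by (auto simp: polynomial_funs_def)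
  have D1_DF: "D1_space X \<subseteq> DF_space F X"
    using D1_F_derivative(2)[OF assms(1,5)] by blast
  have mono: "DF_closure F X S \<subseteq> DF_closure F X T" if "S \<subseteq> T" for S T
    using that unfolding DF_closure_def by blast
  have closure_DF: "DF_closure F X S \<subseteq> DF_space F X" for S
    by (auto simp: DF_closure_def)
  \<comment> \<open>All equalities follow from this inclusion: polynomials are rational functions
    and belong to \<open>D1_space\<close>, closures are monotone, and they stay inside
    \<open>DF_space\<close>.\<close>
  have P: "DF_space F X \<subseteq> D_P F X"
  proof
    fix f assume f: "f \<in> DF_space F X"
    have "\<exists>h \<in> polynomial_funs X \<inter> DF_space F X. DF_norm F X (\<lambda>z\<in>X. f z - h z) < e" if e: "e > 0" for e
    proof -
      obtain p where "DF_norm F X (\<lambda>z\<in>X. f z - (\<lambda>z\<in>X. poly p z) z) < e"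
        using polynomials_dense[OF assms f e] by blast
      moreover have "(\<lambda>z\<in>X. poly p z) \<in> polynomial_funs X" by (auto simp: polynomial_funs_def)
      ultimately show ?thesis using poly_D1 D1_DF by blast
    qed
    then show "f \<in> D_P F X" using f by (simp add: D_P_def DF_closure_def)
  qed
  have "polynomial_funs X \<subseteq> rational_funs X"
  proof
    fix h assume "h \<in> polynomial_funs X"
    then obtain p where "h = (\<lambda>z\<in>X. poly p z)" by (auto simp: polynomial_funs_def)
    then have "h = (\<lambda>z\<in>X. poly p z / poly 1 z)" "\<forall>z\<in>X. poly 1 z \<noteq> (0::complex)" by simp_all
    then show "h \<in> rational_funs X" unfolding rational_funs_def by blast
  qed
  then have "D_P F X \<subseteq> D_R F X" unfolding D_P_def D_R_def by (rule mono)
  moreover have "D_P F X \<subseteq> DF_closure F X (D1_space X)" unfolding D_P_def by (rule mono[OF poly_D1])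
  moreover have "DF_norm F X f = D1_norm X f" if f: "f \<in> D1_space X" for f
  proof -
    have "F_deriv F X f = restrict (cderiv X f) X"
      by (rule F_deriv_eq[OF assms(5,6) D1_F_derivative(1)[OF assms(1,5) f]])
    moreover have "sup_norm X (restrict (cderiv X f) X) = sup_norm X (cderiv X f)"
      unfolding sup_norm_def by (rule SUP_cong) auto
    ultimately show ?thesis by (simp add: DF_norm_def D1_norm_def)
  qed
  moreover have "D_R F X \<subseteq> DF_space F X" "D_P F X \<subseteq> DF_space F X"
    unfolding D_R_def D_P_def by (rule closure_DF)+
  ultimately show ?thesis
    using P D1_DF closure_DF[of "D1_space X"] unfolding DF_completes_D1_def by blast
qed

end
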